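(* (a) For every fixed integer $s\geq 4$, $OSH_3(s,n)\leq 2^{n^{o(1)}}$; that is, for every $\varepsilon>0$ there is $n_0$ such that $OSH_3(s,n)\le 2^{n^{\varepsilon}}$ for all $n\ge n_0$. (b) For fixed integers $d\geq 4$ and $s\geq d+1$, $OSH_d(s,n)\leq \mathrm{twr}_{d-1}(n^{o(1)})$; that is, for every $\varepsilon>0$ there is $n_0$ such that $OSH_d(s,n)\le \mathrm{twr}_{d-1}(n^{\varepsilon})$ for all $n\ge n_0$.
   Context: A finite set of hyperplanes in $\mathbb{R}^d$ is in general position if every $d$ of its members intersect in a single point, distinct for distinct $d$-tuples. For such a set, its vertex set is the set of these intersection points; the vertex set lies above (below) the hyperplane $x_d=0$ if every such intersection point has positive (negative) $d$-th coordinate. $OSH_d(s,n)$ is the smallest integer $N$ such that every set $H$ of $N$ hyperplanes in $\mathbb{R}^d$ in general position contains $s$ members whose vertex set lies above $x_d=0$, or $n$ members whose vertex set lies below $x_d=0$. The tower function is $\mathrm{twr}_1(x)=x$, $\mathrm{twr}_{i+1}(x)=2^{\mathrm{twr}_i(x)}$. *)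

theory Defs
  imports Complex_Main "HOL-Library.Extended_Real" "Jordan_Normal_Form.Matrix"
begin

text \<open>Euclidean \<open>d\<close>-space is \<open>carrier_vec d :: real vec set\<close>. Vector indices start at 0, so the
  \<open>d\<close>-th coordinate of \<open>p\<close> is \<open>p $ (d - 1)\<close>.\<close>

definition is_hyperplane :: "nat \<Rightarrow> real vec set \<Rightarrow> bool" where
  "is_hyperplane d h \<longleftrightarrow>
     (\<exists>a \<in> carrier_vec d. \<exists>b. a \<noteq> 0\<^sub>v d \<and> h = {x \<in> carrier_vec d. a \<bullet> x = b})"

text \<open>Injectivity of the intersection on the \<open>d\<close>-element subfamilies says that distinct
  subfamilies meet in distinct points.\<close>

definition general_position :: "nat \<Rightarrow> real vec set set \<Rightarrow> bool" where
  "general_position d H \<longleftrightarrow>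
     finite H \<and> (\<forall>h \<in> H. is_hyperplane d h) \<and>
     (\<forall>T. T \<subseteq> H \<and> card T = d \<longrightarrow> (\<exists>p. \<Inter>T = {p})) \<and>
     inj_on \<Inter> {T. T \<subseteq> H \<and> card T = d}"

definition vertex_set :: "nat \<Rightarrow> real vec set set \<Rightarrow> real vec set" where
  "vertex_set d H = {p. \<exists>T. T \<subseteq> H \<and> card T = d \<and> \<Inter>T = {p}}"

definition vertices_above :: "nat \<Rightarrow> real vec set set \<Rightarrow> bool" where
  "vertices_above d H \<longleftrightarrow> (\<forall>p \<in> vertex_set d H. p $ (d - 1) > 0)"

definition vertices_below :: "nat \<Rightarrow> real vec set set \<Rightarrow> bool" where
  "vertices_below d H \<longleftrightarrow> (\<forall>p \<in> vertex_set d H. p $ (d - 1) < 0)"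

definition one_sided :: "nat \<Rightarrow> nat \<Rightarrow> nat \<Rightarrow> nat \<Rightarrow> bool" where
  "one_sided d s n N \<longleftrightarrow>
     (\<forall>H. general_position d H \<and> card H = N \<longrightarrow>
        (\<exists>S \<subseteq> H. card S = s \<and> vertices_above d S) \<or>
        (\<exists>S \<subseteq> H. card S = n \<and> vertices_below d S))"

text \<open>Over \<open>enat\<close> the infimum is the least element if there is one and \<open>\<infinity>\<close> otherwise, so a
  finite upper bound on \<open>OSH d s n\<close> includes the existence of a suitable \<open>N\<close>.\<close>

definition OSH :: "nat \<Rightarrow> nat \<Rightarrow> nat \<Rightarrow> enat" where
  "OSH d s n = Inf {enat N | N. one_sided d s n N}"

text \<open>The tower function is indexed from 1; its value at index 0 is a dummy.\<close>

fun twr :: "nat \<Rightarrow> real \<Rightarrow> real" where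
  "twr 0 x = x"
| "twr (Suc 0) x = x"
| "twr (Suc (Suc i)) x = 2 powr twr (Suc i) x"

end

theory Submission
  imports Defs "HOL-Library.Ramsey" "HOL-Library.FuncSet" "HOL-Real_Asymp.Real_Asymp"
begin

text \<open>Write a hyperplane of \<open>H\<close> as \<open>a \<bullet> x = \<beta>\<close> and let \<open>\<alpha>\<close> be the last coordinate of \<open>a\<close>. If \<open>c\<close> is the linear
  dependency of the other coordinates of \<open>a\<close> over a \<open>d\<close>-subfamily, then the vertex satisfies
  \<open>(\<Sum> c \<alpha>) x\<^sub>d = \<Sum> c \<beta>\<close>, so the colour above/below is the sign of \<open>(\<Sum> c \<alpha>) (\<Sum> c \<beta>)\<close>. Eliminating one
  coordinate with the help of one hyperplane gives an arrangement of one dimension less, whence the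
  Erdos--Rado argument costs one exponential per dimension and reduces everything to \<open>d = 3\<close>. A greedy
  choice finally removes the vertices on \<open>x\<^sub>d = 0\<close>, at polynomial cost.

  For \<open>d = 3\<close>, after normalisation, a triple is above iff it has the same orientation in two planar
  point sets with common abscissae. The link of a point is then the comparability graph of a
  two-dimensional order, and \<open>k\<close> pairs split the points into \<open>k\<^bsup>O(1)\<^esup>\<close> classes. Multiplicative weights
  yield many cells of size \<open>N\<^bsup>\<Omega>(1)\<^esup>\<close> such that every pair of points separates few cells. Hence there are
  \<open>m\<close> cells whose cross triples are coloured by cells alone; by Ramsey's theorem these are not above,
  and within a cell the link of another cell either has a large clique (induction on \<open>s\<close>) or is
  avoided by a subset of size \<open>r = N\<^bsup>\<Omega>(1)\<^esup>\<close>. So the best possible size satisfies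
  \<open>F(r\<^bsup>O(1)\<^esup>) \<ge> m F(r)\<close> with an exponent independent of \<open>m\<close>, and \<open>F(N)\<close> beats every power of \<open>log N\<close>.\<close>

section \<open>Low-crossing families of cells\<close>

text \<open>A link is used in two opposite ways. If it contains a clique of size \<open>q\<close>,
  an above set of size \<open>s\<close> inside the clique becomes one of size \<open>s + 1\<close>;
  as \<open>q\<close> is a fixed power of \<open>N\<close>, this costs only a constant factor in
  \<open>ln N\<close>. Without such a clique the link is coloured by \<open>q\<close> ranks, and a
  subset of a cell avoids the links of all other cells at the price of \<open>q ^ (M - 1)\<close>
  classes. Here \<open>M\<close> is a Ramsey number depending on \<open>s\<close> and
  \<open>m\<close> alone. It enters only the choice of \<open>q\<close>, about the
  \<open>M\<close>-th root of \<open>r\<close>, so the block size \<open>r\<close> is the same power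
  of \<open>N\<close> for every \<open>m\<close>. This frees \<open>m\<close> to be as large as
  needed to outweigh the drop from \<open>(ln N)^K\<close> to \<open>(ln r)^K\<close>.

  Ramsey's theorem on cells needs cells such that no two points of chosen cells separate a third
  cell. It is not enough that few pairs cross a typical cell: a particular pair could cross most of
  them. The weights turn the average bound into one for every pair.

  General position permits vertices with last coordinate 0, which are neither above nor below. The
  colouring is therefore above against not above until the very end.\<close>

lemma pigeonhole_class:
  assumes "finite X" "X \<noteq> {}" "b * card (f ` X) \<le> card X"
  shows "\<exists>y. b \<le> card {x \<in> X. f x = y}"
proof (rule ccontr)
  assume "\<not> ?thesis"
  then have *: "card {x \<in> X. f x = y} < b" for y by (simp add: not_le)
  have "card X = (\<Sum>y\<in>f ` X. card {x \<in> X. f x = y})"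
    using sum.image_gen[OF assms(1), of "\<lambda>_. 1::nat" f] by simp
  also have "\<dots> < (\<Sum>y\<in>f ` X. b)"
    using assms * by (intro sum_strict_mono) auto
  finally show False using assms(3) by (simp add: mult.commute)
qed

lemma card_image_le_of_determines:
  assumes "finite (g ` X)" "\<And>x y. x \<in> X \<Longrightarrow> y \<in> X \<Longrightarrow> g x = g y \<Longrightarrow> f x = f y"
  shows "card (f ` X) \<le> card (g ` X)"
proof -
  have "f x = f (inv_into X g (g x))" if "x \<in> X" for x
    using assms(2)[OF that, of "inv_into X g (g x)"] that
    by (simp add: f_inv_into_f inv_into_into)
  then have "f ` X \<subseteq> (\<lambda>c. f (inv_into X g c)) ` (g ` X)"
    by (auto simp: image_iff)
  then show ?thesis
    by (meson assms(1) card_image_le card_mono finite_imageI le_trans)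
qed

text \<open>Averaging with the weights \<open>\<mu>\<close>: each surviving \<open>z\<close> is
  covered by an \<open>\<eta>\<close> fraction of the weight, so by double counting some
  \<open>q\<close> covers at least an \<open>\<eta>\<close> fraction of the survivors. Adding this
  \<open>q\<close> multiplies their number by at most \<open>1 - \<eta>\<close>.\<close>

lemma greedy_cover:
  fixes \<mu> :: "'q \<Rightarrow> real" and cov :: "'q \<Rightarrow> 'z \<Rightarrow> bool"
  assumes fin: "finite Q" "finite Z" and ne: "Q \<noteq> {}" and pos: "\<And>q. q \<in> Q \<Longrightarrow> \<mu> q > 0"
    and \<eta>: "\<eta> \<le> 1"
    and cov: "\<And>z. z \<in> Z \<Longrightarrow> \<eta> * sum \<mu> Q \<le> sum \<mu> {q \<in> Q. cov q z}"
  shows "\<exists>S\<subseteq>Q. card S \<le> k \<and> real (card {z \<in> Z. \<forall>q\<in>S. \<not> cov q z}) \<le> (1 - \<eta>) ^ k * real (card Z)"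
proof (induction k)
  case 0
  then show ?case by (intro exI[of _ "{}"]) auto
next
  case (Suc k)
  then obtain S where S: "S \<subseteq> Q" "card S \<le> k"
    "real (card {z \<in> Z. \<forall>q\<in>S. \<not> cov q z}) \<le> (1 - \<eta>) ^ k * real (card Z)" by blast
  define Z' where "Z' = {z \<in> Z. \<forall>q\<in>S. \<not> cov q z}"
  have finZ': "finite Z'" using fin by (simp add: Z'_def)
  have "\<exists>q\<in>Q. \<eta> * real (card Z') \<le> real (card {z \<in> Z'. cov q z})"
  proof (rule ccontr)
    assume "\<not> ?thesis"
    then have lt: "real (card {z \<in> Z'. cov q z}) < \<eta> * real (card Z')" if "q \<in> Q" for q
      using that by force
    have "\<eta> * sum \<mu> Q * real (card Z') = (\<Sum>z\<in>Z'. \<eta> * sum \<mu> Q)" by simp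
    also have "\<dots> \<le> (\<Sum>z\<in>Z'. sum \<mu> {q \<in> Q. cov q z})"
      by (intro sum_mono cov) (auto simp: Z'_def)
    also have "\<dots> = (\<Sum>z\<in>Z'. \<Sum>q\<in>Q. if cov q z then \<mu> q else 0)"
      by (simp add: sum.inter_filter fin)
    also have "\<dots> = (\<Sum>q\<in>Q. \<Sum>z\<in>Z'. if cov q z then \<mu> q else 0)"
      by (rule sum.swap)
    also have "\<dots> = (\<Sum>q\<in>Q. \<mu> q * real (card {z \<in> Z'. cov q z}))"
      by (simp add: sum.inter_filter[symmetric] finZ' mult.commute)
    also have "\<dots> < (\<Sum>q\<in>Q. \<mu> q * (\<eta> * real (card Z')))"
      using fin ne pos lt by (intro sum_strict_mono mult_strict_left_mono) auto
    also have "\<dots> = \<eta> * sum \<mu> Q * real (card Z')"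
      by (simp add: sum_distrib_right sum_distrib_left mult_ac)
    finally show False by simp
  qed
  then obtain q where q: "q \<in> Q" "\<eta> * real (card Z') \<le> real (card {z \<in> Z'. cov q z})" by blast
  have "card Z' = card {z \<in> Z'. cov q z} + card {z \<in> Z'. \<not> cov q z}"
    using finZ' by (subst card_Un_disjoint[symmetric]) (auto intro: arg_cong[where f=card])
  then have "real (card {z \<in> Z'. \<not> cov q z}) \<le> (1 - \<eta>) * real (card Z')"
    using q by (simp add: algebra_simps)
  also have "\<dots> \<le> (1 - \<eta>) * ((1 - \<eta>) ^ k * real (card Z))"
    using S \<eta> by (intro mult_left_mono) (auto simp: Z'_def)
  finally have "real (card {z \<in> Z'. \<not> cov q z}) \<le> (1 - \<eta>) ^ Suc k * real (card Z)" by simp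
  moreover have "{z \<in> Z'. \<not> cov q z} = {z \<in> Z. \<forall>q\<in>insert q S. \<not> cov q z}"
    by (auto simp: Z'_def)
  ultimately show ?case
    using S q fin by (intro exI[of _ "insert q S"])
      (auto intro!: order.trans[OF card_insert_le_m1] simp: card_insert_if finite_subset)
qed

lemma sum_UN_le:
  fixes \<mu> :: "'q \<Rightarrow> real"
  assumes "finite B" "\<And>x. x \<in> B \<Longrightarrow> finite (F x)" "\<And>x q. x \<in> B \<Longrightarrow> q \<in> F x \<Longrightarrow> 0 \<le> \<mu> q"
  shows "sum \<mu> (\<Union>x\<in>B. F x) \<le> (\<Sum>x\<in>B. sum \<mu> (F x))"
  using assms
proof (induction B)
  case (insert x B)
  have "sum \<mu> (\<Union>x\<in>insert x B. F x) + sum \<mu> (F x \<inter> (\<Union>x\<in>B. F x)) = sum \<mu> (F x) + sum \<mu> (\<Union>x\<in>B. F x)"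
    using insert.prems insert.hyps by (simp add: sum.union_inter)
  moreover have "0 \<le> sum \<mu> (F x \<inter> (\<Union>x\<in>B. F x))"
    using insert.prems by (intro sum_nonneg) auto
  moreover have "sum \<mu> (\<Union>x\<in>B. F x) \<le> (\<Sum>x\<in>B. sum \<mu> (F x))"
    using insert.prems by (intro insert.IH) auto
  ultimately show ?case using insert.hyps by simp
qed auto

definition crosses :: "('q \<Rightarrow> 'a \<Rightarrow> bool) \<Rightarrow> 'q \<Rightarrow> 'a set \<Rightarrow> bool" where
  "crosses \<rho> q B \<longleftrightarrow> (\<exists>x\<in>B. \<exists>y\<in>B. \<rho> q x \<noteq> \<rho> q y)"

text \<open>A polynomial bound on a shatter function: the number of classes into which the elements
  of \<open>S\<close> cut the points. The shift by 2 absorbs constants and keeps the base above 1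
  for small \<open>S\<close>.\<close>

definition poly_growth :: "nat \<Rightarrow> ('q \<Rightarrow> 'a \<Rightarrow> bool) \<Rightarrow> bool" where
  "poly_growth p \<rho> \<longleftrightarrow>
     (\<forall>S X. finite S \<longrightarrow> card ((\<lambda>x. {q \<in> S. \<rho> q x}) ` X) \<le> (card S + 2) ^ p)"

text \<open>Few pairs \<open>q\<close> already hit all differences of heavy weight; a class of points not separated by
  them then consists of points pairwise separated by little weight.\<close>

lemma low_crossing_cell:
  fixes \<mu> :: "'q \<Rightarrow> real"
  assumes fin: "finite Q" "finite X" and ne: "Q \<noteq> {}" and pos: "\<And>q. q \<in> Q \<Longrightarrow> \<mu> q > 0"
    and growth: "poly_growth p \<rho>"
    and \<eta>: "0 \<le> \<eta>" "\<eta> \<le> 1" and k: "(real (card X))\<^sup>2 * (1 - \<eta>) ^ k < 1"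
    and b: "b > 0" "b * (k + 2) ^ p \<le> card X"
  shows "\<exists>B\<subseteq>X. card B = b \<and> sum \<mu> {q \<in> Q. crosses \<rho> q B} \<le> real b * \<eta> * sum \<mu> Q"
proof -
  define Z where "Z = {(x, y) \<in> X \<times> X. \<eta> * sum \<mu> Q \<le> sum \<mu> {q \<in> Q. \<rho> q x \<noteq> \<rho> q y}}"
  have ZX: "Z \<subseteq> X \<times> X" by (auto simp: Z_def)
  then have finZ: "finite Z" using fin finite_subset by blast
  have cZ: "real (card Z) \<le> (real (card X))\<^sup>2"
    using card_mono[OF _ ZX] fin by (simp add: card_cartesian_product power2_eq_square flip: of_nat_mult)
  have "\<eta> * sum \<mu> Q \<le> sum \<mu> {q \<in> Q. (case z of (x, y) \<Rightarrow> \<rho> q x \<noteq> \<rho> q y)}" if "z \<in> Z" for z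
    using that by (cases z) (simp add: Z_def)
  from greedy_cover[OF fin(1) finZ ne pos \<eta>(2) this] obtain S where S: "S \<subseteq> Q" "card S \<le> k"
    "real (card {z \<in> Z. \<forall>q\<in>S. \<not> (case z of (x, y) \<Rightarrow> \<rho> q x \<noteq> \<rho> q y)}) \<le> (1 - \<eta>) ^ k * real (card Z)"
    by meson
  have "(1 - \<eta>) ^ k * real (card Z) \<le> (1 - \<eta>) ^ k * (real (card X))\<^sup>2"
    using \<eta> cZ by (intro mult_left_mono) auto
  then have "real (card {z \<in> Z. \<forall>q\<in>S. \<not> (case z of (x, y) \<Rightarrow> \<rho> q x \<noteq> \<rho> q y)}) < 1"
    using S(3) k by (simp add: mult.commute)
  then have "{z \<in> Z. \<forall>q\<in>S. \<not> (case z of (x, y) \<Rightarrow> \<rho> q x \<noteq> \<rho> q y)} = {}"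
    using finZ by simp
  then have cover: "\<exists>q\<in>S. \<rho> q x \<noteq> \<rho> q y" if "(x, y) \<in> Z" for x y
    using that by blast
  have finS: "finite S" using S fin finite_subset by blast
  define t where "t = (\<lambda>x. {q \<in> S. \<rho> q x})"
  have "card (t ` X) \<le> (card S + 2) ^ p"
    using growth finS by (auto simp: poly_growth_def t_def)
  also have "\<dots> \<le> (k + 2) ^ p" using S by (intro power_mono) auto
  finally have "b * card (t ` X) \<le> card X" using b by (meson le_trans mult_le_mono2)
  moreover have "X \<noteq> {}" using b by auto
  ultimately obtain y where "b \<le> card {x \<in> X. t x = y}"
    using pigeonhole_class[OF fin(2)] by blast
  then obtain B where B: "B \<subseteq> {x \<in> X. t x = y}" "card B = b"
    by (meson obtain_subset_with_card_n)
  have finB: "finite B" using B b card_ge_0_finite by auto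
  obtain x0 where x0: "x0 \<in> B" using B b by fastforce
  have near: "sum \<mu> {q \<in> Q. \<rho> q x0 \<noteq> \<rho> q x} \<le> \<eta> * sum \<mu> Q" if "x \<in> B" for x
  proof -
    have "t x0 = t x" using B x0 that by auto
    then have "\<not> (\<exists>q\<in>S. \<rho> q x0 \<noteq> \<rho> q x)" by (auto simp: t_def set_eq_iff)
    then have "(x0, x) \<notin> Z" using cover by blast
    then show ?thesis using B x0 that by (auto simp: Z_def)
  qed
  \<comment> \<open>Any \<open>q\<close> crossing \<open>B\<close> separates the fixed point
    \<open>x0\<close> from some member, so a union bound over the \<open>b\<close> members suffices
    instead of one over all pairs.\<close>
  have "sum \<mu> {q \<in> Q. crosses \<rho> q B} \<le> sum \<mu> (\<Union>x\<in>B. {q \<in> Q. \<rho> q x0 \<noteq> \<rho> q x})"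
    using fin finB x0 pos by (intro sum_mono2) (auto simp: crosses_def less_imp_le)
  also have "\<dots> \<le> (\<Sum>x\<in>B. sum \<mu> {q \<in> Q. \<rho> q x0 \<noteq> \<rho> q x})"
    using finB fin pos by (intro sum_UN_le) (auto simp: less_imp_le)
  also have "\<dots> \<le> (\<Sum>x\<in>B. \<eta> * sum \<mu> Q)" by (intro sum_mono near)
  also have "\<dots> = real b * \<eta> * sum \<mu> Q" using B by simp
  finally show ?thesis using B by auto
qed


lemma one_plus_inverse_power_le_3: "T > 0 \<Longrightarrow> x \<ge> 0 \<Longrightarrow> x * real T \<le> 1 \<Longrightarrow> (1 + x) ^ T \<le> 3"
proof -
  assume "T > 0" "x \<ge> 0" "x * real T \<le> 1"
  have "(1 + x) ^ T \<le> exp x ^ T"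
    using \<open>x \<ge> 0\<close> by (intro power_mono) auto
  also have "\<dots> = exp (x * real T)" by (metis exp_of_nat_mult mult.commute)
  also have "\<dots> \<le> exp 1" using \<open>x * real T \<le> 1\<close> by simp
  also have "\<dots> \<le> 3" by (rule exp_le)
  finally show ?thesis .
qed

text \<open>Multiplicative weights: the weight of \<open>q\<close> doubles whenever \<open>q\<close> crosses the cell just chosen.\<close>

lemma low_crossing_cells:
  assumes fin: "finite Q" "finite X" and ne: "Q \<noteq> {}"
    and growth: "poly_growth p \<rho>"
    and \<eta>: "0 \<le> \<eta>" "\<eta> \<le> 1" and k: "(real (card X))\<^sup>2 * (1 - \<eta>) ^ k < 1"
    and b: "b > 0" "T * b + b * (k + 2) ^ p \<le> card X"
    and T: "T > 0" "real b * \<eta> * real T \<le> 1"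
  shows "\<exists>C :: nat \<Rightarrow> 'a set. (\<forall>i<T. C i \<subseteq> X \<and> card (C i) = b) \<and>
    (\<forall>i<T. \<forall>j<T. i \<noteq> j \<longrightarrow> C i \<inter> C j = {}) \<and>
    (\<forall>q\<in>Q. 2 ^ card {i. i < T \<and> crosses \<rho> q (C i)} \<le> 3 * real (card Q))"
proof -
  define x where "x = real b * \<eta>"
  have x: "x \<ge> 0" using \<eta> by (simp add: x_def)
  have "t \<le> T \<Longrightarrow> \<exists>C :: nat \<Rightarrow> 'a set. (\<forall>i<t. C i \<subseteq> X \<and> card (C i) = b) \<and>
    (\<forall>i<t. \<forall>j<t. i \<noteq> j \<longrightarrow> C i \<inter> C j = {}) \<and>
    (\<Sum>q\<in>Q. 2 ^ card {i. i < t \<and> crosses \<rho> q (C i)}) \<le> (1 + x) ^ t * real (card Q)" for t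
  proof (induction t)
    case 0
    then show ?case by auto
  next
    case (Suc t)
    then obtain C :: "nat \<Rightarrow> 'a set" where C: "\<forall>i<t. C i \<subseteq> X \<and> card (C i) = b"
      "\<forall>i<t. \<forall>j<t. i \<noteq> j \<longrightarrow> C i \<inter> C j = {}"
      "(\<Sum>q\<in>Q. 2 ^ card {i. i < t \<and> crosses \<rho> q (C i)}) \<le> (1 + x) ^ t * real (card Q)" by auto
    define \<mu> :: "_ \<Rightarrow> real" where "\<mu> = (\<lambda>q. 2 ^ card {i. i < t \<and> crosses \<rho> q (C i)})"
    define X' where "X' = X - (\<Union>i<t. C i)"
    have finX': "finite X'" using fin by (simp add: X'_def)
    have "(real (card X'))\<^sup>2 * (1 - \<eta>) ^ k \<le> (real (card X))\<^sup>2 * (1 - \<eta>) ^ k"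
      using fin \<eta> by (intro mult_right_mono power_mono) (auto simp: X'_def intro!: card_mono)
    then have k': "(real (card X'))\<^sup>2 * (1 - \<eta>) ^ k < 1" using k by simp
    have "card (\<Union>i<t. C i) \<le> (\<Sum>i<t. card (C i))" by (intro card_UN_le) auto
    also have "\<dots> = t * b" using C by simp
    also have "\<dots> \<le> T * b" using Suc.prems by simp
    finally have "card (\<Union>i<t. C i) \<le> T * b" .
    moreover have "finite (\<Union>i<t. C i)" using C(1) fin by (auto intro: finite_subset)
    ultimately have b': "b * (k + 2) ^ p \<le> card X'"
      using b(2) diff_card_le_card_Diff[of "\<Union>i<t. C i" X] by (auto simp: X'_def)
    obtain B where B: "B \<subseteq> X'" "card B = b" "sum \<mu> {q \<in> Q. crosses \<rho> q B} \<le> x * sum \<mu> Q"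
      using low_crossing_cell[OF fin(1) finX' ne _ growth \<eta> k' b(1) b', of \<mu>] by (auto simp: x_def \<mu>_def)
    have "(2::real) ^ card {i. i < Suc t \<and> crosses \<rho> q ((C(t := B)) i)} =
        \<mu> q + (if crosses \<rho> q B then \<mu> q else 0)" for q
    proof -
      have "{i. i < Suc t \<and> crosses \<rho> q ((C(t := B)) i)} =
        (if crosses \<rho> q B then insert t else id) {i. i < t \<and> crosses \<rho> q (C i)}"
        by (auto simp: less_Suc_eq)
      then show ?thesis by (simp add: \<mu>_def)
    qed
    then have "(\<Sum>q\<in>Q. (2::real) ^ card {i. i < Suc t \<and> crosses \<rho> q ((C(t := B)) i)})
        = sum \<mu> Q + sum \<mu> {q \<in> Q. crosses \<rho> q B}"
      using fin by (simp add: sum.distrib sum.inter_filter)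
    also have "\<dots> \<le> (1 + x) * sum \<mu> Q" using B by (simp add: algebra_simps)
    also have "\<dots> \<le> (1 + x) * ((1 + x) ^ t * real (card Q))"
      using C x by (intro mult_left_mono) (auto simp: \<mu>_def)
    finally have "(\<Sum>q\<in>Q. (2::real) ^ card {i. i < Suc t \<and> crosses \<rho> q ((C(t := B)) i)})
      \<le> (1 + x) ^ Suc t * real (card Q)" by simp
    moreover have "C i \<inter> B = {}" if "i < t" for i using B(1) that by (auto simp: X'_def)
    ultimately show ?case using B(1,2) C(1,2) by (intro exI[of _ "C(t := B)"]) (auto simp: less_Suc_eq X'_def)
  qed
  from this[of T] obtain C :: "nat \<Rightarrow> 'a set" where C: "\<forall>i<T. C i \<subseteq> X \<and> card (C i) = b"
      "\<forall>i<T. \<forall>j<T. i \<noteq> j \<longrightarrow> C i \<inter> C j = {}"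
      "(\<Sum>q\<in>Q. 2 ^ card {i. i < T \<and> crosses \<rho> q (C i)}) \<le> (1 + x) ^ T * real (card Q)" by blast
  \<comment> \<open>A single weight is at most the total weight. As \<open>x * T \<le> 1\<close>,
    the total has grown by a factor of at most \<open>exp 1 \<le> 3\<close>, so each
    \<open>q\<close> crosses at most logarithmically many cells.\<close>
  have "2 ^ card {i. i < T \<and> crosses \<rho> q (C i)} \<le> 3 * real (card Q)" if "q \<in> Q" for q
  proof -
    have "2 ^ card {i. i < T \<and> crosses \<rho> q (C i)} \<le> (\<Sum>q\<in>Q. (2::real) ^ card {i. i < T \<and> crosses \<rho> q (C i)})"
      using fin that by (intro member_le_sum) auto
    also note C(3)
    also have "(1 + x) ^ T * real (card Q) \<le> 3 * real (card Q)"
      using one_plus_inverse_power_le_3[OF T(1) x] T(2) by (intro mult_right_mono) (auto simp: x_def)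
    finally show ?thesis .
  qed
  with C show ?thesis by blast
qed

section \<open>Selecting cells by a union bound\<close>

lemma card_PiE_section_le:
  assumes "finite A" "finite S" "c \<in> A" "\<And>h. h \<in> A - {c} \<rightarrow>\<^sub>E S \<Longrightarrow> card {k \<in> S. P h k} \<le> D"
  shows "card {f \<in> A \<rightarrow>\<^sub>E S. P (restrict f (A - {c})) (f c)} \<le> D * card S ^ (card A - 1)"
proof -
  let ?F = "A - {c} \<rightarrow>\<^sub>E S"
  have finF: "finite ?F" using assms by (intro finite_PiE) auto
  have "{f \<in> A \<rightarrow>\<^sub>E S. P (restrict f (A - {c})) (f c)} \<subseteq> (\<lambda>(h, k). h(c := k)) ` (SIGMA h:?F. {k \<in> S. P h k})"
  proof
    fix f assume f: "f \<in> {f \<in> A \<rightarrow>\<^sub>E S. P (restrict f (A - {c})) (f c)}"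
    then have "f = (restrict f (A - {c}))(c := f c)"
      by (auto simp: fun_eq_iff PiE_def extensional_def)
    then show "f \<in> (\<lambda>(h, k). h(c := k)) ` (SIGMA h:?F. {k \<in> S. P h k})"
      using f assms(3) by (intro image_eqI[of _ _ "(restrict f (A - {c}), f c)"]) auto
  qed
  then have "card {f \<in> A \<rightarrow>\<^sub>E S. P (restrict f (A - {c})) (f c)} \<le>
      card ((\<lambda>(h, k). h(c := k)) ` (SIGMA h:?F. {k \<in> S. P h k}))"
    using finF assms by (intro card_mono finite_imageI finite_SigmaI) auto
  also have "\<dots> \<le> card (SIGMA h:?F. {k \<in> S. P h k})"
    using finF assms by (intro card_image_le finite_SigmaI) auto
  also have "\<dots> = (\<Sum>h\<in>?F. card {k \<in> S. P h k})"
    using finF assms by (intro card_SigmaI) auto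
  also have "\<dots> \<le> (\<Sum>h\<in>?F. D)" using assms by (intro sum_mono) auto
  also have "\<dots> = D * card S ^ (card A - 1)"
    using assms by (simp add: card_PiE)
  finally show ?thesis .
qed

text \<open>First moment argument: for fixed \<open>(a, b, c)\<close> and fixed values off
  \<open>c\<close>, at most \<open>D\<close> of the \<open>T\<close> values at \<open>c\<close> are
  bad, so fewer than \<open>T ^ M\<close> maps fail. The case \<open>a = b\<close> is included,
  since later two points of one cell are tested against another cell.\<close>

lemma exists_avoiding_map:
  fixes bad :: "nat \<Rightarrow> nat \<Rightarrow> nat \<Rightarrow> bool"
  assumes "\<And>i j. i < T \<Longrightarrow> j < T \<Longrightarrow> card {k. k < T \<and> bad i j k} \<le> D" "M ^ 3 * D < T"
  shows "\<exists>f. (\<forall>a<M. f a < T) \<and> (\<forall>a<M. \<forall>b<M. \<forall>c<M. c \<noteq> a \<longrightarrow> c \<noteq> b \<longrightarrow> \<not> bad (f a) (f b) (f c))"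
proof (rule ccontr)
  assume contr: "\<not> ?thesis"
  define F where "F = {..<M} \<rightarrow>\<^sub>E {..<T}"
  define I where "I = {(a, b, c) \<in> {..<M} \<times> {..<M} \<times> {..<M}. c \<noteq> a \<and> c \<noteq> b}"
  define G where "G = (\<lambda>(a, b, c). {f \<in> F. bad (f a) (f b) (f c)})"
  have finF: "finite F" by (auto simp: F_def intro!: finite_PiE)
  have I: "I \<subseteq> {..<M} \<times> {..<M} \<times> {..<M}" by (auto simp: I_def)
  have finI: "finite I" using I finite_subset by blast
  have cI: "card I \<le> M ^ 3"
    using card_mono[OF _ I] by (simp add: card_cartesian_product power3_eq_cube)
  have "F \<subseteq> (\<Union>t\<in>I. G t)"
  proof
    fix f assume f: "f \<in> F"
    then have "\<forall>a<M. f a < T" by (auto simp: F_def)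
    with contr obtain a b c where "a < M" "b < M" "c < M" "c \<noteq> a" "c \<noteq> b" "bad (f a) (f b) (f c)"
      by blast
    then show "f \<in> (\<Union>t\<in>I. G t)" using f by (force simp: I_def G_def)
  qed
  moreover have G: "card (G t) \<le> D * T ^ (M - 1)" if "t \<in> I" for t
  proof -
    obtain a b c where t: "t = (a, b, c)" by (cases t)
    have abc: "a < M" "b < M" "c < M" "c \<noteq> a" "c \<noteq> b" using that by (auto simp: I_def t)
    have "card {f \<in> {..<M} \<rightarrow>\<^sub>E {..<T}. bad (restrict f ({..<M} - {c}) a) (restrict f ({..<M} - {c}) b) (f c)}
        \<le> D * card {..<T} ^ (card {..<M} - 1)"
      using abc by (intro card_PiE_section_le[where P = "\<lambda>h k. bad (h a) (h b) k"])
        (auto intro!: order.trans[OF _ assms(1)] simp: PiE_iff)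
    moreover have "G t = {f \<in> {..<M} \<rightarrow>\<^sub>E {..<T}. bad (restrict f ({..<M} - {c}) a) (restrict f ({..<M} - {c}) b) (f c)}"
      using abc by (auto simp: G_def t F_def)
    ultimately show ?thesis by simp
  qed
  ultimately have "card F \<le> (\<Sum>t\<in>I. card (G t))"
    using finF finI by (intro order.trans[OF card_mono card_UN_le]) (auto simp: G_def)
  also have "\<dots> \<le> (\<Sum>t\<in>I. D * T ^ (M - 1))" by (intro sum_mono G)
  also have "\<dots> \<le> M ^ 3 * D * T ^ (M - 1)" using cI by simp
  also have "\<dots> < T ^ M"
  proof (cases M)
    case 0
    then show ?thesis using \<open>card F \<le> (\<Sum>t\<in>I. card (G t))\<close> by simp
  next
    case (Suc n)
    then show ?thesis using assms(2) by simp
  qed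
  also have "\<dots> = card F" by (simp add: F_def card_PiE)
  finally show False by simp
qed

section \<open>Triple colourings with ordered links\<close>

definition red_set :: "('a \<Rightarrow> 'a \<Rightarrow> 'a \<Rightarrow> bool) \<Rightarrow> 'a set \<Rightarrow> bool" where
  "red_set R S \<longleftrightarrow> (\<forall>u\<in>S. \<forall>v\<in>S. \<forall>w\<in>S. u \<noteq> v \<longrightarrow> u \<noteq> w \<longrightarrow> v \<noteq> w \<longrightarrow> R u v w)"

text \<open>Ranging over all triples agrees with the version for distinct points: a link-ordered
  \<open>R\<close> fails whenever an entry is repeated.\<close>

definition blue_set :: "('a \<Rightarrow> 'a \<Rightarrow> 'a \<Rightarrow> bool) \<Rightarrow> 'a set \<Rightarrow> bool" where
  "blue_set R S \<longleftrightarrow> (\<forall>u\<in>S. \<forall>v\<in>S. \<forall>w\<in>S. \<not> R u v w)"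

text \<open>\<open>swap\<close> and \<open>rot\<close> generate all permutations, so
  \<open>R\<close> is a symmetric relation on triples. The product in \<open>link\<close> is
  positive iff \<open>u\<close> and \<open>v\<close> are comparable in the strict product order of
  \<open>f\<close> and \<open>g\<close>, which may vary with \<open>w\<close>.\<close>

locale link_ordered =
  fixes R :: "'a \<Rightarrow> 'a \<Rightarrow> 'a \<Rightarrow> bool" and p :: nat
  assumes swap: "R u v w \<Longrightarrow> R v u w" and rot: "R u v w \<Longrightarrow> R v w u"
    and growth: "poly_growth p (\<lambda>(u, v) w. R u v w)"
    and link: "\<exists>f g. \<forall>u v. R u v w \<longleftrightarrow> ((f u :: real) - f v) * (g u - g v :: real) > 0"
begin

lemma rot_eq: "R u v w = R v w u"
  using rot by blast

lemma irrefl: "\<not> R u u w"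
  using link[of w] by force

text \<open>Mirsky: a comparability graph without large cliques is coloured by the height of its elements.\<close>

lemma clique_or_rank:
  assumes "finite B"
  shows "(\<exists>Q\<subseteq>B. card Q = q \<and> (\<forall>u\<in>Q. \<forall>v\<in>Q. u \<noteq> v \<longrightarrow> R u v w)) \<or>
    (\<exists>h :: 'a \<Rightarrow> nat. (\<forall>u\<in>B. h u < q) \<and> (\<forall>u\<in>B. \<forall>v\<in>B. h u = h v \<longrightarrow> \<not> R u v w))"
proof -
  obtain f g where fg: "\<And>u v. R u v w \<longleftrightarrow> ((f u :: real) - f v) * (g u - g v :: real) > 0"
    using link[of w] by blast
  define below where "below u v \<longleftrightarrow> f u < f v \<and> g u < g v" for u v
  have R: "R u v w \<longleftrightarrow> below u v \<or> below v u" for u v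
    unfolding fg below_def zero_less_mult_iff by auto
  show ?thesis using assms
  proof (induction q arbitrary: B)
    case 0
    then show ?case by auto
  next
    case (Suc q)
    \<comment> \<open>The non-minimal elements. A clique of size \<open>q\<close> among them extends
      downwards by one; otherwise they are ranked by the induction hypothesis and the minimal
      elements, an antichain, receive the new rank \<open>q\<close>.\<close>
    define B' where "B' = {v \<in> B. \<exists>u\<in>B. below u v}"
    have B': "B' \<subseteq> B" "finite B'" using Suc.prems by (auto simp: B'_def)
    show ?case
    proof (cases "\<exists>Q\<subseteq>B'. card Q = q \<and> (\<forall>u\<in>Q. \<forall>v\<in>Q. u \<noteq> v \<longrightarrow> R u v w)")
      case True
      then obtain Q where Q: "Q \<subseteq> B'" "card Q = q" "\<forall>u\<in>Q. \<forall>v\<in>Q. u \<noteq> v \<longrightarrow> R u v w" by blast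
      have finQ: "finite Q" using Q B' finite_subset by blast
      show ?thesis
      proof (cases "Q = {}")
        case True
        show ?thesis
        proof (cases "B = {}")
          case False
          then obtain u where "u \<in> B" by blast
          then show ?thesis using True Q by (intro disjI1 exI[of _ "{u}"]) auto
        qed auto
      next
        case False
        \<comment> \<open>Minimality in \<open>f\<close> suffices: inside a clique \<open>f\<close>
          and \<open>g\<close> order the elements alike.\<close>
        obtain m where m: "m \<in> Q" "\<And>x. x \<in> Q \<Longrightarrow> f m \<le> f x"
          using ex_min_if_finite[of "f ` Q"] finQ False by (auto simp: not_less)
        have mb: "below m x" if "x \<in> Q" "x \<noteq> m" for x
          using Q(3) m that R[of m x] by (force simp: below_def)
        obtain u where u: "u \<in> B" "below u m" using Q m by (auto simp: B'_def)
        have ub: "below u x" if "x \<in> Q" for x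
          using u mb[OF that] by (cases "x = m") (auto simp: below_def)
        then have "u \<notin> Q" by (auto simp: below_def)
        then show ?thesis
          using Q ub u finQ B' R by (intro disjI1 exI[of _ "insert u Q"]) auto
      qed
    next
      case False
      then obtain h :: "'a \<Rightarrow> nat" where h: "\<forall>u\<in>B'. h u < q" "\<forall>u\<in>B'. \<forall>v\<in>B'. h u = h v \<longrightarrow> \<not> R u v w"
        using Suc.IH[OF B'(2)] by blast
      show ?thesis
      proof (intro disjI2 exI[of _ "\<lambda>u. if u \<in> B' then h u else q"] conjI ballI impI)
        fix u assume "u \<in> B"
        then show "(if u \<in> B' then h u else q) < Suc q" using h by (auto simp: less_Suc_eq)
      next
        fix u v assume uv: "u \<in> B" "v \<in> B" "(if u \<in> B' then h u else q) = (if v \<in> B' then h v else q)"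
        show "\<not> R u v w"
        proof (cases "u \<in> B' \<or> v \<in> B'")
          case True
          then show ?thesis using uv h by (auto split: if_splits)
        next
          case False
          then show ?thesis using uv by (auto simp: R B'_def)
        qed
      qed
    qed
  qed
qed

text \<open>The exponent of \<open>r\<close> does not depend on the number \<open>m\<close> of blocks; this is what makes the recursion win
  over every power of the logarithm.\<close>

lemma blue_blocks:
  assumes H: "finite H" "card H = r ^ (10 * p + 10)"
    and q: "q \<ge> 1" "q ^ M \<le> r" and ramsey: "partn_lst {..<M} [s, m] 3"
    and r: "M ^ 3 * (r ^ 5 + 1) < r ^ 6" "3 * r ^ (20 * p + 20) < 2 ^ r"
  shows "(\<exists>S\<subseteq>H. red_set R S \<and> card S = s) \<or>
    (\<exists>w\<in>H. \<exists>Q\<subseteq>H - {w}. card Q = q \<and> (\<forall>u\<in>Q. \<forall>v\<in>Q. u \<noteq> v \<longrightarrow> R u v w)) \<or>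
    (\<exists>(I :: nat set) K. card I = m \<and> (\<forall>i\<in>I. K i \<subseteq> H \<and> r \<le> card (K i)) \<and>
      (\<forall>i\<in>I. \<forall>j\<in>I. i \<noteq> j \<longrightarrow> K i \<inter> K j = {}) \<and>
      (\<forall>i\<in>I. \<forall>j\<in>I. \<forall>k\<in>I. \<forall>u\<in>K i. \<forall>v\<in>K j. \<forall>w\<in>K k. R u v w \<longrightarrow> i = j \<and> j = k))"
    (is "?red \<or> ?clique \<or> ?blocks")
proof (rule ccontr)
  assume contr: "\<not> (?red \<or> ?clique \<or> ?blocks)"
  note no = contr[unfolded de_Morgan_disj]
  note no_red = no[THEN conjunct1] and no_clique = no[THEN conjunct2, THEN conjunct1]
    and no_blocks = no[THEN conjunct2, THEN conjunct2]
  define \<rho> where "\<rho> = (\<lambda>(u, v) w. R u v w)"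
  have "r \<noteq> 0" using r(1) by (cases r) auto
  moreover have "r \<noteq> 1" using r(2) by auto
  ultimately have r2: "2 \<le> r" by simp
  \<comment> \<open>The parameters are cells of size \<open>r^2\<close>, \<open>T = r^6\<close>
    cells and \<open>k = r^9\<close>. Then \<open>r^2 * \<eta> * T = 1\<close> bounds the growth of
    the weights, and \<open>k = r / \<eta>\<close> gives
    \<open>(1 - \<eta>) ^ k \<le> exp (- r)\<close>, which beats \<open>card H ^ 2\<close>.\<close>
  define \<eta> where "\<eta> = 1 / real r ^ 8"
  have \<eta>: "0 \<le> \<eta>" "\<eta> \<le> 1" using r2 by (auto simp: \<eta>_def divide_le_eq)
  have "(1 - \<eta>) ^ (r ^ 9) \<le> exp (- \<eta>) ^ (r ^ 9)"
    using \<eta> exp_ge_add_one_self[of "- \<eta>"] by (intro power_mono) auto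
  also have "\<dots> = exp (real (r ^ 9) * (- \<eta>))" by (rule exp_of_nat_mult[symmetric])
  also have "real (r ^ 9) * (- \<eta>) = - real r" using r2 by (simp add: \<eta>_def power_numeral_reduce)
  finally have e1: "(1 - \<eta>) ^ (r ^ 9) \<le> exp (- real r)" .
  have "real (3 * r ^ (20 * p + 20)) < real (2 ^ r)" using r(2) of_nat_less_iff by blast
  also have "real (2 ^ r) \<le> exp 1 ^ r"
    using exp_ge_add_one_self[of "1::real"] by (simp add: power_mono)
  also have "\<dots> = exp (real r)" by (simp add: exp_of_nat_mult[symmetric])
  finally have "3 * real (r ^ (20 * p + 20)) < exp (real r)" by simp
  then have e2: "real (r ^ (20 * p + 20)) < exp (real r)" using of_nat_0_le_iff[of "r ^ (20 * p + 20)", where 'a = real] by linarith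
  have cardH2: "card H ^ 2 = r ^ (20 * p + 20)"
    by (simp add: H(2) flip: power_mult)
  have "(real (card H))\<^sup>2 * (1 - \<eta>) ^ (r ^ 9) \<le> real (r ^ (20 * p + 20)) * exp (- real r)"
    using e1 \<eta> by (intro mult_mono) (auto simp flip: cardH2)
  also have "\<dots> < exp (real r) * exp (- real r)" using e2 by (intro mult_strict_right_mono) auto
  also have "\<dots> = 1" by (simp flip: exp_add)
  finally have k: "(real (card H))\<^sup>2 * (1 - \<eta>) ^ (r ^ 9) < 1" .
  \<comment> \<open>Origin of the exponent \<open>10 * p + 10\<close>:
    \<open>r^9 + 2 \<le> r^10\<close> bounds the number of classes by \<open>r ^ (10 * p)\<close>,
    and the rest is room for the cells.\<close>
  have big: "r ^ 6 * r\<^sup>2 + r\<^sup>2 * (r ^ 9 + 2) ^ p \<le> card H"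
  proof -
    have "2 \<le> r ^ 9" using r2 self_le_power[of r 9] by simp
    then have "r ^ 9 + 2 \<le> 2 * r ^ 9" by simp
    also have "\<dots> \<le> r * r ^ 9" using r2 by (intro mult_right_mono) auto
    finally have "(r ^ 9 + 2) ^ p \<le> (r ^ 10) ^ p" by (intro power_mono) (auto simp: power_numeral_reduce)
    then have "r\<^sup>2 * (r ^ 9 + 2) ^ p \<le> r\<^sup>2 * (r ^ 10) ^ p" by (rule mult_left_mono) simp
    also have "\<dots> = r ^ (10 * p + 2)" by (simp flip: power_add power_mult)
    also have "\<dots> \<le> r ^ (10 * p + 9)" using r2 by (intro power_increasing) auto
    finally have "r\<^sup>2 * (r ^ 9 + 2) ^ p \<le> r ^ (10 * p + 9)" .
    moreover have "r ^ 6 * r\<^sup>2 \<le> r ^ (10 * p + 9)"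
      unfolding power_add[symmetric] using r2 by (intro power_increasing) auto
    moreover have "2 * r ^ (10 * p + 9) \<le> r * r ^ (10 * p + 9)" using r2 by (intro mult_right_mono) auto
    moreover have "r * r ^ (10 * p + 9) = card H"
      using power_Suc[of r "10 * p + 9"] H(2) by (simp del: power_Suc add: add.commute)
    ultimately show ?thesis by linarith
  qed
  have finQ: "finite (H \<times> H)" "H \<times> H \<noteq> {}" using H r2 by auto
  have growth': "poly_growth p \<rho>" unfolding \<rho>_def by (rule growth)
  have T: "r ^ 6 > 0" "real (r\<^sup>2) * \<eta> * real (r ^ 6) \<le> 1"
    using r2 by (auto simp: \<eta>_def field_simps simp flip: power_add)
  have "r\<^sup>2 > 0" using r2 by simp
  from low_crossing_cells[OF finQ(1) H(1) finQ(2) growth' \<eta> k this big T]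
  obtain C :: "nat \<Rightarrow> 'a set" where "\<forall>i<r ^ 6. C i \<subseteq> H \<and> card (C i) = r\<^sup>2"
    "\<forall>i<r ^ 6. \<forall>j<r ^ 6. i \<noteq> j \<longrightarrow> C i \<inter> C j = {}"
    "\<forall>x\<in>H \<times> H. 2 ^ card {i. i < r ^ 6 \<and> crosses \<rho> x (C i)} \<le> 3 * real (card (H \<times> H))"
    by blast
  then have C: "\<And>i. i < r ^ 6 \<Longrightarrow> C i \<subseteq> H" "\<And>i. i < r ^ 6 \<Longrightarrow> card (C i) = r\<^sup>2"
    "\<And>i j. i < r ^ 6 \<Longrightarrow> j < r ^ 6 \<Longrightarrow> i \<noteq> j \<Longrightarrow> C i \<inter> C j = {}"
    "\<And>x. x \<in> H \<times> H \<Longrightarrow> 2 ^ card {i. i < r ^ 6 \<and> crosses \<rho> x (C i)} \<le> 3 * real (card (H \<times> H))"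
    by blast+
  have few: "card {i. i < r ^ 6 \<and> crosses \<rho> (u, v) (C i)} \<le> r" if "u \<in> H" "v \<in> H" for u v
  proof -
    have "(2::real) ^ card {i. i < r ^ 6 \<and> crosses \<rho> (u, v) (C i)} \<le> 3 * real (card (H \<times> H))"
      using C(4) that by auto
    also have "\<dots> = real (3 * r ^ (20 * p + 20))"
      by (simp add: card_cartesian_product power2_eq_square flip: cardH2)
    also have "\<dots> < real (2 ^ r)" using r(2) of_nat_less_iff by blast
    finally show ?thesis by simp
  qed
  \<comment> \<open>The disjunct \<open>k = i\<close> makes the selected map injective. The other
    one has at most \<open>r^2 * r^2\<close> pairs, each crossing at most \<open>r\<close> cells,
    hence the bound \<open>r^5 + 1\<close>.\<close>
  define bad where "bad i j k \<longleftrightarrow> k = i \<or> (\<exists>u\<in>C i. \<exists>v\<in>C j. crosses \<rho> (u, v) (C k))" for i j k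
  have "card {k. k < r ^ 6 \<and> bad i j k} \<le> r ^ 5 + 1" if ij: "i < r ^ 6" "j < r ^ 6" for i j
  proof -
    let ?S = "\<lambda>(u, v). {k. k < r ^ 6 \<and> crosses \<rho> (u, v) (C k)}"
    have fin: "finite (C i \<times> C j)" using C(1) ij H finite_subset by (metis finite_cartesian_product)
    have "{k. k < r ^ 6 \<and> bad i j k} \<subseteq> insert i (\<Union>x\<in>C i \<times> C j. ?S x)"
      by (auto simp: bad_def)
    then have "card {k. k < r ^ 6 \<and> bad i j k} \<le> card (insert i (\<Union>x\<in>C i \<times> C j. ?S x))"
      using fin by (intro card_mono) auto
    also have "\<dots> \<le> Suc (card (\<Union>x\<in>C i \<times> C j. ?S x))"
      by (rule card_insert_le_m1) auto
    also have "card (\<Union>x\<in>C i \<times> C j. ?S x) \<le> (\<Sum>x\<in>C i \<times> C j. card (?S x))"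
      using fin by (rule card_UN_le)
    also have "\<dots> \<le> (\<Sum>x\<in>C i \<times> C j. r)"
      using few C(1) ij by (intro sum_mono) auto
    also have "\<dots> = r ^ 5"
      using C(2) ij by (simp add: card_cartesian_product eval_nat_numeral)
    finally show ?thesis by simp
  qed
  from exists_avoiding_map[of "r ^ 6" bad "r ^ 5 + 1" M, OF this r(1)]
  obtain f where "\<forall>a<M. f a < r ^ 6"
    "\<forall>a<M. \<forall>b<M. \<forall>c<M. c \<noteq> a \<longrightarrow> c \<noteq> b \<longrightarrow> \<not> bad (f a) (f b) (f c)" by blast
  then have f: "\<And>a. a < M \<Longrightarrow> f a < r ^ 6"
    "\<And>a b c. a < M \<Longrightarrow> b < M \<Longrightarrow> c < M \<Longrightarrow> c \<noteq> a \<Longrightarrow> c \<noteq> b \<Longrightarrow> \<not> bad (f a) (f b) (f c)"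
    by blast+
  define B where "B a = C (f a)" for a
  have BH: "B a \<subseteq> H" "card (B a) = r\<^sup>2" if "a < M" for a
    unfolding B_def using C(1,2)[OF f(1)[OF that]] by simp_all
  have Bdisj: "B a \<inter> B b = {}" if "a < M" "b < M" "a \<noteq> b" for a b
  proof -
    have "f a \<noteq> f b" using f(2)[of b b a] that by (auto simp: bad_def)
    then show ?thesis unfolding B_def using C(3) f(1) that by blast
  qed
  \<comment> \<open>The colour does not depend on the choice within the third cell. With
    \<open>a = b\<close> this lets one representative stand for the links of all points of another
    cell.\<close>
  have lin_indep: "R u v w = R u v w'"
    if "a < M" "b < M" "c < M" "c \<noteq> a" "c \<noteq> b" "u \<in> B a" "v \<in> B b" "w \<in> B c" "w' \<in> B c" for a b c u v w w'
  proof -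
    have "\<not> crosses \<rho> (u, v) (B c)" using f(2)[OF that(1-5)] that(6,7) unfolding bad_def B_def by blast
    then have "\<rho> (u, v) w = \<rho> (u, v) w'" using that(8,9) unfolding crosses_def by blast
    then show ?thesis by (simp add: \<rho>_def)
  qed
  define rep where "rep a = (SOME w. w \<in> B a)" for a
  have rep: "rep a \<in> B a" if "a < M" for a
  proof -
    have "B a \<noteq> {}" using BH[OF that] r2 by auto
    then show ?thesis unfolding rep_def by (simp add: some_in_eq)
  qed
  have hom: "R u v w = R (rep a) (rep b) (rep c)"
    if "a < M" "b < M" "c < M" "a \<noteq> b" "a \<noteq> c" "b \<noteq> c" "u \<in> B a" "v \<in> B b" "w \<in> B c" for a b c u v w
  proof -
    \<comment> \<open>Rotation brings each point in turn to the last position, where it can be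
      replaced by the representative of its cell.\<close>
    have "R u v w = R u v (rep c)" by (rule lin_indep[of a b c]) (use that rep in auto)
    also have "\<dots> = R v (rep c) u" by (rule rot_eq)
    also have "\<dots> = R v (rep c) (rep a)" by (rule lin_indep[of b c a]) (use that rep in auto)
    also have "\<dots> = R (rep c) (rep a) v" by (rule rot_eq)
    also have "\<dots> = R (rep c) (rep a) (rep b)" by (rule lin_indep[of c a b]) (use that rep in auto)
    also have "\<dots> = R (rep a) (rep b) (rep c)" by (rule rot_eq)
    finally show ?thesis .
  qed
  define col where "col X = (if \<forall>a\<in>X. \<forall>b\<in>X. \<forall>c\<in>X. a \<noteq> b \<longrightarrow> a \<noteq> c \<longrightarrow> b \<noteq> c \<longrightarrow> R (rep a) (rep b) (rep c)
      then 0 else 1 :: nat)" for X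
  have col: "col {a, b, c} = 0 \<longleftrightarrow> R (rep a) (rep b) (rep c)" if "a \<noteq> b" "a \<noteq> c" "b \<noteq> c" for a b c
  proof
    assume "col {a, b, c} = 0"
    then show "R (rep a) (rep b) (rep c)" using that by (simp add: col_def split: if_splits)
  next
    assume R: "R (rep a) (rep b) (rep c)"
    note perms = R swap[OF R] rot[OF R] rot[OF rot[OF R]] swap[OF rot[OF R]] swap[OF rot[OF rot[OF R]]]
    show "col {a, b, c} = 0" using that perms by (simp add: col_def)
  qed
  have "col \<in> nsets {..<M} 3 \<rightarrow> {..<2}" by (auto simp: col_def)
  then have "col \<in> nsets {..<M} 3 \<rightarrow> {..<length [s, m]}" by (simp add: numeral_2_eq_2)
  then obtain i I where
    I: "i < length [s, m]" "I \<in> nsets {..<M} ([s, m] ! i)" "col ` nsets I 3 \<subseteq> {i}" by (rule partn_lstE[OF ramsey _ refl])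
  have IM: "I \<subseteq> {..<M}" "finite I" "card I = [s, m] ! i" using I(2) by (auto simp: nsets_def)
  have col_i: "col {a, b, c} = i" if "a \<in> I" "b \<in> I" "c \<in> I" "a \<noteq> b" "a \<noteq> c" "b \<noteq> c" for a b c
  proof -
    have "{a, b, c} \<in> nsets I 3" using that by (simp add: nsets_def)
    then show ?thesis using I(3) by blast
  qed
  have "i \<noteq> 0"
  proof
    assume "i = 0"
    have "inj_on rep I"
      using rep Bdisj IM by (intro inj_onI) (metis IntI empty_iff lessThan_iff subsetD)
    then have "card (rep ` I) = s" using IM \<open>i = 0\<close> by (simp add: card_image)
    moreover have "rep ` I \<subseteq> H" using rep BH IM by blast
    moreover have "red_set R (rep ` I)"
      using col_i col \<open>i = 0\<close> by (auto simp: red_set_def)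
    ultimately show False using no_red by blast
  qed
  then have i: "i = 1" using I(1) by simp
  have blue3: "\<not> R u v w" if "a \<in> I" "b \<in> I" "c \<in> I" "a \<noteq> b" "a \<noteq> c" "b \<noteq> c" "u \<in> B a" "v \<in> B b" "w \<in> B c" for a b c u v w
    using hom[of a b c u v w] col_i[of a b c] col[of a b c] that IM i by auto
  define good where "good a b h \<longleftrightarrow> (\<forall>u\<in>B a. h u < q) \<and>
    (\<forall>u\<in>B a. \<forall>v\<in>B a. h u = h v \<longrightarrow> \<not> R u v (rep b))" for a b and h :: "'a \<Rightarrow> nat"
  define h where "h a b = (SOME h. good a b h)" for a b
  have good: "good a b (h a b)" if "a < M" "b < M" "a \<noteq> b" for a b
  proof -
    have fin: "finite (B a)" by (rule finite_subset[OF BH(1)[OF that(1)] H(1)])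
    have mem: "rep b \<in> H" using rep[OF that(2)] BH(1)[OF that(2)] by (rule subsetD[rotated])
    have sub: "B a \<subseteq> H - {rep b}"
      using BH(1)[OF that(1)] rep[OF that(2)] Bdisj[OF that] by blast
    have "\<not> (\<exists>Q\<subseteq>B a. card Q = q \<and> (\<forall>u\<in>Q. \<forall>v\<in>Q. u \<noteq> v \<longrightarrow> R u v (rep b)))"
    proof
      assume "\<exists>Q\<subseteq>B a. card Q = q \<and> (\<forall>u\<in>Q. \<forall>v\<in>Q. u \<noteq> v \<longrightarrow> R u v (rep b))"
      then obtain Q where Q: "Q \<subseteq> B a" "card Q = q" "\<forall>u\<in>Q. \<forall>v\<in>Q. u \<noteq> v \<longrightarrow> R u v (rep b)"
        by (elim exE conjE)
      have ?clique
        using mem Q(2,3) order.trans[OF Q(1) sub] by (intro bexI[of _ "rep b"] exI[of _ Q] conjI)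
      with no_clique show False by (rule notE)
    qed
    from disj_imp[THEN iffD1, OF clique_or_rank[OF fin], THEN mp, OF this]
    have "\<exists>h. good a b h" unfolding good_def .
    then show ?thesis unfolding h_def by (rule someI_ex)
  qed
  have h: "h a b u < q" if "a < M" "b < M" "a \<noteq> b" "u \<in> B a" for a b u
    using good[OF that(1-3)] that(4) unfolding good_def by blast
  define nice where "nice a K \<longleftrightarrow> K \<subseteq> B a \<and> r \<le> card K \<and>
    (\<forall>b<M. b \<noteq> a \<longrightarrow> (\<forall>u\<in>K. \<forall>v\<in>K. \<not> R u v (rep b)))" for a K
  define K where "K a = (SOME K. nice a K)" for a
  have "nice a (K a)" if a: "a < M" for a
  proof -
    \<comment> \<open>The vector of ranks of \<open>u\<close> in the links of the
      \<open>M - 1\<close> other representatives. There are at most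
      \<open>q ^ (M - 1) \<le> r\<close> vectors, so among the \<open>r^2\<close> points of the cell
      some \<open>r\<close> share one, and equal ranks exclude edges in all these links.\<close>
    define t where "t u = restrict (\<lambda>b. h a b u) ({..<M} - {a})" for u
    have "t ` B a \<subseteq> ({..<M} - {a}) \<rightarrow>\<^sub>E {..<q}" 
      unfolding t_def using h a by (intro image_subsetI restrict_PiE_iff[THEN iffD2] ballI) auto
    then have "card (t ` B a) \<le> card (({..<M} - {a}) \<rightarrow>\<^sub>E {..<q})"
      by (intro card_mono finite_PiE) auto
    also have "\<dots> = q ^ (M - 1)" using a by (simp add: card_PiE)
    also have "\<dots> \<le> r"
      using q power_increasing[of "M - 1" M q] by linarith
    finally have le: "r * card (t ` B a) \<le> card (B a)" using BH(2)[OF a] by (simp add: power2_eq_square)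
    have fin: "finite (B a)" by (rule finite_subset[OF BH(1)[OF a] H(1)])
    have ne: "B a \<noteq> {}" using rep[OF a] by blast
    obtain y where y: "r \<le> card {x \<in> B a. t x = y}" using pigeonhole_class[OF fin ne le] by blast
    have "\<not> R u v (rep b)" if *: "b < M" "b \<noteq> a" "u \<in> {x \<in> B a. t x = y}" "v \<in> {x \<in> B a. t x = y}" for b u v
    proof -
      have "t u b = t v b" using *(3,4) by simp
      then have "h a b u = h a b v" using *(1,2) by (simp add: t_def)
      then show ?thesis using good[OF a *(1) *(2)[symmetric]] *(3,4) unfolding good_def by blast
    qed
    then have "nice a {x \<in> B a. t x = y}" using y unfolding nice_def by blast
    then show ?thesis unfolding K_def by (rule someI)
  qed
  then have K: "\<And>a. a < M \<Longrightarrow> K a \<subseteq> B a" "\<And>a. a < M \<Longrightarrow> r \<le> card (K a)"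
    "\<And>a b u v. a < M \<Longrightarrow> b < M \<Longrightarrow> b \<noteq> a \<Longrightarrow> u \<in> K a \<Longrightarrow> v \<in> K a \<Longrightarrow> \<not> R u v (rep b)"
    unfolding nice_def by blast+
  have blue2: "\<not> R u v w" if "a < M" "b < M" "b \<noteq> a" "u \<in> K a" "v \<in> K a" "w \<in> K b" for a b u v w
  proof -
    have "u \<in> B a" "v \<in> B a" "w \<in> B b" using K(1)[OF that(1)] K(1)[OF that(2)] that by blast+
    then have "R u v w = R u v (rep b)"
      using rep[OF that(2)] by (intro lin_indep[OF that(1,1,2,3,3)])
    then show ?thesis using K(3)[OF that(1-5)] by simp
  qed
  have diag: "i = j \<and> j = k"
    if "i \<in> I" "j \<in> I" "k \<in> I" "u \<in> K i" "v \<in> K j" "w \<in> K k" and R: "R u v w" for i j k u v w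
  proof (rule ccontr)
    assume "\<not> (i = j \<and> j = k)"
    have M: "i < M" "j < M" "k < M" using that(1-3) IM(1) by auto
    consider "i = j" "j \<noteq> k" | "i = k" "i \<noteq> j" | "j = k" "i \<noteq> j" | "i \<noteq> j" "i \<noteq> k" "j \<noteq> k"
      using \<open>\<not> (i = j \<and> j = k)\<close> by blast
    then show False
    proof cases
      case 1
      then show False using blue2[of i k u v w] R that(4-6) M by simp
    next
      case 2
      then show False using blue2[of i j w u v] rot[OF rot[OF R]] that(4-6) M by simp
    next
      case 3
      then show False using blue2[of j i v w u] rot[OF R] that(4-6) M by simp
    next
      case 4
      have "u \<in> B i" "v \<in> B j" "w \<in> B k" using K(1)[OF M(1)] K(1)[OF M(2)] K(1)[OF M(3)] that(4-6) by blast+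
      then show False using blue3[OF that(1-3) 4] R by simp
    qed
  qed
  have sub: "K i \<subseteq> H \<and> r \<le> card (K i)" if "i \<in> I" for i
  proof -
    have "i < M" using that IM(1) by blast
    then show ?thesis using K(1,2)[of i] BH(1)[of i] by simp
  qed
  have disj: "K i \<inter> K j = {}" if "i \<in> I" "j \<in> I" "i \<noteq> j" for i j
  proof -
    have "i < M" "j < M" using that IM(1) by blast+
    then show ?thesis using K(1)[of i] K(1)[of j] Bdisj[of i j] that(3) by blast
  qed
  have "card I = m" using IM(3) i by simp
  then have ?blocks
    using sub disj diag by (intro exI[of _ I] exI[of _ K] conjI ballI impI) simp_all
  with no_blocks show False by (rule notE)
qed

end

section \<open>Recursion for the size of a blue set\<close>

lemma nat_root_bracket:
  fixes r M :: nat
  assumes "M > 0"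
  shows "\<exists>q. q ^ M \<le> r \<and> r < Suc q ^ M"
proof -
  let ?P = "\<lambda>n. r < Suc n ^ M"
  have "?P r" using self_le_power[of "Suc r" M] assms by simp
  then have 1: "?P (LEAST n. ?P n)" by (rule LeastI)
  have "(LEAST n. ?P n) ^ M \<le> r"
  proof (cases "LEAST n. ?P n")
    case 0
    then show ?thesis using assms by (simp add: power_0_left)
  next
    case (Suc n)
    then have "\<not> ?P n" using not_less_Least[of n ?P] by simp
    then show ?thesis using Suc by simp
  qed
  with 1 show ?thesis by blast
qed

text \<open>Since \<open>q + 1 \<le> q^2\<close>, rounding a root down to an integer costs at most a
  factor 2 in the logarithm.\<close>

lemma ln_le_of_lt_Suc_power:
  assumes "2 \<le> q" "n < Suc q ^ M" "0 < n"
  shows "ln (real n) \<le> 2 * real M * ln (real q)"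
proof -
  have "Suc q \<le> q * q" using assms(1) mult_le_mono1[of 2 q q] by linarith
  then have "n \<le> (q * q) ^ M" using assms(2) power_mono[of "Suc q" "q * q" M] by linarith
  then have "real n \<le> real q ^ (2 * M)"
    by (metis of_nat_le_iff of_nat_power power2_eq_square power_mult)
  then have "ln (real n) \<le> ln (real q ^ (2 * M))" using assms by simp
  also have "\<dots> = 2 * real M * ln (real q)" using assms by (simp add: ln_realpow)
  finally show ?thesis .
qed

lemma power_less_two_power_eventually: "\<exists>r0. \<forall>r\<ge>r0. 3 * r ^ c < (2::nat) ^ r"
proof -
  have "eventually (\<lambda>r::nat. 3 * real r powr real c < 2 powr real r) at_top" by real_asymp
  then have "eventually (\<lambda>r::nat. 3 * r ^ c < (2::nat) ^ r) at_top"
    using eventually_gt_at_top[of 0]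
  proof eventually_elim
    case (elim r)
    then have "real (3 * r ^ c) < real (2 ^ r)" by (simp add: powr_realpow)
    then show ?case by (simp only: of_nat_less_iff)
  qed
  then show ?thesis by (auto simp: eventually_at_top_linorder)
qed

text \<open>\<open>K\<close> is arbitrary and \<open>\<kappa>\<close> depends only on
  \<open>p\<close>, \<open>s\<close> and \<open>K\<close>, so the blue size exceeds every power of
  the logarithm. The induction on \<open>s\<close> serves the clique case; inside it, strong
  induction on the size of \<open>H\<close> serves the block case, where the blue sets of the blocks
  are united.\<close>

lemma link_ordered_red_or_blue:
  "\<exists>\<kappa>>0. \<forall>(R :: 'a \<Rightarrow> 'a \<Rightarrow> 'a \<Rightarrow> bool) H. link_ordered R p \<longrightarrow> finite H \<longrightarrow> H \<noteq> {} \<longrightarrow>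
     (\<exists>S\<subseteq>H. red_set R S \<and> card S = s) \<or>
     (\<exists>S\<subseteq>H. blue_set R S \<and> \<kappa> * ln (real (card H)) ^ K \<le> real (card S))"
proof (induction s)
  case 0
  have "\<exists>S\<subseteq>H. red_set R S \<and> card S = 0" for R :: "'a \<Rightarrow> 'a \<Rightarrow> 'a \<Rightarrow> bool" and H
    by (intro exI[of _ "{}"]) (auto simp: red_set_def)
  then show ?case by (intro exI[of _ 1]) auto
next
  case (Suc s)
  then obtain \<kappa>' :: real where \<kappa>': "\<kappa>' > 0" and IH: "\<And>(R :: 'a \<Rightarrow> 'a \<Rightarrow> 'a \<Rightarrow> bool) H.
     link_ordered R p \<Longrightarrow> finite H \<Longrightarrow> H \<noteq> {} \<Longrightarrow> (\<exists>S\<subseteq>H. red_set R S \<and> card S = s) \<or>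
     (\<exists>S\<subseteq>H. blue_set R S \<and> \<kappa>' * ln (real (card H)) ^ K \<le> real (card S))" by auto
  define E where "E = 10 * p + 10"
  \<comment> \<open>As \<open>ln (card H) \<le> 2 * E * ln r\<close>, replacing
    \<open>card H\<close> by the block size \<open>r\<close> loses the factor
    \<open>(2 * E) ^ K\<close>; this many blocks recover it.\<close>
  define m where "m = (2 * E) ^ K"
  obtain M0 where "partn_lst {..<M0::nat} [Suc s, m] 3" using ramsey_full by blast
  then have "partn_lst {..<Suc M0} [Suc s, m] 3" by (rule partn_lst_greater_resource) simp
  with zero_less_Suc[of M0] obtain M :: nat where ramsey: "partn_lst {..<M} [Suc s, m] 3" and M0: "M > 0" by blast
  obtain r1 where r1: "\<And>r. r1 \<le> r \<Longrightarrow> 3 * r ^ (20 * p + 20) < (2::nat) ^ r"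
    using power_less_two_power_eventually by blast
  \<comment> \<open>\<open>r1\<close> handles the exponential inequality,
    \<open>2 * M ^ 3 + 2\<close> gives \<open>M ^ 3 * (r ^ 5 + 1) < r ^ 6\<close>, and
    \<open>2 ^ M\<close> makes the integer root \<open>q\<close> at least 2.\<close>
  define r0 where "r0 = max r1 (max (2 * M ^ 3 + 2) (2 ^ M))"
  \<comment> \<open>The first term fits the clique case, where
    \<open>ln (card H) \<le> 2 * E * 2 * M * ln q\<close>. The second makes the claimed size at most
    1 when \<open>r < r0\<close>, so that a single point is enough.\<close>
  define \<kappa> where "\<kappa> = min (\<kappa>' / (2 * real M * (2 * real E)) ^ K) (1 / (1 + ln (real (Suc r0 ^ E))) ^ K)"
  have lnr0: "0 \<le> ln (real (Suc r0 ^ E))" by (rule ln_ge_zero) simp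
  have "0 < (1 + ln (real (Suc r0 ^ E))) ^ K" using lnr0 by (intro zero_less_power) linarith
  then have \<kappa>: "\<kappa> > 0" using \<kappa>' by (simp add: \<kappa>_def M0 E_def)
  have "(\<exists>S\<subseteq>H. red_set R S \<and> card S = Suc s) \<or>
     (\<exists>S\<subseteq>H. blue_set R S \<and> \<kappa> * ln (real (card H)) ^ K \<le> real (card S))"
    if R: "link_ordered R p" and "finite H" "H \<noteq> {}" for R :: "'a \<Rightarrow> 'a \<Rightarrow> 'a \<Rightarrow> bool" and H
    using that(2,3)
  proof (induction "card H" arbitrary: H rule: less_induct)
    case less
    interpret link_ordered R p by (rule R)
    have N: "card H > 0" using less.prems by (simp add: card_gt_0_iff)
    obtain r where r: "r ^ E \<le> card H" "card H < Suc r ^ E"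
      using nat_root_bracket[of E "card H"] by (auto simp: E_def)
    show ?case
    proof (cases "r < r0")
      case True
      then have "Suc r ^ E \<le> Suc r0 ^ E" by (intro power_mono) auto
      then have "real (card H) \<le> real (Suc r0 ^ E)" using r(2) by linarith
      then have "ln (real (card H)) \<le> 1 + ln (real (Suc r0 ^ E))"
        using N by (simp add: add_increasing del: of_nat_power)
      then have le: "ln (real (card H)) ^ K \<le> (1 + ln (real (Suc r0 ^ E))) ^ K"
        using N by (intro power_mono) auto
      have "\<kappa> * ln (real (card H)) ^ K \<le> 1 / (1 + ln (real (Suc r0 ^ E))) ^ K * (1 + ln (real (Suc r0 ^ E))) ^ K"
        using le \<kappa> N lnr0 by (intro mult_mono) (auto simp: \<kappa>_def simp del: of_nat_power of_nat_Suc)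
      also have "\<dots> \<le> 1" by simp
      finally have "\<kappa> * ln (real (card H)) ^ K \<le> 1" .
      moreover obtain x where "x \<in> H" using less.prems by blast
      ultimately show ?thesis
        using irrefl by (intro disjI2 exI[of _ "{x}"]) (auto simp: blue_set_def)
    next
      case False
      then have rr: "r1 \<le> r" "2 * M ^ 3 < r" "2 \<le> r" "2 ^ M \<le> r" by (auto simp: r0_def)
      obtain q where q: "q ^ M \<le> r" "r < Suc q ^ M" using nat_root_bracket[of M r] by (auto simp: M0)
      have q2: "2 \<le> q"
      proof (rule ccontr)
        assume "\<not> 2 \<le> q"
        then have "Suc q ^ M \<le> 2 ^ M" by (intro power_mono) auto
        then show False using q rr by linarith
      qed
      have lnH: "ln (real (card H)) \<le> 2 * real E * ln (real r)"
        by (rule ln_le_of_lt_Suc_power) (use rr r N in auto)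
      have lnr: "ln (real r) \<le> 2 * real M * ln (real q)"
        by (rule ln_le_of_lt_Suc_power) (use rr q q2 in auto)
      have lnH0: "0 \<le> ln (real (card H))" using N by simp
      obtain H' where H': "H' \<subseteq> H" "card H' = r ^ E" "finite H'"
        using r(1) by (meson obtain_subset_with_card_n)
      have "M ^ 3 * (r ^ 5 + 1) \<le> M ^ 3 * (2 * r ^ 5)" using rr by (intro mult_left_mono) auto
      also have "\<dots> < r * r ^ 5" using rr by (simp add: mult.assoc[symmetric] mult.commute[of _ 2])
      finally have c1: "M ^ 3 * (r ^ 5 + 1) < r ^ 6" by (simp add: eval_nat_numeral)
      have q1: "1 \<le> q" using q2 by simp
      consider (red) "\<exists>S\<subseteq>H'. red_set R S \<and> card S = Suc s"
        | (clique) "\<exists>w\<in>H'. \<exists>Q\<subseteq>H' - {w}. card Q = q \<and> (\<forall>u\<in>Q. \<forall>v\<in>Q. u \<noteq> v \<longrightarrow> R u v w)"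
        | (blocks) "\<exists>(I :: nat set) K. card I = m \<and> (\<forall>i\<in>I. K i \<subseteq> H' \<and> r \<le> card (K i)) \<and>
      (\<forall>i\<in>I. \<forall>j\<in>I. i \<noteq> j \<longrightarrow> K i \<inter> K j = {}) \<and>
      (\<forall>i\<in>I. \<forall>j\<in>I. \<forall>k\<in>I. \<forall>u\<in>K i. \<forall>v\<in>K j. \<forall>w\<in>K k. R u v w \<longrightarrow> i = j \<and> j = k)"
        using blue_blocks[OF H'(3) H'(2)[unfolded E_def] q1 q(1) ramsey c1 r1[OF rr(1)]] by (elim disjE)
      then show ?thesis
      proof cases
        case red
        then show ?thesis using H' by (meson order.trans)
      next
        case clique
        then obtain w Q where Q: "w \<in> H'" "Q \<subseteq> H' - {w}" "card Q = q" "\<forall>u\<in>Q. \<forall>v\<in>Q. u \<noteq> v \<longrightarrow> R u v w" by blast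
        have finQ: "finite Q" "Q \<noteq> {}" using Q q2 card_ge_0_finite[of Q] by auto
        from IH[OF R finQ] show ?thesis
        proof (elim disjE exE conjE)
          fix S assume S: "S \<subseteq> Q" "red_set R S" "card S = s"
          have "w \<notin> S" using S(1) Q(2) by blast
          moreover have "finite S" by (rule finite_subset[OF S(1) finQ(1)])
          ultimately have wS: "w \<notin> S" "finite S" .
          have "red_set R (insert w S)"
            unfolding red_set_def
          proof (intro ballI impI)
            fix a b c assume abc: "a \<in> insert w S" "b \<in> insert w S" "c \<in> insert w S" "a \<noteq> b" "a \<noteq> c" "b \<noteq> c"
            have w: "R x y w" if "x \<in> S" "y \<in> S" "x \<noteq> y" for x y using that S(1) Q(4) by blast
            consider "a = w" "b \<in> S" "c \<in> S" | "b = w" "a \<in> S" "c \<in> S" | "c = w" "a \<in> S" "b \<in> S" | "a \<in> S" "b \<in> S" "c \<in> S"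
              using abc by blast
            then show "R a b c"
            proof cases
              case 1
              then show ?thesis using rot[OF rot[OF w[of b c]]] abc by simp
            next
              case 2
              then show ?thesis using rot[OF w[of c a]] abc by simp
            next
              case 3
              then show ?thesis using w[of a b] abc by simp
            next
              case 4
              then show ?thesis using S(2) abc unfolding red_set_def by blast
            qed
          qed
          then show ?thesis using S wS Q H' by (intro disjI1 exI[of _ "insert w S"]) auto
        next
          fix S assume S: "S \<subseteq> Q" "blue_set R S" "\<kappa>' * ln (real (card Q)) ^ K \<le> real (card S)"
          have "ln (real (card H)) \<le> (2 * real E) * (2 * real M * ln (real q))"
            using lnH lnr by (meson mult_left_mono order.trans of_nat_0_le_iff mult_nonneg_nonneg zero_le_numeral)
          then have "ln (real (card H)) ^ K \<le> ((2 * real E) * (2 * real M * ln (real q))) ^ K"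
            using lnH0 by (intro power_mono)
          then have "\<kappa> * ln (real (card H)) ^ K \<le> \<kappa>' / (2 * real M * (2 * real E)) ^ K * ((2 * real E) * (2 * real M * ln (real q))) ^ K"
            using \<kappa> \<kappa>' lnH0 by (intro mult_mono) (auto simp: \<kappa>_def)
          also have "\<dots> = \<kappa>' * ln (real q) ^ K"
            using M0 by (simp add: power_mult_distrib E_def)
          also have "\<dots> \<le> real (card S)" using S Q by simp
          finally show ?thesis using S Q H' by (intro disjI2 exI[of _ S]) auto
        qed
      next
        case blocks
        then obtain I :: "nat set" and B where B: "card I = m" "\<forall>i\<in>I. B i \<subseteq> H' \<and> r \<le> card (B i)"
          "\<forall>i\<in>I. \<forall>j\<in>I. i \<noteq> j \<longrightarrow> B i \<inter> B j = {}"
          "\<forall>i\<in>I. \<forall>j\<in>I. \<forall>k\<in>I. \<forall>u\<in>B i. \<forall>v\<in>B j. \<forall>w\<in>B k. R u v w \<longrightarrow> i = j \<and> j = k"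
          by (elim exE conjE)
        have "card I > 0" using B(1) by (simp add: m_def E_def)
        then have finI: "finite I" by (rule card_ge_0_finite)
        show ?thesis
        proof (rule disjCI)
          assume no_blue: "\<not> (\<exists>S\<subseteq>H. blue_set R S \<and> \<kappa> * ln (real (card H)) ^ K \<le> real (card S))"
          show "\<exists>S\<subseteq>H. red_set R S \<and> card S = Suc s"
          proof (rule ccontr)
            assume no_red: "\<not> ?thesis"
            have "\<exists>S. S \<subseteq> B i \<and> finite S \<and> blue_set R S \<and> \<kappa> * ln (real r) ^ K \<le> real (card S)" if i: "i \<in> I" for i
            proof -
              from B(2) i have Bi: "B i \<subseteq> H' \<and> r \<le> card (B i)" by (rule bspec)
              obtain D where D: "D \<subseteq> B i" "card D = r" "finite D"
                by (rule obtain_subset_with_card_n[OF conjunct2[OF Bi]])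
              have D0: "D \<noteq> {}" using D(2) rr(3) by auto
              have DH: "D \<subseteq> H" using D(1) conjunct1[OF Bi] H'(1) by (meson order.trans)
              have "r < r ^ E" using rr power_strict_increasing[of 1 E r] by (simp add: E_def)
              then have "card D < card H" using D r by simp
              from less.hyps[OF this D(3) D0] show ?thesis
              proof (elim disjE exE conjE)
                fix S assume "S \<subseteq> D" "red_set R S" "card S = Suc s"
                then have "\<exists>S\<subseteq>H. red_set R S \<and> card S = Suc s" using DH by (intro exI[of _ S]) simp
                with no_red show ?thesis by (rule notE)
              next
                fix S assume S: "S \<subseteq> D" "blue_set R S" "\<kappa> * ln (real (card D)) ^ K \<le> real (card S)"
                have "finite S" by (rule finite_subset[OF S(1) D(3)])
                then show ?thesis using S D(1,2) by (intro exI[of _ S]) simp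
              qed
            qed
            then obtain S where S: "\<And>i. i \<in> I \<Longrightarrow> S i \<subseteq> B i" "\<And>i. i \<in> I \<Longrightarrow> finite (S i)"
              "\<And>i. i \<in> I \<Longrightarrow> blue_set R (S i)" "\<And>i. i \<in> I \<Longrightarrow> \<kappa> * ln (real r) ^ K \<le> real (card (S i))"
              by metis
            have disj: "\<forall>i\<in>I. \<forall>j\<in>I. i \<noteq> j \<longrightarrow> S i \<inter> S j = {}" using S(1) B(3) by blast
            have "card (\<Union>i\<in>I. S i) = (\<Sum>i\<in>I. card (S i))"
              using finI S(2) disj by (intro card_UN_disjoint) auto
            have "\<kappa> * ln (real (card H)) ^ K \<le> \<kappa> * (2 * real E * ln (real r)) ^ K"
              using lnH lnH0 \<kappa> by (intro mult_left_mono power_mono) auto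
            also have "\<dots> = real m * (\<kappa> * ln (real r) ^ K)"
              by (simp add: m_def power_mult_distrib)
            also have "\<dots> = (\<Sum>i\<in>I. \<kappa> * ln (real r) ^ K)" using B(1) by simp
            also have "\<dots> \<le> (\<Sum>i\<in>I. real (card (S i)))" by (intro sum_mono S(4))
            also have "\<dots> = real (card (\<Union>i\<in>I. S i))"
              using \<open>card (\<Union>i\<in>I. S i) = (\<Sum>i\<in>I. card (S i))\<close> by simp
            finally have "\<kappa> * ln (real (card H)) ^ K \<le> real (card (\<Union>i\<in>I. S i))" .
            moreover have "blue_set R (\<Union>i\<in>I. S i)"
              unfolding blue_set_def
            proof (intro ballI notI)
              fix u v w assume *: "u \<in> (\<Union>i\<in>I. S i)" "v \<in> (\<Union>i\<in>I. S i)" "w \<in> (\<Union>i\<in>I. S i)" "R u v w"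
              then obtain i j k where ijk: "i \<in> I" "j \<in> I" "k \<in> I" "u \<in> S i" "v \<in> S j" "w \<in> S k" by blast
              then have "u \<in> B i" "v \<in> B j" "w \<in> B k" using S(1)[of i] S(1)[of j] S(1)[of k] by blast+
              then have "i = j \<and> j = k" using B(4) ijk(1-3) *(4) by blast
              then show False using S(3)[OF ijk(1)] ijk *(4) unfolding blue_set_def by blast
            qed
            moreover have "(\<Union>i\<in>I. S i) \<subseteq> H" using S(1) B(2) H' by blast
            ultimately have "\<exists>S\<subseteq>H. blue_set R S \<and> \<kappa> * ln (real (card H)) ^ K \<le> real (card S)"
              by (intro exI[of _ "\<Union>i\<in>I. S i"] conjI)
            with no_blue show False by (rule notE)
          qed
        qed
      qed
    qed
  qed
  then show ?case using \<kappa> by blast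
qed

section \<open>Orientation of planar triples\<close>

text \<open>Twice the signed area of the triangle with vertices \<open>(y u, \<alpha> u)\<close>,
  \<open>(y v, \<alpha> v)\<close>, \<open>(y w, \<alpha> w)\<close>.\<close>

definition orient :: "('a \<Rightarrow> real) \<Rightarrow> ('a \<Rightarrow> real) \<Rightarrow> 'a \<Rightarrow> 'a \<Rightarrow> 'a \<Rightarrow> real" where
  "orient y \<alpha> u v w = (y v - y u) * (\<alpha> w - \<alpha> u) - (y w - y u) * (\<alpha> v - \<alpha> u)"

definition same_orient :: "('a \<Rightarrow> real) \<Rightarrow> ('a \<Rightarrow> real) \<Rightarrow> ('a \<Rightarrow> real) \<Rightarrow> 'a \<Rightarrow> 'a \<Rightarrow> 'a \<Rightarrow> bool" where
  "same_orient y \<alpha> \<beta> u v w \<longleftrightarrow> orient y \<alpha> u v w * orient y \<beta> u v w > 0"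

lemma orient_swap: "orient y \<alpha> v u w = - orient y \<alpha> u v w"
  by (simp add: orient_def algebra_simps)

lemma orient_rot: "orient y \<alpha> v w u = orient y \<alpha> u v w"
  by (simp add: orient_def algebra_simps)

text \<open>Seen from \<open>w\<close>, each orientation is \<open>(y u - y w) * (y v - y w)\<close>
  times a difference of slopes. In the product of the two orientations the common factor is squared,
  so only the order of the slopes in the two point sets matters. A point with the abscissa of
  \<open>w\<close> is comparable either to all other directions or to none, according to the sign of
  \<open>(\<alpha> u - \<alpha> w) * (\<beta> u - \<beta> w)\<close>.\<close>

lemma same_orient_link:
  "\<exists>f g. \<forall>u v. same_orient y \<alpha> \<beta> u v w \<longleftrightarrow> ((f u :: real) - f v) * (g u - g v :: real) > 0"
proof -
  define sl where "sl \<gamma> u = (\<gamma> u - \<gamma> w) / (y u - y w)" for \<gamma> :: "'a \<Rightarrow> real" and u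
  \<comment> \<open>points above or below \<open>w\<close> have infinite slope; the values \<open>2\<close> and \<open>- 2\<close> lie outside the range of \<open>arctan\<close>\<close>
  define f where "f u = (if y u = y w then 2 else arctan (sl \<alpha> u))" for u
  define g where "g u = (if y u = y w then if (\<alpha> u - \<alpha> w) * (\<beta> u - \<beta> w) > 0 then 2 else - 2
    else arctan (sl \<beta> u))" for u
  have arc: "- 2 < arctan x" "arctan x < 2" for x
    using arctan_bounded[of x] pi_less_4 by linarith+
  have nondeg: "orient y \<gamma> u v w = (y u - y w) * (y v - y w) * (sl \<gamma> v - sl \<gamma> u)"
    if "y u \<noteq> y w" "y v \<noteq> y w" for \<gamma> u v
  proof -
    have slope: "\<gamma> v = \<gamma> w + sl \<gamma> v * (y v - y w)" "\<gamma> u = \<gamma> w + sl \<gamma> u * (y u - y w)"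
      using that by (simp_all add: sl_def)
    show ?thesis unfolding orient_def slope by (simp add: algebra_simps)
  qed
  have pos: "(a - b :: real)\<^sup>2 * c > 0 \<longleftrightarrow> a \<noteq> b \<and> c > 0" for a b c
    by (simp add: zero_less_mult_iff)
  have "same_orient y \<alpha> \<beta> u v w \<longleftrightarrow> (f u - f v) * (g u - g v) > 0" for u v
  proof -
    consider "y u = y w" "y v = y w" | "y u = y w" "y v \<noteq> y w" | "y u \<noteq> y w" "y v = y w" | "y u \<noteq> y w" "y v \<noteq> y w"
      by blast
    then show ?thesis
    proof cases
      case 1
      then show ?thesis by (simp add: same_orient_def orient_def f_def)
    next
      case 2
      have "same_orient y \<alpha> \<beta> u v w \<longleftrightarrow> (y v - y w)\<^sup>2 * ((\<alpha> u - \<alpha> w) * (\<beta> u - \<beta> w)) > 0"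
        using 2 by (simp add: same_orient_def orient_def power2_eq_square algebra_simps)
      then show ?thesis using 2 arc[of "sl \<alpha> v"] arc[of "sl \<beta> v"] by (simp add: pos f_def g_def zero_less_mult_iff)
    next
      case 3
      have "same_orient y \<alpha> \<beta> u v w \<longleftrightarrow> (y u - y w)\<^sup>2 * ((\<alpha> v - \<alpha> w) * (\<beta> v - \<beta> w)) > 0"
        using 3 by (simp add: same_orient_def orient_def power2_eq_square algebra_simps)
      then show ?thesis using 3 arc[of "sl \<alpha> u"] arc[of "sl \<beta> u"] by (simp add: pos f_def g_def zero_less_mult_iff)
    next
      case 4
      have "same_orient y \<alpha> \<beta> u v w \<longleftrightarrow>
        (y u - y w)\<^sup>2 * ((y v - y w)\<^sup>2 * ((sl \<alpha> v - sl \<alpha> u) * (sl \<beta> v - sl \<beta> u))) > 0"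
        unfolding same_orient_def nondeg[OF 4] by (simp add: power2_eq_square mult_ac)
      then show ?thesis using 4 by (auto simp: pos f_def g_def zero_less_mult_iff arctan_less_iff)
    qed
  qed
  then show ?thesis by blast
qed

lemma eq_of_chain_card:
  assumes "finite U" "finite V" "card U = card V" "U \<subseteq> V \<or> V \<subseteq> U"
  shows "U = V"
  using assms card_subset_eq by metis

text \<open>Lower sets of a common weak order form a chain, so their cardinality identifies them.
  The thresholds and the functions may differ as long as the induced order is the same.\<close>

lemma rank_determines_lower_sets:
  fixes g g' :: "'q \<Rightarrow> real"
  assumes S: "finite S" and order: "\<And>q q'. q \<in> S \<Longrightarrow> q' \<in> S \<Longrightarrow> g q < g q' \<longleftrightarrow> g' q < g' q'"
  shows "card {q \<in> S. g q < a} = card {q \<in> S. g' q < a'} \<Longrightarrow> {q \<in> S. g q < a} = {q \<in> S. g' q < a'}"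
    and "card {q \<in> S. g q \<le> a} = card {q \<in> S. g' q \<le> a'} \<Longrightarrow> {q \<in> S. g q \<le> a} = {q \<in> S. g' q \<le> a'}"
proof -
  show "{q \<in> S. g q < a} = {q \<in> S. g' q < a'}" if "card {q \<in> S. g q < a} = card {q \<in> S. g' q < a'}"
  proof (rule eq_of_chain_card[OF _ _ that])
    show "{q \<in> S. g q < a} \<subseteq> {q \<in> S. g' q < a'} \<or> {q \<in> S. g' q < a'} \<subseteq> {q \<in> S. g q < a}"
    proof (rule ccontr)
      assume "\<not> ?thesis"
      then obtain q q' where "q \<in> S" "q' \<in> S" "g q < a" "\<not> g' q < a'" "g' q' < a'" "\<not> g q' < a" by blast
      then show False using order[of q q'] by linarith
    qed
  qed (use S in auto)
  show "{q \<in> S. g q \<le> a} = {q \<in> S. g' q \<le> a'}" if "card {q \<in> S. g q \<le> a} = card {q \<in> S. g' q \<le> a'}"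
  proof (rule eq_of_chain_card[OF _ _ that])
    show "{q \<in> S. g q \<le> a} \<subseteq> {q \<in> S. g' q \<le> a'} \<or> {q \<in> S. g' q \<le> a'} \<subseteq> {q \<in> S. g q \<le> a}"
    proof (rule ccontr)
      assume "\<not> ?thesis"
      then obtain q q' where "q \<in> S" "q' \<in> S" "g q \<le> a" "\<not> g' q \<le> a'" "g' q' \<le> a'" "\<not> g q' \<le> a" by blast
      then show False using order[of q q'] order[of q' q] by linarith
    qed
  qed (use S in auto)
qed

text \<open>The sign is decided by the position relative to the root
  \<open>- \<delta> / \<rho>\<close>; the strict comparison serves a negative slope and the weak one
  a positive slope. For slope 0 there is nothing to compare.\<close>

lemma affine_sign_eq:
  fixes \<delta> \<rho> :: real
  assumes "\<rho> \<noteq> 0 \<Longrightarrow> (- \<delta> / \<rho> < Y \<longleftrightarrow> - \<delta> / \<rho> < Y') \<and> (- \<delta> / \<rho> \<le> Y \<longleftrightarrow> - \<delta> / \<rho> \<le> Y')"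
  shows "\<delta> + \<rho> * Y < 0 \<longleftrightarrow> \<delta> + \<rho> * Y' < 0"
proof -
  consider "\<rho> = 0" | "\<rho> > 0" | "\<rho> < 0" by linarith
  then show ?thesis
  proof cases
    case 1
    then show ?thesis by simp
  next
    case 2
    then have "\<delta> + \<rho> * Z < 0 \<longleftrightarrow> \<not> - \<delta> / \<rho> \<le> Z" for Z by (simp add: field_simps) linarith
    then show ?thesis using assms 2 by simp
  next
    case 3
    then have "\<delta> + \<rho> * Z < 0 \<longleftrightarrow> - \<delta> / \<rho> < Z" for Z by (simp add: field_simps) linarith
    then show ?thesis using assms 3 by simp
  qed
qed

text \<open>As a function of \<open>w\<close>, the colour of \<open>(u, v, w)\<close> is determined by the sides of two non-vertical lines
  through the points \<open>u\<close>, \<open>v\<close>. Sorting the abscissa of \<open>w\<close> among the crossings of these lines fixes their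
  vertical order, so that only the ranks of \<open>w\<close> among the lines remain.\<close>

lemma poly_growth_same_orient: "poly_growth 10 (\<lambda>(u, v) w. same_orient y \<alpha> \<beta> u v w)"
  unfolding poly_growth_def
proof (intro allI impI)
  fix S :: "('a \<times> 'a) set" and X :: "'a set"
  assume S: "finite S"
  define k where "k = card S"
  \<comment> \<open>For a vertical pair the division by zero yields slope 0, a spurious horizontal
    line. It only refines the code; such pairs are decided by their abscissa.\<close>
  define sl where "sl \<gamma> q = (\<gamma> (snd q) - \<gamma> (fst q)) / (y (snd q) - y (fst q))" for \<gamma> :: "'a \<Rightarrow> real" and q
  define ic where "ic \<gamma> q = \<gamma> (fst q) - sl \<gamma> q * y (fst q)" for \<gamma> q
  define L where "L \<gamma> q Y = ic \<gamma> q + sl \<gamma> q * Y" for \<gamma> q Y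
  define cr where "cr \<gamma> = (\<lambda>(q, q'). - (ic \<gamma> q - ic \<gamma> q') / (sl \<gamma> q - sl \<gamma> q'))" for \<gamma>
  \<comment> \<open>The crossings within either family of lines, together with the abscissae of the
    pairs, which decide the vertical ones.\<close>
  define \<Theta> where "\<Theta> = cr \<alpha> ` (S \<times> S) \<union> cr \<beta> ` (S \<times> S) \<union> (\<lambda>q. y (fst q)) ` S"
  have fin: "finite \<Theta>" using S by (simp add: \<Theta>_def)
  have "card \<Theta> \<le> card (S \<times> S) + card (S \<times> S) + card S"
    unfolding \<Theta>_def using S by (intro order.trans[OF card_Un_le] add_mono card_image_le) auto
  then have card\<Theta>: "card \<Theta> \<le> 2 * k ^ 2 + k"
    by (simp add: card_cartesian_product k_def power2_eq_square)
  define code where "code w = (card {\<theta> \<in> \<Theta>. \<theta> < y w}, card {\<theta> \<in> \<Theta>. \<theta> \<le> y w},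
    card {q \<in> S. L \<alpha> q (y w) < \<alpha> w}, card {q \<in> S. L \<alpha> q (y w) \<le> \<alpha> w},
    card {q \<in> S. L \<beta> q (y w) < \<beta> w}, card {q \<in> S. L \<beta> q (y w) \<le> \<beta> w})" for w
  let ?C = "{..card \<Theta>} \<times> {..card \<Theta>} \<times> {..k} \<times> {..k} \<times> {..k} \<times> {..k}"
  have code_sub: "code ` X \<subseteq> ?C"
    using S fin by (auto simp: code_def k_def intro!: card_mono)
  have side: "(L \<gamma> q (y w) < \<gamma> w \<longleftrightarrow> L \<gamma> q (y w') < \<gamma> w') \<and> (L \<gamma> q (y w) \<le> \<gamma> w \<longleftrightarrow> L \<gamma> q (y w') \<le> \<gamma> w')"
    if \<Theta>1: "{\<theta> \<in> \<Theta>. \<theta> < y w} = {\<theta> \<in> \<Theta>. \<theta> < y w'}" and \<Theta>2: "{\<theta> \<in> \<Theta>. \<theta> \<le> y w} = {\<theta> \<in> \<Theta>. \<theta> \<le> y w'}"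
      and sub: "cr \<gamma> ` (S \<times> S) \<subseteq> \<Theta>" and q: "q \<in> S"
      and c1: "card {q \<in> S. L \<gamma> q (y w) < \<gamma> w} = card {q \<in> S. L \<gamma> q (y w') < \<gamma> w'}"
      and c2: "card {q \<in> S. L \<gamma> q (y w) \<le> \<gamma> w} = card {q \<in> S. L \<gamma> q (y w') \<le> \<gamma> w'}" for w w' \<gamma> q
  proof -
    have order: "L \<gamma> q (y w) < L \<gamma> q' (y w) \<longleftrightarrow> L \<gamma> q (y w') < L \<gamma> q' (y w')" if "q \<in> S" "q' \<in> S" for q q'
    proof -
      have "cr \<gamma> (q, q') \<in> \<Theta>" using that by (intro subsetD[OF sub] imageI) simp
      then have "cr \<gamma> (q, q') < y w \<longleftrightarrow> cr \<gamma> (q, q') < y w'" "cr \<gamma> (q, q') \<le> y w \<longleftrightarrow> cr \<gamma> (q, q') \<le> y w'"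
        using eqset_imp_iff[OF \<Theta>1, of "cr \<gamma> (q, q')"] eqset_imp_iff[OF \<Theta>2, of "cr \<gamma> (q, q')"] by simp_all
      then have "(ic \<gamma> q - ic \<gamma> q') + (sl \<gamma> q - sl \<gamma> q') * y w < 0 \<longleftrightarrow> (ic \<gamma> q - ic \<gamma> q') + (sl \<gamma> q - sl \<gamma> q') * y w' < 0"
        by (intro affine_sign_eq) (simp add: cr_def)
      then show ?thesis by (simp add: L_def algebra_simps)
    qed
    show ?thesis
      using eqset_imp_iff[OF rank_determines_lower_sets(1)[OF S order c1], of q]
        eqset_imp_iff[OF rank_determines_lower_sets(2)[OF S order c2], of q] q by simp
  qed
  have determ: "{q \<in> S. (\<lambda>(u, v) w. same_orient y \<alpha> \<beta> u v w) q w} = {q \<in> S. (\<lambda>(u, v) w. same_orient y \<alpha> \<beta> u v w) q w'}"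
    if "code w = code w'" for w w'
  proof -
    have c: "card {\<theta> \<in> \<Theta>. \<theta> < y w} = card {\<theta> \<in> \<Theta>. \<theta> < y w'}" "card {\<theta> \<in> \<Theta>. \<theta> \<le> y w} = card {\<theta> \<in> \<Theta>. \<theta> \<le> y w'}"
      "card {q \<in> S. L \<alpha> q (y w) < \<alpha> w} = card {q \<in> S. L \<alpha> q (y w') < \<alpha> w'}"
      "card {q \<in> S. L \<alpha> q (y w) \<le> \<alpha> w} = card {q \<in> S. L \<alpha> q (y w') \<le> \<alpha> w'}"
      "card {q \<in> S. L \<beta> q (y w) < \<beta> w} = card {q \<in> S. L \<beta> q (y w') < \<beta> w'}"
      "card {q \<in> S. L \<beta> q (y w) \<le> \<beta> w} = card {q \<in> S. L \<beta> q (y w') \<le> \<beta> w'}"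
      using that by (simp_all add: code_def)
    have \<Theta>1: "{\<theta> \<in> \<Theta>. \<theta> < y w} = {\<theta> \<in> \<Theta>. \<theta> < y w'}"
      using rank_determines_lower_sets(1)[OF fin _ c(1)] by blast
    have \<Theta>2: "{\<theta> \<in> \<Theta>. \<theta> \<le> y w} = {\<theta> \<in> \<Theta>. \<theta> \<le> y w'}"
      using rank_determines_lower_sets(2)[OF fin _ c(2)] by blast
    have "same_orient y \<alpha> \<beta> u v w \<longleftrightarrow> same_orient y \<alpha> \<beta> u v w'" if uv: "(u, v) \<in> S" for u v
    proof (cases "y u = y v")
      case True
      have so: "same_orient y \<alpha> \<beta> u v x \<longleftrightarrow> y x \<noteq> y u \<and> (\<alpha> v - \<alpha> u) * (\<beta> v - \<beta> u) > 0" for x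
      proof -
        have "same_orient y \<alpha> \<beta> u v x \<longleftrightarrow> (y x - y u)\<^sup>2 * ((\<alpha> v - \<alpha> u) * (\<beta> v - \<beta> u)) > 0"
          using True by (simp add: same_orient_def orient_def power2_eq_square mult_ac)
        then show ?thesis by (simp add: zero_less_mult_iff)
      qed
      have "y u \<in> \<Theta>" using uv by (force simp: \<Theta>_def)
      have "y w = y u \<longleftrightarrow> y w' = y u"
      proof -
        have "y u < y w \<longleftrightarrow> y u < y w'" using \<open>y u \<in> \<Theta>\<close> eqset_imp_iff[OF \<Theta>1, of "y u"] by simp
        moreover have "y u \<le> y w \<longleftrightarrow> y u \<le> y w'" using \<open>y u \<in> \<Theta>\<close> eqset_imp_iff[OF \<Theta>2, of "y u"] by simp
        ultimately show ?thesis by linarith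
      qed
      then show ?thesis by (simp add: so)
    next
      case False
      have orient: "orient y \<gamma> u v x = (y v - y u) * (\<gamma> x - L \<gamma> (u, v) (y x))" for \<gamma> x
      proof -
        have slope: "\<gamma> v = \<gamma> u + sl \<gamma> (u, v) * (y v - y u)" using False by (simp add: sl_def)
        show ?thesis unfolding orient_def L_def ic_def fst_conv slope by (simp add: algebra_simps)
      qed
      have so: "same_orient y \<alpha> \<beta> u v x \<longleftrightarrow> (\<alpha> x - L \<alpha> (u, v) (y x)) * (\<beta> x - L \<beta> (u, v) (y x)) > 0" for x
      proof -
        have "same_orient y \<alpha> \<beta> u v x \<longleftrightarrow>
          (y v - y u)\<^sup>2 * ((\<alpha> x - L \<alpha> (u, v) (y x)) * (\<beta> x - L \<beta> (u, v) (y x))) > 0"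
          by (simp add: same_orient_def orient power2_eq_square mult_ac)
        then show ?thesis using False by (simp add: zero_less_mult_iff)
      qed
      have "cr \<alpha> ` (S \<times> S) \<subseteq> \<Theta>" "cr \<beta> ` (S \<times> S) \<subseteq> \<Theta>" by (auto simp: \<Theta>_def)
      from side[OF \<Theta>1 \<Theta>2 this(1) uv c(3,4)] side[OF \<Theta>1 \<Theta>2 this(2) uv c(5,6)]
      show ?thesis unfolding so zero_less_mult_iff by linarith
    qed
    then show ?thesis by auto
  qed
  have "card ((\<lambda>w. {q \<in> S. (\<lambda>(u, v) w. same_orient y \<alpha> \<beta> u v w) q w}) ` X) \<le> card (code ` X)"
    using code_sub by (intro card_image_le_of_determines determ finite_subset[OF code_sub]) auto
  also have "\<dots> \<le> card ?C" using code_sub by (intro card_mono) auto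
  also have "\<dots> = Suc (card \<Theta>) ^ 2 * Suc k ^ 4"
    by (simp only: card_cartesian_product card_atMost power2_eq_square power4_eq_xxxx mult.assoc)
  \<comment> \<open>The exponent 10: two ranks in \<open>\<Theta>\<close> of cubic range and four
    ranks among the \<open>k\<close> lines of linear range.\<close>
  also have "\<dots> \<le> ((k + 2) ^ 3) ^ 2 * (k + 2) ^ 4"
  proof (intro mult_mono power_mono)
    have "2 * k ^ 2 + k + 1 \<le> (k + 2) ^ 3" by (simp add: eval_nat_numeral algebra_simps)
    then show "Suc (card \<Theta>) \<le> (k + 2) ^ 3" using card\<Theta> by linarith
  qed auto
  also have "\<dots> = (card S + 2) ^ 10" unfolding k_def by (simp flip: power_mult power_add)
  finally show "card ((\<lambda>w. {q \<in> S. (\<lambda>(u, v) w. same_orient y \<alpha> \<beta> u v w) q w}) ` X) \<le> (card S + 2) ^ 10" .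
qed

lemma link_ordered_same_orient: "link_ordered (same_orient y \<alpha> \<beta>) 10"
proof
  show "same_orient y \<alpha> \<beta> v u w" if "same_orient y \<alpha> \<beta> u v w" for u v w
    using that by (simp add: same_orient_def orient_swap[of _ _ v u])
  show "same_orient y \<alpha> \<beta> v w u" if "same_orient y \<alpha> \<beta> u v w" for u v w
    using that by (simp add: same_orient_def orient_rot[of _ _ v w])
qed (rule poly_growth_same_orient, rule same_orient_link)

section \<open>Erdos--Rado reduction\<close>

lemma card_subsets_le:
  assumes "finite S"
  shows "card {T. T \<subseteq> S \<and> card T \<le> e} \<le> (card S + 1) ^ e"
proof (induction e)
  case 0
  have "{T. T \<subseteq> S \<and> card T \<le> 0} = {{}}" using assms finite_subset by fastforce
  then show ?case by simp
next
  case (Suc e)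
  let ?F = "{T. T \<subseteq> S \<and> card T \<le> e}"
  let ?g = "\<lambda>(x, T). case x of None \<Rightarrow> T | Some a \<Rightarrow> insert a T"
  have fin: "finite ?F" using assms by simp
  have "{T. T \<subseteq> S \<and> card T \<le> Suc e} \<subseteq> ?g ` (insert None (Some ` S) \<times> ?F)"
  proof
    fix T assume T: "T \<in> {T. T \<subseteq> S \<and> card T \<le> Suc e}"
    show "T \<in> ?g ` (insert None (Some ` S) \<times> ?F)"
    proof (cases "card T \<le> e")
      case True
      then show ?thesis using T by (intro image_eqI[of _ _ "(None, T)"]) auto
    next
      case False
      then have "T \<noteq> {}" by auto
      then obtain a where "a \<in> T" by blast
      then show ?thesis using T
        by (intro image_eqI[of _ _ "(Some a, T - {a})"]) (auto simp: insert_absorb)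
    qed
  qed
  then have "card {T. T \<subseteq> S \<and> card T \<le> Suc e} \<le> card (?g ` (insert None (Some ` S) \<times> ?F))"
    using assms fin by (intro card_mono) auto
  also have "\<dots> \<le> card (insert None (Some ` S) \<times> ?F)"
    using assms fin by (intro card_image_le) auto
  also have "\<dots> = (card S + 1) * card ?F"
    using assms by (simp add: card_cartesian_product card_image)
  also have "\<dots> \<le> (card S + 1) ^ Suc e" 
    using mult_left_mono[OF Suc.IH, of "card S + 1"] by (simp only: power_Suc)
  finally show ?case .
qed

text \<open>Points are chosen one at a time while a pool of candidates is kept on which every
  \<open>e\<close>-subset of the chosen points sees a constant colour. The \<open>v\<close> in the
  conclusion is the last chosen point of \<open>T\<close>, which may be exchanged for a survivor
  \<open>w\<close>; the existential quantifier avoids recording the order of choice. On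
  \<open>Y\<close> the colouring is thus governed by its link at \<open>w\<close>.\<close>

lemma erdos_rado_end_homogeneous:
  fixes col :: "'a set \<Rightarrow> bool"
  assumes "e > 0" and X: "finite X" "2 ^ (m * ((m + 1) ^ e + 1)) \<le> card X"
  shows "\<exists>Y w. Y \<subseteq> X \<and> w \<in> X - Y \<and> card Y = m \<and>
    (\<forall>T\<subseteq>Y. card T = e + 1 \<longrightarrow> (\<exists>v\<in>T. col T = col (insert w (T - {v}))))"
proof -
  \<comment> \<open>A bound for the number of \<open>e\<close>-subsets of the chosen points. One
    round costs \<open>P\<close> bits for the colour pattern and one bit for removing
    \<open>v\<close>.\<close>
  define P where "P = (m + 1) ^ e"
  have "j \<le> m \<Longrightarrow> \<exists>Y X'. Y \<subseteq> X \<and> X' \<subseteq> X - Y \<and> card Y = j \<and> 2 ^ ((m - j) * (P + 1)) \<le> card X' \<and>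
    (\<forall>T\<subseteq>Y. card T = e + 1 \<longrightarrow> (\<exists>v\<in>T. \<forall>w\<in>X'. col T = col (insert w (T - {v})))) \<and>
    (\<forall>J\<subseteq>Y. card J = e \<longrightarrow> (\<forall>x\<in>X'. \<forall>x'\<in>X'. col (insert x J) = col (insert x' J)))" for j
  proof (induction j)
    case 0
    show ?case using X \<open>e > 0\<close> by (intro exI[of _ "{}"] exI[of _ X]) (auto simp: P_def)
  next
    case (Suc j)
    then obtain Y X' where Y: "Y \<subseteq> X" "X' \<subseteq> X - Y" "card Y = j" "2 ^ ((m - j) * (P + 1)) \<le> card X'"
      "\<forall>T\<subseteq>Y. card T = e + 1 \<longrightarrow> (\<exists>v\<in>T. \<forall>w\<in>X'. col T = col (insert w (T - {v})))"
      "\<forall>J\<subseteq>Y. card J = e \<longrightarrow> (\<forall>x\<in>X'. \<forall>x'\<in>X'. col (insert x J) = col (insert x' J))" by auto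
    have "finite Y" by (rule finite_subset[OF Y(1) X(1)])
    moreover have "finite X'" by (rule finite_subset[OF Y(2)]) (use X(1) in simp)
    ultimately have finY: "finite Y" "finite X'" .
    have split: "(m - j) * (P + 1) = (m - Suc j) * (P + 1) + P + 1"
      using Suc.prems by (metis Suc_diff_Suc Suc_le_lessD add.assoc add.commute mult_Suc)
    have X'pos: "0 < card X'" using Y(4) by (rule less_le_trans[rotated]) simp
    then have "X' \<noteq> {}" by auto
    then obtain v where v: "v \<in> X'" by blast
    \<comment> \<open>Only subsets containing \<open>v\<close> are new, but refining by all of
      \<open>F\<close> treats both kinds at once.\<close>
    define F where "F = {J. J \<subseteq> insert v Y \<and> card J = e}"
    define t where "t x = {J \<in> F. col (insert x J)}" for x
    have finF: "finite F" using finY by (simp add: F_def)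
    have "card F \<le> card {J. J \<subseteq> insert v Y \<and> card J \<le> e}"
      using finY by (intro card_mono) (auto simp: F_def)
    also have "\<dots> \<le> (card (insert v Y) + 1) ^ e" using finY by (intro card_subsets_le) auto
    also have "\<dots> \<le> P"
      unfolding P_def using Suc.prems Y(3) card_insert_le_m1[of "Suc j" Y v] by (intro power_mono) auto
    finally have cF: "card F \<le> P" .
    have "card (t ` (X' - {v})) \<le> card (Pow F)"
      using finF by (intro card_mono) (auto simp: t_def)
    also have "\<dots> \<le> 2 ^ P" using finF cF by (simp add: card_Pow)
    finally have ct: "card (t ` (X' - {v})) \<le> 2 ^ P" .
    have "2 ^ ((m - Suc j) * (P + 1)) * card (t ` (X' - {v})) \<le> 2 ^ ((m - Suc j) * (P + 1)) * 2 ^ P"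
      using ct by simp
    also have "\<dots> = 2 ^ ((m - Suc j) * (P + 1) + P)" by (simp add: power_add)
    finally have "2 ^ ((m - Suc j) * (P + 1)) * card (t ` (X' - {v})) \<le> 2 ^ ((m - Suc j) * (P + 1) + P)" .
    moreover have "2 ^ ((m - j) * (P + 1)) = 2 * (2::nat) ^ ((m - Suc j) * (P + 1) + P)"
      unfolding split by simp
    moreover have one: "1 \<le> (2::nat) ^ ((m - Suc j) * (P + 1) + P)" by simp
    moreover have "card (X' - {v}) = card X' - 1" using v finY by simp
    ultimately have le: "2 ^ ((m - Suc j) * (P + 1)) * card (t ` (X' - {v})) \<le> card (X' - {v})"
      and pos: "0 < card (X' - {v})"
      using Y(4) by linarith+
    have ne: "X' - {v} \<noteq> {}" using pos card.empty by fastforce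
    obtain z where z: "2 ^ ((m - Suc j) * (P + 1)) \<le> card {x \<in> X' - {v}. t x = z}"
      using pigeonhole_class[OF finite_Diff[OF finY(2)] ne le] by (elim exE)
    define X'' where "X'' = {x \<in> X' - {v}. t x = z}"
    have sub: "X'' \<subseteq> X' - {v}" by (auto simp: X''_def)
    have vY: "v \<notin> Y" using v Y(2) by blast
    show ?case
    proof (rule exI[of _ "insert v Y"], rule exI[of _ X''], intro conjI allI impI ballI)
      show "insert v Y \<subseteq> X" "X'' \<subseteq> X - insert v Y" using v sub Y(1,2) by blast+
      show "card (insert v Y) = Suc j" using vY Y(3) finY by simp
      show "2 ^ ((m - Suc j) * (P + 1)) \<le> card X''" using z by (simp add: X''_def)
    next
      fix T assume T: "T \<subseteq> insert v Y" "card T = e + 1"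
      show "\<exists>u\<in>T. \<forall>w\<in>X''. col T = col (insert w (T - {u}))"
      proof (cases "v \<in> T")
        case False
        then have "T \<subseteq> Y" using T by blast
        from Y(5)[rule_format, OF this T(2)] show ?thesis using sub by (meson DiffD1 subsetD)
      next
        case True
        have J: "T - {v} \<subseteq> Y" "card (T - {v}) = e" using T True by auto
        have "col T = col (insert w (T - {v}))" if "w \<in> X''" for w
        proof -
          have "w \<in> X'" using that sub by blast
          then have "col (insert v (T - {v})) = col (insert w (T - {v}))"
            using Y(6)[rule_format, OF J v] by blast
          then show ?thesis using True by (simp add: insert_absorb)
        qed
        then show ?thesis using True by blast
      qed
    next
      fix J x x' assume J: "J \<subseteq> insert v Y" "card J = e" and x: "x \<in> X''" "x' \<in> X''"
      have "J \<in> F" using J by (simp add: F_def)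
      moreover have "t x = t x'" using x by (simp add: X''_def)
      ultimately show "col (insert x J) = col (insert x' J)" unfolding t_def by blast
    qed
  qed
  from this[of m] obtain Y X' where Y: "Y \<subseteq> X" "X' \<subseteq> X - Y" "card Y = m" "2 ^ ((m - m) * (P + 1)) \<le> card X'"
      "\<forall>T\<subseteq>Y. card T = e + 1 \<longrightarrow> (\<exists>v\<in>T. \<forall>w\<in>X'. col T = col (insert w (T - {v})))" by auto
  then have "X' \<noteq> {}" by auto
  then obtain w where "w \<in> X'" by blast
  with Y(5) have "\<forall>T\<subseteq>Y. card T = e + 1 \<longrightarrow> (\<exists>v\<in>T. col T = col (insert w (T - {v})))" by meson
  then show ?thesis using Y(1-3) \<open>w \<in> X'\<close> by (intro exI[of _ w] exI[of _ Y]) auto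
qed

section \<open>Vertices via linear dependencies\<close>

definition kills :: "'j set \<Rightarrow> ('a \<Rightarrow> 'j \<Rightarrow> real) \<Rightarrow> 'a set \<Rightarrow> ('a \<Rightarrow> real) \<Rightarrow> bool" where
  "kills J A T c \<longleftrightarrow> (\<forall>j\<in>J. (\<Sum>i\<in>T. c i * A i j) = 0)"

definition lin_indep :: "'j set \<Rightarrow> ('a \<Rightarrow> 'j \<Rightarrow> real) \<Rightarrow> ('a \<Rightarrow> real) \<Rightarrow> 'a set \<Rightarrow> bool" where
  "lin_indep J A \<alpha> T \<longleftrightarrow> (\<forall>c. kills J A T c \<longrightarrow> (\<Sum>i\<in>T. c i * \<alpha> i) = 0 \<longrightarrow> (\<forall>i\<in>T. c i = 0))"

text \<open>With \<open>J\<close> indexing all coordinates but the last, the sets of size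
  \<open>card J + 1\<close> are the \<open>d\<close>-subfamilies, and the condition says that their
  normal vectors are independent.\<close>

definition generic :: "'j set \<Rightarrow> ('a \<Rightarrow> 'j \<Rightarrow> real) \<Rightarrow> ('a \<Rightarrow> real) \<Rightarrow> 'a set \<Rightarrow> bool" where
  "generic J A \<alpha> I \<longleftrightarrow> (\<forall>T\<subseteq>I. card T = card J + 1 \<longrightarrow> lin_indep J A \<alpha> T)"

text \<open>The coordinates \<open>A\<close> are all normal coordinates but the last, which is \<open>\<alpha>\<close>; \<open>\<beta>\<close> is the right-hand side.\<close>

definition lies_above :: "'j set \<Rightarrow> ('a \<Rightarrow> 'j \<Rightarrow> real) \<Rightarrow> ('a \<Rightarrow> real) \<Rightarrow> ('a \<Rightarrow> real) \<Rightarrow> 'a set \<Rightarrow> bool" where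
  "lies_above J A \<alpha> \<beta> T \<longleftrightarrow> (\<exists>c. kills J A T c \<and> (\<Sum>i\<in>T. c i * \<alpha> i) * (\<Sum>i\<in>T. c i * \<beta> i) > 0)"

lemma lin_indepD: "lin_indep J A \<alpha> T \<Longrightarrow> kills J A T c \<Longrightarrow> (\<Sum>i\<in>T. c i * \<alpha> i) = 0 \<Longrightarrow> i \<in> T \<Longrightarrow> c i = 0"
  by (simp add: lin_indep_def)

lemma generic_subset: "generic J A \<alpha> I \<Longrightarrow> I' \<subseteq> I \<Longrightarrow> generic J A \<alpha> I'"
  by (auto simp: generic_def)

lemma kills_combine:
  "kills J A T c \<Longrightarrow> kills J A T c' \<Longrightarrow> kills J A T (\<lambda>i. s * c i - s' * c' i)"
  by (simp add: kills_def algebra_simps sum_subtractf flip: sum_distrib_left)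

lemma sum_combine:
  "(\<Sum>i\<in>T. (s * c i - s' * c' i) * \<gamma> i) = s * (\<Sum>i\<in>T. c i * \<gamma> i) - s' * (\<Sum>i\<in>T. c' i * (\<gamma> i :: real))"
  by (simp add: algebra_simps sum_subtractf flip: sum_distrib_left)

text \<open>A Gaussian elimination step. Solving the equation of \<open>w\<close> for coordinate
  \<open>j\<close> and substituting describes the trace of hyperplane \<open>i\<close> on hyperplane
  \<open>w\<close> in the remaining coordinates. For \<open>j\<close> in \<open>J\<close> the last
  coordinate is kept, so above and below retain their meaning.\<close>

definition eliminate :: "('a \<Rightarrow> 'j \<Rightarrow> real) \<Rightarrow> 'a \<Rightarrow> 'j \<Rightarrow> ('a \<Rightarrow> real) \<Rightarrow> 'a \<Rightarrow> real" where
  "eliminate A w j \<gamma> i = \<gamma> i - A i j / A w j * \<gamma> w"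

abbreviation eliminate_coords :: "('a \<Rightarrow> 'j \<Rightarrow> real) \<Rightarrow> 'a \<Rightarrow> 'j \<Rightarrow> 'a \<Rightarrow> 'j \<Rightarrow> real" where
  "eliminate_coords A w j \<equiv> \<lambda>i j'. eliminate A w j (\<lambda>i. A i j') i"

lemma sum_elim:
  assumes "finite T" "w \<notin> T" "c w = - (\<Sum>i\<in>T. c i * (A i j / A w j))"
  shows "(\<Sum>i\<in>insert w T. c i * \<gamma> i) = (\<Sum>i\<in>T. c i * eliminate A w j \<gamma> i)"
  using assms(1,2) by (simp add: eliminate_def assms(3) algebra_simps sum_subtractf sum_distrib_left)

text \<open>Coordinate \<open>j\<close> determines the coefficient of \<open>w\<close>; after
  substitution the other coordinates constrain only the coefficients on \<open>T\<close>.\<close>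

lemma kills_link:
  assumes "finite T" "w \<notin> T" "j \<in> J" "A w j \<noteq> 0"
  shows "kills J A (insert w T) c \<longleftrightarrow>
    c w = - (\<Sum>i\<in>T. c i * (A i j / A w j)) \<and> kills (J - {j}) (eliminate_coords A w j) T c"
proof -
  have j: "(\<Sum>i\<in>insert w T. c i * A i j) = 0 \<longleftrightarrow> c w = - (\<Sum>i\<in>T. c i * (A i j / A w j))"
  proof -
    have "(\<Sum>i\<in>insert w T. c i * A i j) = A w j * (c w + (\<Sum>i\<in>T. c i * (A i j / A w j)))"
      using assms by (simp add: sum_distrib_left algebra_simps)
    then show ?thesis using assms(4) by (simp add: eq_neg_iff_add_eq_0)
  qed
  show ?thesis
  proof
    assume k: "kills J A (insert w T) c"
    then have c: "c w = - (\<Sum>i\<in>T. c i * (A i j / A w j))" using j assms(3) by (simp add: kills_def)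
    moreover have "kills (J - {j}) (eliminate_coords A w j) T c"
      using k sum_elim[where A = A and w = w and j = j, OF assms(1,2) c] by (simp add: kills_def)
    ultimately show "c w = - (\<Sum>i\<in>T. c i * (A i j / A w j)) \<and> kills (J - {j}) (eliminate_coords A w j) T c" by simp
  next
    assume k: "c w = - (\<Sum>i\<in>T. c i * (A i j / A w j)) \<and> kills (J - {j}) (eliminate_coords A w j) T c"
    then have c: "c w = - (\<Sum>i\<in>T. c i * (A i j / A w j))" by (rule conjunct1)
    show "kills J A (insert w T) c"
      unfolding kills_def
    proof
      fix j' assume "j' \<in> J"
      then show "(\<Sum>i\<in>insert w T. c i * A i j') = 0"
        using k j c sum_elim[where A = A and w = w and j = j and \<gamma> = "\<lambda>i. A i j'", OF assms(1,2) c] by (cases "j' = j") (simp_all add: kills_def)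
    qed
  qed
qed

lemma extend_coefficient:
  assumes "finite T" "w \<notin> T"
  obtains c' where "c' w = - (\<Sum>i\<in>T. c' i * (A i j / A w j :: real))" "\<And>i. i \<in> T \<Longrightarrow> c' i = c i"
proof
  let ?c = "c(w := - (\<Sum>i\<in>T. c i * (A i j / A w j)))"
  show eq: "?c i = c i" if "i \<in> T" for i using that assms by auto
  have "(\<Sum>i\<in>T. c i * (A i j / A w j)) = (\<Sum>i\<in>T. ?c i * (A i j / A w j))"
    by (intro sum.cong refl) (use assms in auto)
  then show "?c w = - (\<Sum>i\<in>T. ?c i * (A i j / A w j))" by simp
qed

lemma kills_cong: "(\<And>i. i \<in> T \<Longrightarrow> c' i = c i) \<Longrightarrow> kills J A T c' = kills J A T c"
  by (simp add: kills_def)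

lemma above_link:
  assumes "finite T" "w \<notin> T" "j \<in> J" "A w j \<noteq> 0"
  shows "lies_above J A \<alpha> \<beta> (insert w T) \<longleftrightarrow>
    lies_above (J - {j}) (eliminate_coords A w j) (eliminate A w j \<alpha>) (eliminate A w j \<beta>) T"
proof
  assume "lies_above J A \<alpha> \<beta> (insert w T)"
  then obtain c where c: "kills J A (insert w T) c"
    "(\<Sum>i\<in>insert w T. c i * \<alpha> i) * (\<Sum>i\<in>insert w T. c i * \<beta> i) > 0" by (auto simp: lies_above_def)
  have k: "c w = - (\<Sum>i\<in>T. c i * (A i j / A w j))" "kills (J - {j}) (eliminate_coords A w j) T c"
    using c(1) unfolding kills_link[where A = A and w = w and j = j, OF assms] by simp_all
  show "lies_above (J - {j}) (eliminate_coords A w j) (eliminate A w j \<alpha>) (eliminate A w j \<beta>) T"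
    unfolding lies_above_def using k(2) c(2) unfolding sum_elim[where A = A and w = w and j = j, OF assms(1,2) k(1)] by (intro exI[of _ c] conjI)
next
  assume "lies_above (J - {j}) (eliminate_coords A w j) (eliminate A w j \<alpha>) (eliminate A w j \<beta>) T"
  then obtain c where c: "kills (J - {j}) (eliminate_coords A w j) T c"
    "(\<Sum>i\<in>T. c i * eliminate A w j \<alpha> i) * (\<Sum>i\<in>T. c i * eliminate A w j \<beta> i) > 0" by (auto simp: lies_above_def)
  obtain c' where c': "c' w = - (\<Sum>i\<in>T. c' i * (A i j / A w j))" "\<And>i. i \<in> T \<Longrightarrow> c' i = c i"
    using extend_coefficient[OF assms(1,2), of A j c] by blast
  have "kills J A (insert w T) c'"
    using kills_link[where A = A and w = w and j = j, OF assms] c' c(1) kills_cong[of T c' c] by blast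
  moreover have "(\<Sum>i\<in>insert w T. c' i * \<alpha> i) * (\<Sum>i\<in>insert w T. c' i * \<beta> i) > 0"
    using sum_elim[where A = A and w = w and j = j, OF assms(1,2) c'(1)] c(2) c'(2) by simp
  ultimately show "lies_above J A \<alpha> \<beta> (insert w T)" by (auto simp: lies_above_def)
qed

lemma generic_link:
  assumes gen: "generic J A \<alpha> I" and fin: "finite I" "finite J" and w: "w \<in> I" and j: "j \<in> J" "A w j \<noteq> 0"
  shows "generic (J - {j}) (eliminate_coords A w j) (eliminate A w j \<alpha>) (I - {w})"
  unfolding generic_def
proof (intro allI impI)
  fix T assume T: "T \<subseteq> I - {w}" "card T = card (J - {j}) + 1"
  have finT: "finite T" by (rule finite_subset[OF T(1)]) (use fin in simp)
  have wT: "w \<notin> T" using T by blast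
  have "card J > 0" using fin j by (auto simp: card_gt_0_iff)
  then have "card (insert w T) = card J + 1" using T fin j finT wT by simp
  moreover have "insert w T \<subseteq> I" using T w by blast
  ultimately have ind: "lin_indep J A \<alpha> (insert w T)" using gen by (simp add: generic_def)
  show "lin_indep (J - {j}) (eliminate_coords A w j) (eliminate A w j \<alpha>) T"
    unfolding lin_indep_def
  proof (intro allI impI ballI)
    fix c i assume c: "kills (J - {j}) (eliminate_coords A w j) T c" "(\<Sum>i\<in>T. c i * eliminate A w j \<alpha> i) = 0" and i: "i \<in> T"
    obtain c' where c': "c' w = - (\<Sum>i\<in>T. c' i * (A i j / A w j))" "\<And>i. i \<in> T \<Longrightarrow> c' i = c i"
      using extend_coefficient[OF finT wT, of A j c] by blast
    have "kills J A (insert w T) c'"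
      using kills_link[where A = A and w = w and j = j, OF finT wT j] c' c(1) kills_cong[of T c' c] by blast
    moreover have "(\<Sum>i\<in>insert w T. c' i * \<alpha> i) = 0"
      using sum_elim[where A = A and w = w and j = j, OF finT wT c'(1)] c(2) c'(2) by simp
    ultimately have "c' i = 0" using lin_indepD[OF ind] i by blast
    then show "c i = 0" using c'(2) i by simp
  qed
qed

lemma exists_superset_card:
  assumes "finite I" "B \<subseteq> I" "card B \<le> n" "n \<le> card I"
  shows "\<exists>T. B \<subseteq> T \<and> T \<subseteq> I \<and> card T = n"
  using assms exists_subset_between[of B n I] by blast

text \<open>Such hyperplanes are parallel to \<open>x_d = 0\<close>, and two of them have dependent
  normals. They are exactly those offering no coordinate to eliminate.\<close>

lemma card_zero_coords_le_1:
  fixes I :: "'a set"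
  assumes gen: "generic J A \<alpha> I" and fin: "finite I" and J: "card J \<ge> 1" "card J + 1 \<le> card I"
  shows "card {w \<in> I. \<forall>j\<in>J. A w j = 0} \<le> 1"
proof (rule ccontr)
  let ?Z = "{w \<in> I. \<forall>j\<in>J. A w j = 0}"
  assume "\<not> ?thesis"
  then obtain w w' where w: "w \<in> ?Z" "w' \<in> ?Z" "w \<noteq> w'"
    using fin card_le_Suc0_iff_eq[of ?Z] by auto
  obtain T where T: "{w, w'} \<subseteq> T" "T \<subseteq> I" "card T = card J + 1"
    using exists_superset_card[OF fin, of "{w, w'}" "card J + 1"] w J by auto
  have finT: "finite T" by (rule finite_subset[OF T(2) fin])
  have ind: "lin_indep J A \<alpha> T" using gen T by (simp add: generic_def)
  have sum: "(\<Sum>i\<in>T. c i * \<gamma> i) = c w * \<gamma> w + c w' * \<gamma> w'"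
    if "\<And>i. i \<noteq> w \<Longrightarrow> i \<noteq> w' \<Longrightarrow> c i = 0" for c \<gamma> :: "'a \<Rightarrow> real"
  proof -
    have "(\<Sum>i\<in>T. c i * \<gamma> i) = (\<Sum>i\<in>{w, w'}. c i * \<gamma> i)"
      using T finT that by (intro sum.mono_neutral_right) auto
    then show ?thesis using w by simp
  qed
  have kills: "kills J A T c" if "\<And>i. i \<noteq> w \<Longrightarrow> i \<noteq> w' \<Longrightarrow> c i = 0" for c
    unfolding kills_def using sum[OF that] w by simp
  \<comment> \<open>This dependency forces \<open>\<alpha> w = 0\<close>. Then the normal of
    \<open>w\<close> vanishes altogether and the unit coefficient \<open>e\<close> is a dependency
    as well.\<close>
  define c where "c = (\<lambda>i. if i = w then \<alpha> w' else if i = w' then - \<alpha> w else 0)"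
  have c0: "c i = 0" if "i \<noteq> w" "i \<noteq> w'" for i using that by (simp add: c_def)
  have "(\<Sum>i\<in>T. c i * \<alpha> i) = c w * \<alpha> w + c w' * \<alpha> w'" by (rule sum) (rule c0)
  also have "\<dots> = 0" using w by (simp add: c_def)
  finally have "(\<Sum>i\<in>T. c i * \<alpha> i) = 0" .
  from lin_indepD[OF ind kills[of c, OF c0] this, of w'] have "\<alpha> w = 0" using T w by (simp add: c_def)
  define e where "e = (\<lambda>i. if i = w then 1 else 0 :: real)"
  have e0: "e i = 0" if "i \<noteq> w" "i \<noteq> w'" for i using that by (simp add: e_def)
  have "(\<Sum>i\<in>T. e i * \<alpha> i) = e w * \<alpha> w + e w' * \<alpha> w'" by (rule sum) (rule e0)
  also have "\<dots> = 0" using w \<open>\<alpha> w = 0\<close> by (simp add: e_def)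
  finally have "(\<Sum>i\<in>T. e i * \<alpha> i) = 0" .
  from lin_indepD[OF ind kills[of e, OF e0] this, of w] show False using T by (simp add: e_def)
qed

text \<open>Dividing by \<open>A i a\<close> normalises one coordinate to 1, the factor being
  absorbed by the coefficients. The cofactor vector is then a dependency whose sums against
  \<open>\<alpha>\<close> and \<open>\<beta>\<close> are the two orientations, and by independence
  every dependency is a multiple of it.\<close>

lemma above_triple:
  fixes u :: 'a
  assumes ind: "lin_indep {a, b} A \<alpha> {u, v, w}" and distinct: "u \<noteq> v" "u \<noteq> w" "v \<noteq> w"
    and nz: "A u a \<noteq> 0" "A v a \<noteq> 0" "A w a \<noteq> 0"
  shows "lies_above {a, b} A \<alpha> \<beta> {u, v, w} \<longleftrightarrow>
    same_orient (\<lambda>i. A i b / A i a) (\<lambda>i. \<alpha> i / A i a) (\<lambda>i. \<beta> i / A i a) u v w"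
proof -
  let ?y = "\<lambda>i. A i b / A i a"
  let ?n = "\<lambda>\<gamma> i. \<gamma> i / A i a"
  let ?T = "{u, v, w}"
  have sum: "(\<Sum>i\<in>?T. f i) = f u + f v + f w" for f :: "'a \<Rightarrow> real" using distinct by simp
  have uses: "(\<Sum>i\<in>?T. c i * \<gamma> i) = (c u * A u a) * ?n \<gamma> u + (c v * A v a) * ?n \<gamma> v + (c w * A w a) * ?n \<gamma> w" for c \<gamma>
    unfolding sum using nz by simp
  define c0 where "c0 i = (if i = u then ?y w - ?y v else if i = v then ?y u - ?y w else ?y v - ?y u) / A i a" for i
  have c0A: "c0 u * A u a = ?y w - ?y v" "c0 v * A v a = ?y u - ?y w" "c0 w * A w a = ?y v - ?y u"
    using distinct nz by (auto simp: c0_def)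
  have c0sum: "(\<Sum>i\<in>?T. c0 i * \<gamma> i) = orient ?y (?n \<gamma>) u v w" for \<gamma>
    unfolding uses c0A orient_def by (simp only: algebra_simps)
  have ka: "(\<Sum>i\<in>?T. c i * A i a) = c u * A u a + c v * A v a + c w * A w a" for c by (rule sum)
  have kb: "(\<Sum>i\<in>?T. c i * A i b) = (c u * A u a) * ?y u + (c v * A v a) * ?y v + (c w * A w a) * ?y w" for c
    by (rule uses)
  have k0: "kills {a, b} A ?T c0"
    unfolding kills_def using ka[of c0] kb[of c0] unfolding c0A by (simp add: algebra_simps)
  show ?thesis
  proof
    assume "same_orient ?y (?n \<alpha>) (?n \<beta>) u v w"
    then show "lies_above {a, b} A \<alpha> \<beta> ?T"
      unfolding lies_above_def same_orient_def using k0 c0sum by (intro exI[of _ c0]) simp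
  next
    assume "lies_above {a, b} A \<alpha> \<beta> ?T"
    then obtain c where k: "kills {a, b} A ?T c" and pos: "(\<Sum>i\<in>?T. c i * \<alpha> i) * (\<Sum>i\<in>?T. c i * \<beta> i) > 0"
      unfolding lies_above_def by (elim exE conjE)
    define s where "s = (\<Sum>i\<in>?T. c i * \<alpha> i)"
    define s0 where "s0 = (\<Sum>i\<in>?T. c0 i * \<alpha> i)"
    have "s \<noteq> 0" using pos by (auto simp: s_def)
    have comb: "s0 * c i = s * c0 i" if "i \<in> ?T" for i
    proof -
      have "(\<Sum>i\<in>?T. (s0 * c i - s * c0 i) * \<alpha> i) = 0" unfolding sum_combine s_def s0_def by simp
      from lin_indepD[OF ind kills_combine[OF k k0] this that] show ?thesis by simp
    qed
    \<comment> \<open>Otherwise the cofactors vanish and the three abscissae coincide. The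
      dependencies then form a plane, which contains a nonzero one with \<open>\<alpha>\<close>-sum
      0; \<open>e\<close> and \<open>f\<close> produce it.\<close>
    have "s0 \<noteq> 0"
    proof
      assume s0: "s0 = 0"
      then have "c0 i = 0" if "i \<in> ?T" for i using comb[OF that] \<open>s \<noteq> 0\<close> by simp
      then have "c0 u = 0" "c0 v = 0" "c0 w = 0" by simp_all
      then have y: "?y v = ?y w" "?y u = ?y w" using c0A by simp_all
      have kk: "kills {a, b} A ?T e" if "e u * A u a + e v * A v a + e w * A w a = 0" for e
      proof -
        have "(\<Sum>i\<in>?T. e i * A i b) = (e u * A u a + e v * A v a + e w * A w a) * ?y w"
          unfolding kb y by (simp add: algebra_simps)
        then show ?thesis using that ka[of e] by (simp add: kills_def)
      qed
      define e where "e i = (if i = u then ?n \<alpha> v - ?n \<alpha> w else if i = v then ?n \<alpha> w - ?n \<alpha> u else ?n \<alpha> u - ?n \<alpha> v) / A i a" for i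
      have eA: "e u * A u a = ?n \<alpha> v - ?n \<alpha> w" "e v * A v a = ?n \<alpha> w - ?n \<alpha> u" "e w * A w a = ?n \<alpha> u - ?n \<alpha> v"
        using distinct nz by (auto simp: e_def)
      have "kills {a, b} A ?T e" by (rule kk) (unfold eA, simp)
      moreover have "(\<Sum>i\<in>?T. e i * \<alpha> i) = 0" unfolding uses eA by (simp add: algebra_simps)
      ultimately have "e u = 0" "e w = 0" using lin_indepD[OF ind, of e] by simp_all
      then have eq: "?n \<alpha> u = ?n \<alpha> v" using eA by simp
      define f where "f i = (if i = u then 1 else if i = v then - 1 else 0) / A i a" for i
      have fA: "f u * A u a = 1" "f v * A v a = - 1" "f w * A w a = 0"
        using distinct nz by (auto simp: f_def)
      have "kills {a, b} A ?T f" by (rule kk) (unfold fA, simp)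
      moreover have "(\<Sum>i\<in>?T. f i * \<alpha> i) = 0" unfolding uses fA using eq by simp
      ultimately have "f u = 0" using lin_indepD[OF ind, of f] by simp
      then show False using fA by simp
    qed
    have "s0 * (\<Sum>i\<in>?T. c i * \<beta> i) = s * (\<Sum>i\<in>?T. c0 i * \<beta> i)"
      unfolding sum_distrib_left using comb by (intro sum.cong refl) (metis mult.assoc)
    then have "s\<^sup>2 * (s0 * (\<Sum>i\<in>?T. c0 i * \<beta> i)) = s0\<^sup>2 * (s * (\<Sum>i\<in>?T. c i * \<beta> i))"
      by (simp add: power2_eq_square)
    also have "\<dots> > 0" using pos \<open>s0 \<noteq> 0\<close> by (simp add: s_def zero_less_mult_iff)
    finally have "s0 * (\<Sum>i\<in>?T. c0 i * \<beta> i) > 0"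
      using \<open>s \<noteq> 0\<close> by (simp add: zero_less_mult_iff)
    then show "same_orient ?y (?n \<alpha>) (?n \<beta>) u v w"
      unfolding same_orient_def s0_def c0sum .
  qed
qed

section \<open>Tower bounds\<close>

lemma twr_Suc: "e \<ge> 1 \<Longrightarrow> twr (Suc e) x = 2 powr twr e x"
  by (cases e) auto

lemma twr_ge_1: "1 \<le> x \<Longrightarrow> 1 \<le> twr e x"
proof (induction e x rule: twr.induct)
  case (3 i x)
  then show ?case by (simp add: ge_one_powr_ge_zero)
qed auto

lemma twr_mono: "x \<le> y \<Longrightarrow> twr e x \<le> twr e y"
  by (induction e x rule: twr.induct) auto

lemma powr_nat_ge_1: "n \<ge> 1 \<Longrightarrow> 0 \<le> \<epsilon> \<Longrightarrow> 1 \<le> real n powr \<epsilon>"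
  by (simp add: ge_one_powr_ge_zero)

text \<open>Lowering the exponent at the bottom of the tower absorbs every polynomial above it.
  Taking a logarithm turns \<open>C * T ^ p\<close> into an expression linear in the next lower
  tower, so the induction needs power 1 but a new constant, which is why \<open>C\<close> and
  \<open>p\<close> are generalised.\<close>

lemma twr_absorbs_polynomial:
  fixes C \<epsilon> :: real
  assumes "e \<ge> 1" "\<epsilon> > 0"
  shows "\<exists>\<epsilon>'>0. \<exists>n1\<ge>1. \<forall>n\<ge>n1. C * twr e (real n powr \<epsilon>') ^ p \<le> twr e (real n powr \<epsilon>)"
  using assms(1)
proof (induction e arbitrary: C p rule: nat_induct_at_least)
  case base
  define \<epsilon>' where "\<epsilon>' = \<epsilon> / (real p + 1)"
  have \<epsilon>': "\<epsilon>' > 0" using assms(2) by (simp add: \<epsilon>'_def)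
  have "(real p + 1) * \<epsilon>' = \<epsilon>" unfolding \<epsilon>'_def by simp
  then have "\<epsilon> = real p * \<epsilon>' + \<epsilon>'" by (simp add: distrib_right)
  define D where "D = max 1 C"
  define n1 where "n1 = Suc (nat \<lceil>D powr (1 / \<epsilon>')\<rceil>)"
  have "C * twr 1 (real n powr \<epsilon>') ^ p \<le> twr 1 (real n powr \<epsilon>)" if "n \<ge> n1" for n
  proof -
    have n: "real n > 0" "real n \<ge> D powr (1 / \<epsilon>')" using that unfolding n1_def by linarith+
    have "D = (D powr (1 / \<epsilon>')) powr \<epsilon>'" using \<epsilon>' by (simp add: powr_powr D_def)
    also have "\<dots> \<le> real n powr \<epsilon>'" using n \<epsilon>' by (intro powr_mono2) auto
    finally have "C \<le> real n powr \<epsilon>'" by (simp add: D_def)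
    then have "C * (real n powr \<epsilon>') ^ p \<le> real n powr \<epsilon>' * (real n powr \<epsilon>') ^ p"
      by (intro mult_right_mono) auto
    also have pw: "(real n powr \<epsilon>') ^ p = real n powr (real p * \<epsilon>')"
      using n by (simp add: powr_powr mult.commute flip: powr_realpow)
    also have "real n powr \<epsilon>' * real n powr (real p * \<epsilon>') = real n powr \<epsilon>"
      unfolding \<open>\<epsilon> = real p * \<epsilon>' + \<epsilon>'\<close> by (simp add: powr_add mult.commute)
    finally show ?thesis unfolding One_nat_def twr.simps pw .
  qed
  moreover have "n1 \<ge> 1" by (simp add: n1_def)
  ultimately have "\<exists>n1\<ge>1. \<forall>n\<ge>n1. C * twr 1 (real n powr \<epsilon>') ^ p \<le> twr 1 (real n powr \<epsilon>)"
    by (intro exI[of _ n1]) simp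
  then show ?case using \<epsilon>' by (intro exI[of _ \<epsilon>'] conjI)
next
  case (Suc e)
  define D where "D = max 1 C"
  have D: "D > 0" "C \<le> D" "log 2 D \<ge> 0" by (auto simp: D_def)
  obtain \<epsilon>' n1 where \<epsilon>': "\<epsilon>' > 0" "n1 \<ge> 1" and
    IH: "\<forall>n\<ge>n1. (log 2 D + real p) * twr e (real n powr \<epsilon>') ^ 1 \<le> twr e (real n powr \<epsilon>)"
    using Suc.IH[of "log 2 D + real p" 1] by (elim exE conjE)
  have "C * twr (Suc e) (real n powr \<epsilon>') ^ p \<le> twr (Suc e) (real n powr \<epsilon>)" if "n \<ge> n1" for n
  proof -
    define T where "T = twr e (real n powr \<epsilon>')"
    have "1 \<le> T" unfolding T_def using that \<epsilon>' by (intro twr_ge_1 powr_nat_ge_1) auto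
    have "C * (2 powr T) ^ p \<le> D * (2 powr T) ^ p" using D by (intro mult_right_mono) auto
    also have "\<dots> = 2 powr (log 2 D + real p * T)"
      using D by (simp add: powr_add powr_powr mult.commute flip: powr_realpow)
    also have "\<dots> \<le> 2 powr ((log 2 D + real p) * T)"
      using D \<open>1 \<le> T\<close> mult_left_mono[of 1 T "log 2 D"] by (intro powr_mono) (auto simp: algebra_simps)
    also have "\<dots> \<le> 2 powr twr e (real n powr \<epsilon>)"
      using IH[rule_format, OF that] by (intro powr_mono) (auto simp: T_def)
    finally show ?thesis using Suc.hyps by (simp add: twr_Suc T_def)
  qed
  then have "\<exists>n1\<ge>1. \<forall>n\<ge>n1. C * twr (Suc e) (real n powr \<epsilon>') ^ p \<le> twr (Suc e) (real n powr \<epsilon>)"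
    using \<epsilon>'(2) by (intro exI[of _ n1]) simp
  then show ?case using \<epsilon>'(1) by (intro exI[of _ \<epsilon>'] conjI)
qed

section \<open>The three-dimensional case and the induction on the dimension\<close>

lemma same_orient_red_or_blue:
  fixes \<epsilon> :: real
  assumes "\<epsilon> > 0"
  shows "\<exists>n0. \<forall>n\<ge>n0. \<forall>(y :: 'a \<Rightarrow> real) \<alpha> \<beta> H. finite H \<longrightarrow> 2 powr (real n powr \<epsilon>) \<le> real (card H) \<longrightarrow>
    (\<exists>S\<subseteq>H. red_set (same_orient y \<alpha> \<beta>) S \<and> card S = s) \<or>
    (\<exists>S\<subseteq>H. blue_set (same_orient y \<alpha> \<beta>) S \<and> card S = n)"
proof -
  \<comment> \<open>With \<open>\<epsilon> * K \<ge> 2\<close> the blue size is at least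
    \<open>\<mu> * n^2\<close>, and the surplus factor \<open>n\<close> absorbs
    \<open>1 / \<mu>\<close>.\<close>
  define K where "K = nat \<lceil>2 / \<epsilon>\<rceil>"
  have "2 / \<epsilon> \<le> real K" unfolding K_def using assms by linarith
  then have K: "2 \<le> \<epsilon> * real K" using assms by (simp add: field_simps)
  obtain \<kappa> :: real where \<kappa>: "\<kappa> > 0" and main: "\<forall>(R :: 'a \<Rightarrow> 'a \<Rightarrow> 'a \<Rightarrow> bool) H. link_ordered R 10 \<longrightarrow> finite H \<longrightarrow> H \<noteq> {} \<longrightarrow>
     (\<exists>S\<subseteq>H. red_set R S \<and> card S = s) \<or> (\<exists>S\<subseteq>H. blue_set R S \<and> \<kappa> * ln (real (card H)) ^ K \<le> real (card S))"
    using link_ordered_red_or_blue[of 10 s K] by (elim exE conjE)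
  define \<mu> where "\<mu> = \<kappa> * ln 2 ^ K"
  have \<mu>: "\<mu> > 0" using \<kappa> by (simp add: \<mu>_def)
  define n0 where "n0 = Suc (nat \<lceil>1 / \<mu>\<rceil>)"
  have "(\<exists>S\<subseteq>H. red_set (same_orient y \<alpha> \<beta>) S \<and> card S = s) \<or>
    (\<exists>S\<subseteq>H. blue_set (same_orient y \<alpha> \<beta>) S \<and> card S = n)"
    if n: "n \<ge> n0" and H: "finite H" "2 powr (real n powr \<epsilon>) \<le> real (card H)" for n y \<alpha> \<beta> and H :: "'a set"
  proof -
    have n1: "real n \<ge> 1" "real n \<ge> 1 / \<mu>" using n unfolding n0_def by linarith+
    have "0 < 2 powr (real n powr \<epsilon>)" by simp
    then have cH: "0 < real (card H)" using H(2) by linarith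
    then have ne: "H \<noteq> {}" by auto
    from main[rule_format, OF link_ordered_same_orient H(1) ne, of y \<alpha> \<beta>] show ?thesis
    proof (elim disjE exE conjE)
      fix S assume "S \<subseteq> H" "red_set (same_orient y \<alpha> \<beta>) S" "card S = s"
      then show ?thesis by (intro disjI1 exI[of _ S]) simp
    next
      fix S assume S: "S \<subseteq> H" "blue_set (same_orient y \<alpha> \<beta>) S" "\<kappa> * ln (real (card H)) ^ K \<le> real (card S)"
      have "real n powr \<epsilon> * ln 2 = ln (2 powr (real n powr \<epsilon>))" by (simp add: ln_powr)
      also have "\<dots> \<le> ln (real (card H))" using H(2) cH by (subst ln_le_cancel_iff) auto
      finally have ln: "real n powr \<epsilon> * ln 2 \<le> ln (real (card H))" .
      have "real n = 1 * real n" by simp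
      also have "\<dots> \<le> (\<mu> * real n) * real n"
        using n1 \<mu> by (intro mult_right_mono) (auto simp: field_simps)
      also have "\<dots> = \<mu> * real n powr 2" using n1 by (simp add: powr_numeral power2_eq_square)
      also have "\<dots> \<le> \<mu> * real n powr (\<epsilon> * real K)"
        using n1 \<mu> K by (intro mult_left_mono powr_mono) auto
      also have "\<dots> = \<kappa> * (real n powr \<epsilon> * ln 2) ^ K"
        using n1 by (simp add: \<mu>_def power_mult_distrib powr_powr flip: powr_realpow)
      also have "\<dots> \<le> \<kappa> * ln (real (card H)) ^ K"
        using ln \<kappa> by (intro mult_left_mono power_mono) auto
      also note S(3)
      finally have "n \<le> card S" by simp
      then obtain S' where S': "S' \<subseteq> S" "card S' = n" by (rule obtain_subset_with_card_n)
      have "blue_set (same_orient y \<alpha> \<beta>) S'" using S(2) S'(1) unfolding blue_set_def by blast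
      then show ?thesis using S' S(1) by (intro disjI2 exI[of _ S']) auto
    qed
  qed
  then show ?thesis by (intro exI[of _ n0]) simp
qed

text \<open>The second alternative is only the negation of lying above, so vertices with last
  coordinate 0 still count for it.\<close>

definition one_sided_subset :: "nat \<Rightarrow> nat \<Rightarrow> 'j set \<Rightarrow> ('a \<Rightarrow> 'j \<Rightarrow> real) \<Rightarrow> ('a \<Rightarrow> real) \<Rightarrow> ('a \<Rightarrow> real) \<Rightarrow> 'a set \<Rightarrow> bool" where
  "one_sided_subset s n J A \<alpha> \<beta> I \<longleftrightarrow>
    (\<exists>S\<subseteq>I. card S = s \<and> (\<forall>T\<subseteq>S. card T = card J + 1 \<longrightarrow> lies_above J A \<alpha> \<beta> T)) \<or>
    (\<exists>S\<subseteq>I. card S = n \<and> (\<forall>T\<subseteq>S. card T = card J + 1 \<longrightarrow> \<not> lies_above J A \<alpha> \<beta> T))"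

lemma one_sided_subset_pivot:
  fixes I :: "'a set"
  assumes J: "J = {a, b}" "a \<noteq> b" and gen: "generic J A \<alpha> I"
    and H: "H \<subseteq> I" "\<And>w. w \<in> H \<Longrightarrow> A w a \<noteq> 0"
    and dich: "(\<exists>S\<subseteq>H. red_set (same_orient (\<lambda>i. A i b / A i a) (\<lambda>i. \<alpha> i / A i a) (\<lambda>i. \<beta> i / A i a)) S \<and> card S = s) \<or>
      (\<exists>S\<subseteq>H. blue_set (same_orient (\<lambda>i. A i b / A i a) (\<lambda>i. \<alpha> i / A i a) (\<lambda>i. \<beta> i / A i a)) S \<and> card S = n)"
  shows "one_sided_subset s n J A \<alpha> \<beta> I"
proof -
  let ?R = "same_orient (\<lambda>i. A i b / A i a) (\<lambda>i. \<alpha> i / A i a) (\<lambda>i. \<beta> i / A i a)"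
  have cJ: "card J + 1 = 3" using J by simp
  have triple: "\<exists>u v w. T = {u, v, w} \<and> u \<in> T \<and> v \<in> T \<and> w \<in> T \<and> u \<noteq> v \<and> u \<noteq> w \<and> v \<noteq> w \<and> (lies_above J A \<alpha> \<beta> T \<longleftrightarrow> ?R u v w)"
    if T: "T \<subseteq> H" "card T = 3" for T
  proof -
    obtain u v w where uvw: "T = {u, v, w}" "u \<noteq> v" "u \<noteq> w" "v \<noteq> w"
      using T(2) unfolding card_3_iff by (elim exE conjE)
    have "lin_indep J A \<alpha> T" using gen T H(1) cJ unfolding generic_def by simp
    then have "lies_above J A \<alpha> \<beta> T \<longleftrightarrow> ?R u v w"
      using H(2) T(1) uvw unfolding J uvw(1) by (intro above_triple) auto
    then show ?thesis using uvw by (intro exI[of _ u] exI[of _ v] exI[of _ w]) simp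
  qed
  from dich show ?thesis
  proof (elim disjE exE conjE)
    fix S assume S: "S \<subseteq> H" "red_set ?R S" "card S = s"
    have "lies_above J A \<alpha> \<beta> T" if "T \<subseteq> S" "card T = 3" for T
    proof -
      have "T \<subseteq> H" using that(1) S(1) by simp
      from triple[OF this that(2)] obtain u v w where
        "u \<in> T" "v \<in> T" "w \<in> T" "u \<noteq> v" "u \<noteq> w" "v \<noteq> w" "lies_above J A \<alpha> \<beta> T \<longleftrightarrow> ?R u v w" by (elim exE conjE)
      then show ?thesis using S(2) that(1) unfolding red_set_def by blast
    qed
    then show ?thesis using S(1,3) H(1) unfolding one_sided_subset_def cJ by (intro disjI1 exI[of _ S]) simp
  next
    fix S assume S: "S \<subseteq> H" "blue_set ?R S" "card S = n"
    have "\<not> lies_above J A \<alpha> \<beta> T" if "T \<subseteq> S" "card T = 3" for T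
    proof -
      have "T \<subseteq> H" using that(1) S(1) by simp
      from triple[OF this that(2)] obtain u v w where
        "u \<in> T" "v \<in> T" "w \<in> T" "lies_above J A \<alpha> \<beta> T \<longleftrightarrow> ?R u v w" by (elim exE conjE)
      then show ?thesis using S(2) that(1) unfolding blue_set_def by blast
    qed
    then show ?thesis using S(1,3) H(1) unfolding one_sided_subset_def cJ by (intro disjI2 exI[of _ S]) simp
  qed
qed

text \<open>At most one hyperplane has both coordinates in \<open>J\<close> equal to 0, so one of
  the two is nonzero on nearly half of \<open>I\<close> and can serve as the normalising coordinate.
  Starting from \<open>\<epsilon> / 2\<close> pays for this loss.\<close>

lemma one_sided_subset_base:
  fixes \<epsilon> :: real
  assumes "\<epsilon> > 0"
  shows "\<exists>n0. \<forall>n\<ge>n0. \<forall>(I :: 'a set) (J :: nat set) A \<alpha> \<beta>. finite I \<longrightarrow> card J = 2 \<longrightarrow> generic J A \<alpha> I \<longrightarrow>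
    2 powr (real n powr \<epsilon>) \<le> real (card I) \<longrightarrow> one_sided_subset s n J A \<alpha> \<beta> I"
proof -
  have "\<epsilon> / 2 > 0" using assms by simp
  from same_orient_red_or_blue[OF this, of s] obtain n0 where
    n0: "\<forall>n\<ge>n0. \<forall>(y :: 'a \<Rightarrow> real) \<alpha> \<beta> H. finite H \<longrightarrow> 2 powr (real n powr (\<epsilon> / 2)) \<le> real (card H) \<longrightarrow>
    (\<exists>S\<subseteq>H. red_set (same_orient y \<alpha> \<beta>) S \<and> card S = s) \<or>
    (\<exists>S\<subseteq>H. blue_set (same_orient y \<alpha> \<beta>) S \<and> card S = n)" by (elim exE)
  define n1 where "n1 = max n0 (Suc (nat \<lceil>2 powr (2 / \<epsilon>)\<rceil>))"
  have "one_sided_subset s n J A \<alpha> \<beta> I"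
    if n: "n \<ge> n1" and I: "finite I" "card J = 2" "generic J A \<alpha> I" "2 powr (real n powr \<epsilon>) \<le> real (card I)"
    for n A \<alpha> \<beta> and I :: "'a set" and J :: "nat set"
  proof -
    have nn: "n \<ge> n0" "real n \<ge> 2 powr (2 / \<epsilon>)" using n unfolding n1_def by linarith+
    define x where "x = real n powr (\<epsilon> / 2)"
    have "2 = (2 powr (2 / \<epsilon>)) powr (\<epsilon> / 2)" using assms by (simp add: powr_powr)
    also have "\<dots> \<le> x" unfolding x_def using nn(2) assms by (intro powr_mono2) auto
    finally have x: "2 \<le> x" .
    have xx: "real n powr \<epsilon> = x * x" by (simp add: x_def flip: powr_add)
    define X where "X = 2 powr x"
    have "2 powr (2::real) \<le> X" unfolding X_def using x by (intro powr_mono) auto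
    then have X: "4 \<le> X" by simp
    have "2 * x \<le> x * x" using x by (intro mult_right_mono) auto
    then have "2 powr (x + x) \<le> 2 powr (x * x)" by (intro powr_mono) auto
    then have "X * X \<le> real (card I)" using I(4) unfolding xx powr_add X_def by linarith
    moreover have "4 * X \<le> X * X" using X by (intro mult_right_mono) auto
    ultimately have cI: "4 * X \<le> real (card I)" by linarith
    obtain a b where J: "J = {a, b}" "a \<noteq> b" using I(2) unfolding card_2_iff by (elim exE conjE)
    define Z where "Z = {w \<in> I. \<forall>j\<in>J. A w j = 0}"
    have "card Z \<le> 1"
      unfolding Z_def by (rule card_zero_coords_le_1[OF I(3) I(1)]) (use I(2) cI X in auto)
    define Ia where "Ia = {w \<in> I. A w a \<noteq> 0}"
    define Ib where "Ib = {w \<in> I. A w b \<noteq> 0}"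
    have "I \<subseteq> Z \<union> (Ia \<union> Ib)" by (auto simp: Z_def Ia_def Ib_def J)
    then have "card I \<le> card (Z \<union> (Ia \<union> Ib))" using I(1) by (intro card_mono) (auto simp: Z_def Ia_def Ib_def)
    also have "\<dots> \<le> card Z + (card Ia + card Ib)"
      by (intro order.trans[OF card_Un_le] add_left_mono card_Un_le)
    finally have "real (card I) \<le> 1 + real (card Ia) + real (card Ib)" using \<open>card Z \<le> 1\<close> by linarith
    then consider "X \<le> real (card Ia)" | "X \<le> real (card Ib)" using cI X by linarith
    then show ?thesis
    proof cases
      case 1
      have "finite Ia" using I(1) by (simp add: Ia_def)
      show ?thesis
        by (rule one_sided_subset_pivot[OF J I(3) _ _ n0[rule_format, OF nn(1) \<open>finite Ia\<close> 1[unfolded X_def x_def]]])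
          (auto simp: Ia_def)
    next
      case 2
      have "finite Ib" using I(1) by (simp add: Ib_def)
      have J': "J = {b, a}" "b \<noteq> a" using J by auto
      show ?thesis
        by (rule one_sided_subset_pivot[OF J' I(3) _ _ n0[rule_format, OF nn(1) \<open>finite Ib\<close> 2[unfolded X_def x_def]]])
          (auto simp: Ib_def)
    qed
  qed
  then show ?thesis by (intro exI[of _ n1]) simp
qed

text \<open>On an end-homogeneous \<open>Y\<close> the colours are read off the arrangement cut out
  on the hyperplane \<open>w\<close>, one dimension lower. Here \<open>d = e + 2\<close>, hence the
  exponent \<open>e + 1\<close> in the size.\<close>

lemma one_sided_subset_step:
  fixes I :: "'a set" and J :: "nat set"
  assumes I: "finite I" "card J = Suc e" "generic J A \<alpha> I" and e: "e > 0"
    and size: "2 ^ (m * ((m + 1) ^ (e + 1) + 1)) + 1 \<le> card I" "Suc e + 1 \<le> card I"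
    and IH: "\<And>(Y :: 'a set) (J' :: nat set) A \<alpha> \<beta>. finite Y \<Longrightarrow> card J' = e \<Longrightarrow> generic J' A \<alpha> Y \<Longrightarrow>
      card Y = m \<Longrightarrow> one_sided_subset s n J' A \<alpha> \<beta> Y"
  shows "one_sided_subset s n J A \<alpha> \<beta> I"
proof -
  have finJ: "finite J" using I(2) by (intro card_ge_0_finite) simp
  \<comment> \<open>Removing the hyperplane without a coordinate to eliminate is what the
    \<open>+ 1\<close> in the size hypothesis is for.\<close>
  define Z where "Z = {w \<in> I. \<forall>j\<in>J. A w j = 0}"
  have "card Z \<le> 1"
    unfolding Z_def by (rule card_zero_coords_le_1[OF I(3) I(1)]) (use I(2) size in auto)
  moreover have "card (I - Z) = card I - card Z" using I(1) by (intro card_Diff_subset) (auto simp: Z_def)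
  ultimately have c: "2 ^ (m * ((m + 1) ^ (e + 1) + 1)) \<le> card (I - Z)" using size(1) by linarith
  have fin: "finite (I - Z)" using I(1) by simp
  have "0 < e + 1" by simp
  from erdos_rado_end_homogeneous[OF this fin c, of "lies_above J A \<alpha> \<beta>"]
  obtain Y w where Y: "Y \<subseteq> I - Z" "w \<in> I - Z - Y" "card Y = m"
    "\<forall>T\<subseteq>Y. card T = e + 1 + 1 \<longrightarrow> (\<exists>v\<in>T. lies_above J A \<alpha> \<beta> T = lies_above J A \<alpha> \<beta> (insert w (T - {v})))"
    by (elim exE conjE)
  obtain j where j: "j \<in> J" "A w j \<noteq> 0" using Y(2) by (auto simp: Z_def)
  have w: "w \<in> I" "w \<notin> Y" using Y(2) by auto
  have finY: "finite Y" by (rule finite_subset[OF Y(1) fin])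
  let ?J = "J - {j}" and ?A = "eliminate_coords A w j" and ?\<alpha> = "eliminate A w j \<alpha>" and ?\<beta> = "eliminate A w j \<beta>"
  have cJ: "card ?J = e" using I(2) finJ j by simp
  have "generic ?J ?A ?\<alpha> (I - {w})" by (rule generic_link[OF I(3) I(1) finJ w(1) j])
  then have "generic ?J ?A ?\<alpha> Y" by (rule generic_subset) (use Y(1) w in auto)
  from IH[OF finY cJ this Y(3), of ?\<beta>]
  have side: "one_sided_subset s n ?J ?A ?\<alpha> ?\<beta> Y" .
  \<comment> \<open>Since \<open>T'\<close> lies in \<open>T\<close>, a one-sided set for the link
    is one-sided for the original colouring, whichever \<open>v\<close> is exchanged.\<close>
  have lift: "\<exists>T'\<subseteq>T. card T' = card ?J + 1 \<and> lies_above J A \<alpha> \<beta> T = lies_above ?J ?A ?\<alpha> ?\<beta> T'"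
    if T: "T \<subseteq> Y" "card T = card J + 1" for T
  proof -
    have cT: "card T = e + 1 + 1" using T(2) I(2) by simp
    from Y(4)[rule_format, OF T(1) this] obtain v where v: "v \<in> T"
      "lies_above J A \<alpha> \<beta> T = lies_above J A \<alpha> \<beta> (insert w (T - {v}))" by (elim bexE)
    have "finite (T - {v})" using finite_subset[OF T(1) finY] by simp
    moreover have "w \<notin> T - {v}" using T(1) w(2) by blast
    ultimately have "lies_above J A \<alpha> \<beta> (insert w (T - {v})) = lies_above ?J ?A ?\<alpha> ?\<beta> (T - {v})"
      using j by (rule above_link)
    moreover have "card (T - {v}) = card ?J + 1" using cT cJ v(1) by simp
    ultimately show ?thesis using v(2) by (intro exI[of _ "T - {v}"]) auto
  qed
  have YI: "Y \<subseteq> I" using Y(1) by blast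
  from side show ?thesis
    unfolding one_sided_subset_def
  proof (elim disjE exE conjE)
    fix S assume S: "S \<subseteq> Y" "card S = s" "\<forall>T\<subseteq>S. card T = card ?J + 1 \<longrightarrow> lies_above ?J ?A ?\<alpha> ?\<beta> T"
    have "lies_above J A \<alpha> \<beta> T" if "T \<subseteq> S" "card T = card J + 1" for T
    proof -
      have "T \<subseteq> Y" using that(1) S(1) by simp
      from lift[OF this that(2)] obtain T' where "T' \<subseteq> T" "card T' = card ?J + 1"
        "lies_above J A \<alpha> \<beta> T = lies_above ?J ?A ?\<alpha> ?\<beta> T'" by (elim exE conjE)
      then show ?thesis using S(3)[rule_format, of T'] that(1) by auto
    qed
    then show "(\<exists>S\<subseteq>I. card S = s \<and> (\<forall>T\<subseteq>S. card T = card J + 1 \<longrightarrow> lies_above J A \<alpha> \<beta> T)) \<or>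
      (\<exists>S\<subseteq>I. card S = n \<and> (\<forall>T\<subseteq>S. card T = card J + 1 \<longrightarrow> \<not> lies_above J A \<alpha> \<beta> T))"
      using S(1,2) YI by (intro disjI1 exI[of _ S]) auto
  next
    fix S assume S: "S \<subseteq> Y" "card S = n" "\<forall>T\<subseteq>S. card T = card ?J + 1 \<longrightarrow> \<not> lies_above ?J ?A ?\<alpha> ?\<beta> T"
    have "\<not> lies_above J A \<alpha> \<beta> T" if "T \<subseteq> S" "card T = card J + 1" for T
    proof -
      have "T \<subseteq> Y" using that(1) S(1) by simp
      from lift[OF this that(2)] obtain T' where "T' \<subseteq> T" "card T' = card ?J + 1"
        "lies_above J A \<alpha> \<beta> T = lies_above ?J ?A ?\<alpha> ?\<beta> T'" by (elim exE conjE)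
      then show ?thesis using S(3)[rule_format, of T'] that(1) by auto
    qed
    then show "(\<exists>S\<subseteq>I. card S = s \<and> (\<forall>T\<subseteq>S. card T = card J + 1 \<longrightarrow> lies_above J A \<alpha> \<beta> T)) \<or>
      (\<exists>S\<subseteq>I. card S = n \<and> (\<forall>T\<subseteq>S. card T = card J + 1 \<longrightarrow> \<not> lies_above J A \<alpha> \<beta> T))"
      using S(1,2) YI by (intro disjI2 exI[of _ S]) auto
  qed
qed

theorem one_sided_subset_tower:
  fixes \<epsilon> :: real
  assumes "e \<ge> 2" "\<epsilon> > 0"
  shows "\<exists>n0. \<forall>n\<ge>n0. \<forall>(I :: 'a set) (J :: nat set) A \<alpha> \<beta>. finite I \<longrightarrow> card J = e \<longrightarrow> generic J A \<alpha> I \<longrightarrow>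
    twr e (real n powr \<epsilon>) \<le> real (card I) \<longrightarrow> one_sided_subset s n J A \<alpha> \<beta> I"
  using assms
proof (induction e arbitrary: \<epsilon> rule: nat_induct_at_least)
  case base
  then show ?case using one_sided_subset_base[of \<epsilon> s] by (simp add: numeral_2_eq_2)
next
  case (Suc e)
  \<comment> \<open>The exponent of 2 is below \<open>3 * (m + 1) ^ (e + 2)\<close>, and
    \<open>m + 1 \<le> 3 * x\<close> for \<open>m\<close> the rounded-up tower \<open>x\<close>;
    this gives \<open>p\<close> and \<open>C\<close>.\<close>
  define p where "p = e + 2"
  define C :: real where "C = 3 * 3 ^ p"
  have "1 \<le> e" using Suc.hyps by simp
  from twr_absorbs_polynomial[OF this Suc.prems, of C p] obtain \<epsilon>' n1 where
    \<epsilon>': "\<epsilon>' > 0" "n1 \<ge> 1" "\<forall>n\<ge>n1. C * twr e (real n powr \<epsilon>') ^ p \<le> twr e (real n powr \<epsilon>)"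
    by (elim exE conjE)
  from Suc.IH[OF \<epsilon>'(1)] obtain n0 where n0: "\<forall>n\<ge>n0. \<forall>(I :: 'a set) (J :: nat set) A \<alpha> \<beta>. finite I \<longrightarrow> card J = e \<longrightarrow> generic J A \<alpha> I \<longrightarrow>
    twr e (real n powr \<epsilon>') \<le> real (card I) \<longrightarrow> one_sided_subset s n J A \<alpha> \<beta> I" by (elim exE)
  have "one_sided_subset s n J A \<alpha> \<beta> I"
    if n: "n \<ge> max n0 n1" and I: "finite I" "card J = Suc e" "generic J A \<alpha> I" "twr (Suc e) (real n powr \<epsilon>) \<le> real (card I)"
    for n A \<alpha> \<beta> and I :: "'a set" and J :: "nat set"
  proof -
    define x where "x = twr e (real n powr \<epsilon>')"
    have x: "1 \<le> x" unfolding x_def using n \<epsilon>' by (intro twr_ge_1 powr_nat_ge_1) auto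
    define m where "m = nat \<lceil>x\<rceil>"
    have m: "x \<le> real m" "real m \<le> x + 1" using x unfolding m_def by linarith+
    define P where "P = (m + 1) ^ (e + 1)"
    have P: "e + 2 \<le> P"
    proof -
      have "m \<ge> 1" using m(1) x by linarith
      then have "2 ^ (e + 1) \<le> P" unfolding P_def by (intro power_mono) auto
      then show ?thesis using less_exp[of "e + 1"] by linarith
    qed
    have "m * (P + 1) + 1 = m * P + (m + 1)" by simp
    moreover have "m * P \<le> (m + 1) * P" by simp
    moreover have "m + 1 \<le> (m + 1) * P" using mult_le_mono2[of 1 P "m + 1"] P by simp
    moreover have "(m + 1) * P = (m + 1) ^ p" by (simp add: P_def p_def)
    ultimately have "m * (P + 1) + 1 \<le> 3 * (m + 1) ^ p" by linarith
    then have "real (m * (P + 1) + 1) \<le> real (3 * (m + 1) ^ p)" by (simp only: of_nat_le_iff)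
    also have "\<dots> = 3 * (real m + 1) ^ p" by (simp add: add.commute)
    also have "\<dots> \<le> 3 * (3 * x) ^ p" using m x by (intro mult_left_mono power_mono) auto
    also have "\<dots> = C * x ^ p" by (simp add: C_def power_mult_distrib)
    also have "\<dots> \<le> twr e (real n powr \<epsilon>)" using \<epsilon>'(3) n by (simp add: x_def)
    finally have le: "real (m * (P + 1) + 1) \<le> twr e (real n powr \<epsilon>)" .
    have "real (2 ^ (m * (P + 1) + 1)) = 2 powr real (m * (P + 1) + 1)" by (subst powr_realpow) auto
    also have "\<dots> \<le> 2 powr twr e (real n powr \<epsilon>)" using le by (intro powr_mono) auto
    also have "\<dots> \<le> real (card I)" using I(4) Suc.hyps by (simp add: twr_Suc)
    finally have cI: "2 ^ (m * (P + 1) + 1) \<le> card I" by (simp only: of_nat_le_iff)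
    have "m \<ge> 1" using m(1) x by linarith
    then have "1 * (P + 1) \<le> m * (P + 1)" by (intro mult_right_mono) auto
    moreover have "e + 3 \<le> 1 * (P + 1)" using P by simp
    ultimately have "e + 3 \<le> m * (P + 1)" by (rule order.trans[rotated])
    moreover have "m * (P + 1) + 1 < 2 ^ (m * (P + 1) + 1)" by (rule less_exp)
    ultimately have big: "Suc e + 1 \<le> card I" using cI by linarith
    have "1 \<le> (2::nat) ^ (m * (P + 1))" by simp
    then have size: "2 ^ (m * (P + 1)) + 1 \<le> card I" using cI by (simp only: power_add power_one_right)
    show ?thesis
    proof (rule one_sided_subset_step[OF I(1-3) _ size[unfolded P_def] big])
      fix Y :: "'a set" and J' :: "nat set" and A' \<alpha>' \<beta>'
      assume Y: "finite Y" "card J' = e" "generic J' A' \<alpha>' Y" "card Y = m"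
      have "n0 \<le> n" using n by simp
      moreover have "twr e (real n powr \<epsilon>') \<le> real (card Y)" using m(1) Y(4) by (simp add: x_def)
      ultimately show "one_sided_subset s n J' A' \<alpha>' \<beta>' Y" by (rule n0[rule_format, OF _ Y(1-3)])
    qed (use Suc.hyps in simp)
  qed
  then show ?case by (intro exI[of _ "max n0 n1"]) simp
qed

text \<open>A homogeneous system with more unknowns than equations, solved by elimination. It
  supplies dependencies among hyperplanes and, with the roles of rows and coordinates exchanged,
  kernel vectors.\<close>

lemma exists_dependency:
  assumes "finite J" "finite T" "card J < card T"
  shows "\<exists>c. kills J A T c \<and> (\<exists>i\<in>T. c i \<noteq> 0)"
  using assms
proof (induction J arbitrary: T A)
  case empty
  then obtain i where "i \<in> T" by fastforce
  then show ?case by (intro exI[of _ "\<lambda>_. 1"]) (auto simp: kills_def)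
next
  case (insert j J)
  show ?case
  proof (cases "\<forall>i\<in>T. A i j = 0")
    case True
    obtain c where "kills J A T c" "\<exists>i\<in>T. c i \<noteq> 0"
      using insert.IH[of T A] insert.prems insert.hyps by auto
    then show ?thesis using True by (intro exI[of _ c]) (simp add: kills_def)
  next
    case False
    then obtain w where w: "w \<in> T" "A w j \<noteq> 0" by blast
    have T': "finite (T - {w})" "w \<notin> T - {w}" "insert w (T - {w}) = T" using insert.prems w by auto
    have "card J < card (T - {w})" using insert.prems insert.hyps w by simp
    from insert.IH[OF T'(1) this, of "eliminate_coords A w j"] obtain c where
      c: "kills J (eliminate_coords A w j) (T - {w}) c" "\<exists>i\<in>T - {w}. c i \<noteq> 0" by (elim exE conjE)
    obtain c' where c': "c' w = - (\<Sum>i\<in>T - {w}. c' i * (A i j / A w j))" "\<And>i. i \<in> T - {w} \<Longrightarrow> c' i = c i"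
      using extend_coefficient[OF T'(1,2), of A j c] by blast
    have J: "insert j J - {j} = J" using insert.hyps by simp
    have k: "kills J (eliminate_coords A w j) (T - {w}) c'" 
      by (rule iffD2[OF kills_cong c(1)]) (rule c'(2))
    have "kills (insert j J) A (insert w (T - {w})) c'"
      using kills_link[where A = A and w = w and j = j, OF T'(1,2) insertI1 w(2), of J c'] c'(1) k unfolding J by simp
    then have "kills (insert j J) A T c'" unfolding T'(3) .
    moreover from c(2) obtain i where i: "i \<in> T - {w}" "c i \<noteq> 0" by (elim bexE)
    have "\<exists>i\<in>T. c' i \<noteq> 0" using i c'(2)[OF i(1)] by (intro bexI[of _ i]) auto
    ultimately show ?thesis by (intro exI[of _ c'] conjI)
  qed
qed

section \<open>Removing vertices on the coordinate hyperplane\<close>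

text \<open>Independence of the rows including the right-hand side. For \<open>d + 1\<close>
  hyperplanes, any \<open>d\<close> of which meet in one point, it says that they have no common
  point.\<close>

definition lin_indep2 :: "'j set \<Rightarrow> ('a \<Rightarrow> 'j \<Rightarrow> real) \<Rightarrow> ('a \<Rightarrow> real) \<Rightarrow> ('a \<Rightarrow> real) \<Rightarrow> 'a set \<Rightarrow> bool" where
  "lin_indep2 J A \<alpha> \<beta> U \<longleftrightarrow> (\<forall>c. kills J A U c \<longrightarrow> (\<Sum>i\<in>U. c i * \<alpha> i) = 0 \<longrightarrow> (\<Sum>i\<in>U. c i * \<beta> i) = 0 \<longrightarrow> (\<forall>i\<in>U. c i = 0))"

lemma indep2_subset:
  assumes U: "finite U" "T \<subseteq> U" and ind: "lin_indep2 J A \<alpha> \<beta> U"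
  shows "lin_indep2 J A \<alpha> \<beta> T"
  unfolding lin_indep2_def
proof (intro allI impI ballI)
  fix c i assume c: "kills J A T c" "(\<Sum>i\<in>T. c i * \<alpha> i) = 0" "(\<Sum>i\<in>T. c i * \<beta> i) = 0" and i: "i \<in> T"
  define c' where "c' i = (if i \<in> T then c i else 0)" for i
  have sum: "(\<Sum>i\<in>U. c' i * \<gamma> i) = (\<Sum>i\<in>T. c i * \<gamma> i)" for \<gamma>
    using U by (intro sum.mono_neutral_cong_right) (auto simp: c'_def)
  have "kills J A U c'" using c(1) unfolding kills_def sum .
  moreover have "(\<Sum>i\<in>U. c' i * \<alpha> i) = 0" "(\<Sum>i\<in>U. c' i * \<beta> i) = 0" using c(2,3) unfolding sum .
  ultimately have "c' i = 0" using ind i U unfolding lin_indep2_def by blast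
  then show "c i = 0" using i by (simp add: c'_def)
qed

text \<open>A family whose vertices avoid \<open>x\<^sub>d = 0\<close> is spoiled through a given subfamily \<open>T\<close> by at most one further
  hyperplane; this bounds what a maximal such family leaves out.\<close>

lemma indep_extension_unique:
  assumes ind: "lin_indep2 J A \<alpha> \<beta> (insert x (insert y T))" and fin: "finite T"
    and T: "x \<notin> T" "y \<notin> T" "x \<noteq> y"
    and c: "kills J A (insert x T) c" "(\<Sum>i\<in>insert x T. c i * \<beta> i) = 0" "c x \<noteq> 0"
    and d: "kills J A (insert y T) d" "(\<Sum>i\<in>insert y T. d i * \<beta> i) = 0" "d y \<noteq> 0"
  shows False
proof -
  let ?U = "insert x (insert y T)"
  define c' where "c' = c(y := 0)"
  define d' where "d' = d(x := 0)"
  have sc: "(\<Sum>i\<in>?U. c' i * \<gamma> i) = (\<Sum>i\<in>insert x T. c i * \<gamma> i)" for \<gamma>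
    using T fin by (intro sum.mono_neutral_cong_right) (auto simp: c'_def)
  have sd: "(\<Sum>i\<in>?U. d' i * \<gamma> i) = (\<Sum>i\<in>insert y T. d i * \<gamma> i)" for \<gamma>
    using T fin by (intro sum.mono_neutral_cong_right) (auto simp: d'_def)
  have kc: "kills J A ?U c'" using c(1) unfolding kills_def sc .
  have kd: "kills J A ?U d'" using d(1) unfolding kills_def sd .
  have bc: "(\<Sum>i\<in>?U. c' i * \<beta> i) = 0" and bd: "(\<Sum>i\<in>?U. d' i * \<beta> i) = 0"
    using c(2) d(2) unfolding sc sd .
  have nz: "c' x \<noteq> 0" "d' y \<noteq> 0" using c(3) d(3) T by (auto simp: c'_def d'_def)
  have ind': "e i = 0" if "kills J A ?U e" "(\<Sum>i\<in>?U. e i * \<alpha> i) = 0" "(\<Sum>i\<in>?U. e i * \<beta> i) = 0" "i \<in> ?U" for e i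
    using ind that unfolding lin_indep2_def by blast
  \<comment> \<open>The combination \<open>t * c' - s * d'\<close> also has
    \<open>\<alpha>\<close>-sum 0, so independence makes it vanish; but at \<open>x\<close>, where
    \<open>d'\<close> is 0, it equals \<open>t * c' x\<close>, which is nonzero.\<close>
  define s where "s = (\<Sum>i\<in>?U. c' i * \<alpha> i)"
  define t where "t = (\<Sum>i\<in>?U. d' i * \<alpha> i)"
  have "t \<noteq> 0" using ind'[OF kd _ bd, of y] nz by (auto simp: t_def)
  have "t * c' x - s * d' x = 0"
  proof (rule ind'[of "\<lambda>i. t * c' i - s * d' i"])
    show "kills J A ?U (\<lambda>i. t * c' i - s * d' i)" by (rule kills_combine[OF kc kd])
    show "(\<Sum>i\<in>?U. (t * c' i - s * d' i) * \<alpha> i) = 0" unfolding sum_combine s_def t_def by (simp only: mult.commute diff_self)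
    show "(\<Sum>i\<in>?U. (t * c' i - s * d' i) * \<beta> i) = 0" unfolding sum_combine bc bd by simp
  qed simp
  then show False using nz \<open>t \<noteq> 0\<close> by (simp add: d'_def)
qed

text \<open>Independence with \<open>\<beta>\<close> in place of the last coordinate means that the
  vertex of a \<open>d\<close>-subfamily is off \<open>x_d = 0\<close>. For a maximal
  \<open>S\<close>, each outside element is blocked by a subset of \<open>S\<close> with at most
  \<open>d - 1\<close> members; distinct elements have distinct blockers, so counting blockers
  bounds \<open>I - S\<close>.\<close>

lemma exists_large_indep_subset:
  fixes I :: "'a set"
  assumes fin: "finite I" and big: "card J + 2 \<le> card I"
    and ind: "\<And>U. U \<subseteq> I \<Longrightarrow> card U = card J + 2 \<Longrightarrow> lin_indep2 J A \<alpha> \<beta> U"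
  shows "\<exists>S\<subseteq>I. card I \<le> (card S + 1) ^ (card J + 1) \<and> (\<forall>T\<subseteq>S. card T \<le> card J + 1 \<longrightarrow> lin_indep J A \<beta> T)"
proof -
  have ind': "lin_indep2 J A \<alpha> \<beta> U" if U: "U \<subseteq> I" "card U \<le> card J + 2" for U
  proof -
    from exists_superset_card[OF fin U big] obtain V where V: "U \<subseteq> V" "V \<subseteq> I" "card V = card J + 2"
      by (elim exE conjE)
    show ?thesis by (rule indep2_subset[OF finite_subset[OF V(2) fin] V(1) ind[OF V(2,3)]])
  qed
  \<comment> \<open>Asking this also for fewer than \<open>d\<close> members ensures that a
    dependency spoiling \<open>insert x S\<close> has a nonzero coefficient at \<open>x\<close>: the
    rest of its support is independent.\<close>
  define ok where "ok S \<longleftrightarrow> S \<subseteq> I \<and> (\<forall>T\<subseteq>S. card T \<le> card J + 1 \<longrightarrow> lin_indep J A \<beta> T)" for S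
  have "ok {}" by (simp add: ok_def lin_indep_def)
  moreover have "\<forall>S. ok S \<longrightarrow> card S < card I + 1"
    using fin by (auto simp: ok_def less_Suc_eq_le intro: card_mono)
  ultimately have "\<exists>S. ok S \<and> (\<forall>S'. ok S' \<longrightarrow> card S' \<le> card S)" by (rule ex_has_greatest_nat)
  then obtain S where S: "ok S" "\<forall>S'. ok S' \<longrightarrow> card S' \<le> card S" by (elim exE conjE)
  have SI: "S \<subseteq> I" and Sind: "\<And>T. T \<subseteq> S \<Longrightarrow> card T \<le> card J + 1 \<Longrightarrow> lin_indep J A \<beta> T"
    using S(1) by (auto simp: ok_def)
  have finS: "finite S" by (rule finite_subset[OF SI fin])
  define ext where "ext x T \<longleftrightarrow> T \<subseteq> S \<and> card T \<le> card J \<and>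
    (\<exists>c. kills J A (insert x T) c \<and> (\<Sum>i\<in>insert x T. c i * \<beta> i) = 0 \<and> c x \<noteq> 0)" for x T
  have ext: "\<exists>T. ext x T" if x: "x \<in> I - S" for x
  proof -
    have "\<not> card (insert x S) \<le> card S" using x finS by simp
    then have "\<not> ok (insert x S)" using S(2)[rule_format, of "insert x S"] by (rule contrapos_nn)
    then obtain T where T: "T \<subseteq> insert x S" "card T \<le> card J + 1" "\<not> lin_indep J A \<beta> T"
      using x SI unfolding ok_def by auto
    from T(3) obtain c i where c: "kills J A T c" "(\<Sum>i\<in>T. c i * \<beta> i) = 0" "i \<in> T" "c i \<noteq> 0"
      unfolding lin_indep_def by auto
    have finT: "finite T" by (rule finite_subset[OF T(1)]) (use finS in simp)
    have xT: "x \<in> T"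
    proof (rule ccontr)
      assume "x \<notin> T"
      then have "T \<subseteq> S" using T(1) by blast
      from Sind[OF this T(2)] show False using T(3) by (rule notE[rotated])
    qed
    then have ins: "insert x (T - {x}) = T" by blast
    have sub: "T - {x} \<subseteq> S" using T(1) by blast
    have card: "card (T - {x}) \<le> card J" using T(2) xT finT by simp
    have "c x \<noteq> 0"
    proof
      assume "c x = 0"
      then have sum: "(\<Sum>i\<in>T. c i * \<gamma> i) = (\<Sum>i\<in>T - {x}. c i * \<gamma> i)" for \<gamma>
        using finT by (intro sum.mono_neutral_right) auto
      have "kills J A (T - {x}) c" using c(1) unfolding kills_def sum .
      moreover have "(\<Sum>i\<in>T - {x}. c i * \<beta> i) = 0" using c(2) unfolding sum .
      moreover have "i \<in> T - {x}" using c(3,4) \<open>c x = 0\<close> by auto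
      moreover have "lin_indep J A \<beta> (T - {x})" by (rule Sind[OF sub]) (use card in simp)
      ultimately have "c i = 0" by (intro lin_indepD[of J A \<beta> "T - {x}" c])
      then show False using c(4) by simp
    qed
    then have "ext x (T - {x})" unfolding ext_def ins using sub card c(1,2) by (intro conjI exI[of _ c])
    then show ?thesis by (rule exI)
  qed
  define \<tau> where "\<tau> x = (SOME T. ext x T)" for x
  have \<tau>: "ext x (\<tau> x)" if "x \<in> I - S" for x
    unfolding \<tau>_def using ext[OF that] by (rule someI_ex)
  have "inj_on \<tau> (I - S)"
  proof (rule inj_onI, rule ccontr)
    fix x y assume xy: "x \<in> I - S" "y \<in> I - S" "\<tau> x = \<tau> y" "x \<noteq> y"
    define T where "T = \<tau> x"
    have T: "ext x T" "ext y T" using \<tau>[OF xy(1)] \<tau>[OF xy(2)] xy(3) by (simp_all add: T_def)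
    have TS: "T \<subseteq> S" "card T \<le> card J" using T(1) by (simp_all add: ext_def)
    have finT: "finite T" by (rule finite_subset[OF TS(1) finS])
    have nin: "x \<notin> T" "y \<notin> T" using TS(1) xy(1,2) by auto
    obtain c where c: "kills J A (insert x T) c" "(\<Sum>i\<in>insert x T. c i * \<beta> i) = 0" "c x \<noteq> 0"
      using T(1) unfolding ext_def by (elim exE conjE)
    obtain d where d: "kills J A (insert y T) d" "(\<Sum>i\<in>insert y T. d i * \<beta> i) = 0" "d y \<noteq> 0"
      using T(2) unfolding ext_def by (elim exE conjE)
    have "insert x (insert y T) \<subseteq> I" using xy(1,2) TS(1) SI by blast
    moreover have "card (insert x (insert y T)) \<le> card J + 2" using TS(2) finT nin xy(4) by simp
    ultimately have "lin_indep2 J A \<alpha> \<beta> (insert x (insert y T))" by (rule ind')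
    then show False using finT nin xy(4) c d by (rule indep_extension_unique)
  qed
  moreover have "\<tau> ` (I - S) \<subseteq> {T. T \<subseteq> S \<and> card T \<le> card J}"
  proof (rule image_subsetI)
    fix x assume "x \<in> I - S"
    from \<tau>[OF this] show "\<tau> x \<in> {T. T \<subseteq> S \<and> card T \<le> card J}" by (simp add: ext_def)
  qed
  ultimately have "card (I - S) \<le> card {T. T \<subseteq> S \<and> card T \<le> card J}"
    using finS by (intro card_inj_on_le) auto
  also have "\<dots> \<le> (card S + 1) ^ card J" by (rule card_subsets_le[OF finS])
  finally have 1: "card (I - S) \<le> (card S + 1) ^ card J" .
  have "card I = card (I - S) + card S"
    using card_Diff_subset[OF finS SI] card_mono[OF fin SI] by linarith
  also have "\<dots> \<le> (card S + 1) ^ card J + card S * (card S + 1) ^ card J"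
    using 1 by (intro add_mono) simp_all
  also have "\<dots> = (card S + 1) ^ (card J + 1)" by simp
  finally show ?thesis using SI Sind by (intro exI[of _ S]) auto
qed

section \<open>Hyperplane arrangements\<close>

locale arrangement =
  fixes d :: nat and H :: "real vec set set" and a :: "real vec set \<Rightarrow> real vec" and b :: "real vec set \<Rightarrow> real"
  assumes d: "1 \<le> d" and general: "general_position d H"
    and hyperplane: "h \<in> H \<Longrightarrow> h = {x \<in> carrier_vec d. a h \<bullet> x = b h}"
begin

abbreviation "J \<equiv> {..<d - 1}"
abbreviation "A \<equiv> \<lambda>h j. a h $ j"
abbreviation "\<alpha> \<equiv> \<lambda>h. a h $ (d - 1)"

lemma finite_H: "finite H"
  using general by (simp add: general_position_def)

lemma mem_iff:
  assumes "h \<in> H" "x \<in> carrier_vec d"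
  shows "x \<in> h \<longleftrightarrow> (\<Sum>j<d. x $ j * a h $ j) = b h"
proof -
  have "x \<in> h \<longleftrightarrow> a h \<bullet> x = b h" using hyperplane[OF assms(1)] assms(2) by blast
  then show ?thesis using assms(2) by (simp add: scalar_prod_def lessThan_atLeast0 mult.commute)
qed

lemma sum_split_last: "(\<Sum>j<d. f j) = (\<Sum>j<d - 1. f j) + f (d - 1)" for f :: "nat \<Rightarrow> real"
  using d sum.lessThan_Suc[of f "d - 1"] by simp

lemma vertex_exists:
  assumes "T \<subseteq> H" "card T = d"
  obtains p where "\<Inter>T = {p}" "p \<in> carrier_vec d"
proof -
  from general assms obtain p where p: "\<Inter>T = {p}" unfolding general_position_def by blast
  have "T \<noteq> {}" using assms d by auto
  then obtain h where h: "h \<in> T" by blast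
  have "p \<in> h" using p h by blast
  moreover have "h \<subseteq> carrier_vec d" using hyperplane[of h] h assms(1) by blast
  ultimately show ?thesis using that[OF p] by blast
qed

lemma sum_swap_coords:
  "(\<Sum>h\<in>T. c h * (\<Sum>j<d. x j * a h $ j)) = (\<Sum>j<d. x j * (\<Sum>h\<in>T. c h * a h $ j))"
proof -
  have "(\<Sum>h\<in>T. c h * (\<Sum>j<d. x j * a h $ j)) = (\<Sum>h\<in>T. \<Sum>j<d. x j * (c h * a h $ j))"
    by (simp add: sum_distrib_left mult_ac)
  also have "\<dots> = (\<Sum>j<d. \<Sum>h\<in>T. x j * (c h * a h $ j))" by (rule sum.swap)
  finally show ?thesis by (simp add: sum_distrib_left)
qed

lemma last_coordinate:
  assumes "T \<subseteq> H" "p \<in> carrier_vec d" "\<And>h. h \<in> T \<Longrightarrow> p \<in> h" "kills J A T c"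
  shows "(\<Sum>h\<in>T. c h * b h) = p $ (d - 1) * (\<Sum>h\<in>T. c h * \<alpha> h)"
proof -
  have "(\<Sum>h\<in>T. c h * b h) = (\<Sum>h\<in>T. c h * (\<Sum>j<d. p $ j * a h $ j))"
  proof (rule sum.cong[OF refl])
    fix h assume h: "h \<in> T"
    then have "h \<in> H" using assms(1) by blast
    from mem_iff[OF this assms(2)] assms(3)[OF h]
    show "c h * b h = c h * (\<Sum>j<d. p $ j * a h $ j)" by simp
  qed
  also have "\<dots> = (\<Sum>j<d. p $ j * (\<Sum>h\<in>T. c h * a h $ j))" by (rule sum_swap_coords)
  also have "\<dots> = p $ (d - 1) * (\<Sum>h\<in>T. c h * \<alpha> h)"
    using assms(4) unfolding sum_split_last kills_def by simp
  finally show ?thesis .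
qed

text \<open>If \<open>d\<close> normals were dependent, some nonzero \<open>x\<close> would be
  orthogonal to all of them: \<open>d - 1\<close> rows have a common kernel vector by counting, and
  the dependency handles the remaining row. Translating the vertex by \<open>x\<close> gives a
  second common point.\<close>

lemma generic_H: "generic J A \<alpha> H"
  unfolding generic_def
proof (intro allI impI)
  fix T assume T: "T \<subseteq> H" "card T = card J + 1"
  have cT: "card T = d" using T(2) d by simp
  have finT: "finite T" by (rule finite_subset[OF T(1) finite_H])
  from vertex_exists[OF T(1) cT] obtain p where p: "\<Inter>T = {p}" "p \<in> carrier_vec d" .
  show "lin_indep J A \<alpha> T"
    unfolding lin_indep_def
  proof (intro allI impI ballI, rule ccontr)
    fix c w assume c: "kills J A T c" "(\<Sum>i\<in>T. c i * \<alpha> i) = 0" and w: "w \<in> T" "c w \<noteq> 0"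
    have col: "(\<Sum>h\<in>T. c h * a h $ j) = 0" if "j < d" for j
      using c that unfolding kills_def by (cases "j = d - 1") auto
    have "card (T - {w}) < card {..<d}" using w finT cT d by simp
    from exists_dependency[OF finite_Diff[OF finT] finite_lessThan this, of "\<lambda>j h. a h $ j"]
    obtain x j0 where x: "kills (T - {w}) (\<lambda>j h. a h $ j) {..<d} x" "j0 \<in> {..<d}" "x j0 \<noteq> 0"
      by (elim exE conjE bexE)
    have row: "(\<Sum>j<d. x j * a h $ j) = 0" if "h \<in> T - {w}" for h
      using x(1) that unfolding kills_def by blast
    have "(\<Sum>h\<in>T. c h * (\<Sum>j<d. x j * a h $ j)) = c w * (\<Sum>j<d. x j * a w $ j) + (\<Sum>h\<in>T - {w}. c h * (\<Sum>j<d. x j * a h $ j))"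
      by (rule sum.remove[OF finT w(1)])
    also have "(\<Sum>h\<in>T - {w}. c h * (\<Sum>j<d. x j * a h $ j)) = 0" using row by simp
    finally have "c w * (\<Sum>j<d. x j * a w $ j) = (\<Sum>j<d. x j * (\<Sum>h\<in>T. c h * a h $ j))"
      using sum_swap_coords[of c x T] by simp
    also have "\<dots> = 0" using col by simp
    finally have roww: "(\<Sum>j<d. x j * a w $ j) = 0" using w(2) by simp
    define p' where "p' = vec d (\<lambda>j. p $ j + x j)"
    have p': "p' \<in> carrier_vec d" by (simp add: p'_def)
    have "p' \<in> h" if h: "h \<in> T" for h
    proof -
      have hH: "h \<in> H" using h T(1) by blast
      have "p \<in> h" using p(1) h by blast
      have "(\<Sum>j<d. p' $ j * a h $ j) = (\<Sum>j<d. p $ j * a h $ j) + (\<Sum>j<d. x j * a h $ j)"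
        by (simp add: p'_def distrib_right sum.distrib)
      also have "(\<Sum>j<d. x j * a h $ j) = 0" using row[of h] roww h by (cases "h = w") auto
      finally show ?thesis using \<open>p \<in> h\<close> mem_iff[OF hH p(2)] mem_iff[OF hH p'] by simp
    qed
    then have "p' \<in> \<Inter>T" by (rule InterI)
    then have "p' = p" unfolding p(1) by (rule singletonD)
    then have "p' $ j0 = p $ j0" by simp
    then show False using x(2,3) by (simp add: p'_def)
  qed
qed

text \<open>A dependency including the right-hand sides puts \<open>w\<close> through the vertex of
  the other \<open>d\<close> hyperplanes. Exchanging one of them for \<open>w\<close> gives a
  different \<open>d\<close>-subfamily with the same vertex, which general position forbids.\<close>

lemma indep2_H:
  assumes U: "U \<subseteq> H" "card U = card J + 2"
  shows "lin_indep2 J A \<alpha> b U"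
  unfolding lin_indep2_def
proof (intro allI impI ballI, rule ccontr)
  fix c w assume c: "kills J A U c" "(\<Sum>i\<in>U. c i * \<alpha> i) = 0" "(\<Sum>i\<in>U. c i * b i) = 0" and w: "w \<in> U" "c w \<noteq> 0"
  have cU: "card U = d + 1" using U(2) d by simp
  have finU: "finite U" by (rule finite_subset[OF U(1) finite_H])
  define T where "T = U - {w}"
  have T: "T \<subseteq> H" "card T = d" using U(1) cU finU w(1) by (auto simp: T_def)
  from vertex_exists[OF T] obtain p where p: "\<Inter>T = {p}" "p \<in> carrier_vec d" .
  have pT: "p \<in> h" if "h \<in> T" for h using p(1) that by blast
  have col: "(\<Sum>h\<in>U. c h * a h $ j) = 0" if "j < d" for j
    using c that unfolding kills_def by (cases "j = d - 1") auto
  let ?f = "\<lambda>h. (\<Sum>j<d. p $ j * a h $ j)"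
  have "(\<Sum>h\<in>U. c h * (?f h - b h)) = (\<Sum>h\<in>U. c h * ?f h) - (\<Sum>h\<in>U. c h * b h)"
    by (simp add: right_diff_distrib sum_subtractf)
  also have "(\<Sum>h\<in>U. c h * ?f h) = (\<Sum>j<d. p $ j * (\<Sum>h\<in>U. c h * a h $ j))" by (rule sum_swap_coords)
  also have "\<dots> = 0" using col by simp
  finally have "(\<Sum>h\<in>U. c h * (?f h - b h)) = 0" using c(3) by simp
  moreover have "(\<Sum>h\<in>U. c h * (?f h - b h)) = c w * (?f w - b w) + (\<Sum>h\<in>T. c h * (?f h - b h))"
    unfolding T_def by (rule sum.remove[OF finU w(1)])
  moreover have "(\<Sum>h\<in>T. c h * (?f h - b h)) = 0"
  proof (rule sum.neutral, rule ballI)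
    fix h assume "h \<in> T"
    then have "?f h = b h" using mem_iff[OF _ p(2), of h] pT[of h] T(1) by blast
    then show "c h * (?f h - b h) = 0" by simp
  qed
  ultimately have "?f w = b w" using w(2) by simp
  moreover have "w \<in> H" using w(1) U(1) by blast
  ultimately have pw: "p \<in> w" using mem_iff[OF _ p(2)] by simp
  have "T \<noteq> {}" using T(2) d by auto
  then obtain k where k: "k \<in> T" by blast
  define T' where "T' = U - {k}"
  have kU: "k \<in> U" "k \<noteq> w" using k by (auto simp: T_def)
  have T': "T' \<subseteq> H" "card T' = d" using U(1) cU finU kU by (auto simp: T'_def)
  from vertex_exists[OF T'] obtain p' where p': "\<Inter>T' = {p'}" .
  have "p \<in> \<Inter>T'"
  proof (rule InterI)
    fix h assume "h \<in> T'"
    then have "h = w \<or> h \<in> T" by (auto simp: T'_def T_def)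
    then show "p \<in> h" using pw pT by (elim disjE) simp_all
  qed
  then have "p = p'" unfolding p' by (rule singletonD)
  then have "\<Inter>T = \<Inter>T'" using p(1) p' by simp
  moreover have "inj_on \<Inter> {T. T \<subseteq> H \<and> card T = d}" using general by (simp add: general_position_def)
  ultimately have "T = T'" using T T' by (intro inj_onD[of \<Inter> "{T. T \<subseteq> H \<and> card T = d}" T T']) simp_all
  then show False using w(1) kU by (auto simp: T_def T'_def)
qed

lemma lies_above_iff:
  assumes T: "T \<subseteq> H" "card T = d" "\<Inter>T = {p}"
  shows "lies_above J A \<alpha> b T \<longleftrightarrow> p $ (d - 1) > 0"
    and "lin_indep J A b T \<Longrightarrow> p $ (d - 1) \<noteq> 0"
proof -
  from vertex_exists[OF T(1,2)] have p: "p \<in> carrier_vec d" using T(3) by auto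
  have finT: "finite T" by (rule finite_subset[OF T(1) finite_H])
  have pT: "p \<in> h" if "h \<in> T" for h using T(3) that by blast
  have last: "(\<Sum>h\<in>T. c h * b h) = p $ (d - 1) * (\<Sum>h\<in>T. c h * \<alpha> h)" if "kills J A T c" for c
    using T(1) p pT that by (rule last_coordinate)
  have ind: "lin_indep J A \<alpha> T" using generic_H T(1,2) d unfolding generic_def by simp
  have "card J < card T" using T(2) d by simp
  from exists_dependency[OF finite_lessThan finT this, of A]
  obtain c i where c: "kills J A T c" "i \<in> T" "c i \<noteq> 0" by (elim exE conjE bexE)
  have nz: "(\<Sum>h\<in>T. c h * \<alpha> h) \<noteq> 0"
  proof
    assume "(\<Sum>h\<in>T. c h * \<alpha> h) = 0"
    from lin_indepD[OF ind c(1) this c(2)] c(3) show False by simp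
  qed
  show "lies_above J A \<alpha> b T \<longleftrightarrow> p $ (d - 1) > 0"
  proof
    assume "lies_above J A \<alpha> b T"
    then obtain c where k: "kills J A T c" and pos: "(\<Sum>i\<in>T. c i * \<alpha> i) * (\<Sum>i\<in>T. c i * b i) > 0"
      unfolding lies_above_def by (elim exE conjE)
    have "p $ (d - 1) * (\<Sum>i\<in>T. c i * \<alpha> i)\<^sup>2 > 0"
      using pos unfolding last[OF k] by (simp add: power2_eq_square mult_ac)
    then show "p $ (d - 1) > 0" by (simp add: zero_less_mult_iff)
  next
    assume "p $ (d - 1) > 0"
    then have "p $ (d - 1) * (\<Sum>i\<in>T. c i * \<alpha> i)\<^sup>2 > 0" using nz by (intro mult_pos_pos) simp_all
    then have "(\<Sum>i\<in>T. c i * \<alpha> i) * (\<Sum>i\<in>T. c i * b i) > 0"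
      unfolding last[OF c(1)] by (simp add: power2_eq_square mult_ac)
    then show "lies_above J A \<alpha> b T" unfolding lies_above_def using c(1) by (intro exI[of _ c] conjI)
  qed
  show "p $ (d - 1) \<noteq> 0" if indb: "lin_indep J A b T"
  proof
    assume "p $ (d - 1) = 0"
    then have "(\<Sum>i\<in>T. c i * b i) = 0" unfolding last[OF c(1)] by simp
    from lin_indepD[OF indb c(1) this c(2)] c(3) show False by simp
  qed
qed

text \<open>A not-above set of size \<open>(n + 1) ^ d\<close> contains \<open>n\<close> members
  whose vertices are off \<open>x_d = 0\<close>, hence below: the extraction takes at most a
  \<open>d\<close>-th root.\<close>

lemma one_sided_if_one_sided_subset:
  assumes side: "one_sided_subset s ((n + 1) ^ d) J A \<alpha> b H" and n: "d \<le> n"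
  shows "(\<exists>S\<subseteq>H. card S = s \<and> vertices_above d S) \<or> (\<exists>S\<subseteq>H. card S = n \<and> vertices_below d S)"
proof -
  have cJ: "card J + 1 = d" "card J + 2 = d + 1" using d by simp_all
  from side show ?thesis
    unfolding one_sided_subset_def cJ
  proof (elim disjE exE conjE)
    fix S assume S: "S \<subseteq> H" "card S = s" "\<forall>T\<subseteq>S. card T = d \<longrightarrow> lies_above J A \<alpha> b T"
    have "vertices_above d S"
      unfolding vertices_above_def vertex_set_def
    proof (rule ballI)
      fix p assume "p \<in> {p. \<exists>T. T \<subseteq> S \<and> card T = d \<and> \<Inter>T = {p}}"
      then obtain T where T: "T \<subseteq> S" "card T = d" "\<Inter>T = {p}" by blast
      have "T \<subseteq> H" using T(1) S(1) by simp
      from lies_above_iff(1)[OF this T(2,3)] S(3)[rule_format, OF T(1,2)]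
      show "p $ (d - 1) > 0" by simp
    qed
    then show ?thesis using S(1,2) by (intro disjI1 exI[of _ S]) simp
  next
    fix S assume S: "S \<subseteq> H" "card S = (n + 1) ^ d" "\<forall>T\<subseteq>S. card T = d \<longrightarrow> \<not> lies_above J A \<alpha> b T"
    have finS: "finite S" by (rule finite_subset[OF S(1) finite_H])
    have "d + 1 \<le> (n + 1) ^ d" using n d self_le_power[of "n + 1" d] by simp
    then have big: "card J + 2 \<le> card S" using S(2) cJ by simp
    have "\<exists>S'\<subseteq>S. card S \<le> (card S' + 1) ^ (card J + 1) \<and> (\<forall>T\<subseteq>S'. card T \<le> card J + 1 \<longrightarrow> lin_indep J A b T)"
      by (rule exists_large_indep_subset[OF finS big]) (rule indep2_H[OF order.trans[OF _ S(1)]])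
    then obtain S' where S': "S' \<subseteq> S" "card S \<le> (card S' + 1) ^ (card J + 1)"
      "\<forall>T\<subseteq>S'. card T \<le> card J + 1 \<longrightarrow> lin_indep J A b T" by (elim exE conjE)
    have "(n + 1) ^ d \<le> (card S' + 1) ^ d" using S'(2) S(2) cJ(1) by simp
    then have "n \<le> card S'" using power_strict_mono[of "card S' + 1" "n + 1" d] d by linarith
    then obtain S'' where S'': "S'' \<subseteq> S'" "card S'' = n" by (rule obtain_subset_with_card_n)
    have S''H: "S'' \<subseteq> H" using S''(1) S'(1) S(1) by simp
    have "vertices_below d S''"
      unfolding vertices_below_def vertex_set_def
    proof (rule ballI)
      fix p assume "p \<in> {p. \<exists>T. T \<subseteq> S'' \<and> card T = d \<and> \<Inter>T = {p}}"
      then obtain T where T: "T \<subseteq> S''" "card T = d" "\<Inter>T = {p}" by blast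
      have TS': "T \<subseteq> S'" and TS: "T \<subseteq> S" and TH: "T \<subseteq> H" using T(1) S''(1) S'(1) S(1) by auto
      have "lin_indep J A b T" using S'(3)[rule_format, OF TS'] T(2) cJ by simp
      then have "p $ (d - 1) \<noteq> 0" by (rule lies_above_iff(2)[OF TH T(2,3)])
      moreover have "\<not> p $ (d - 1) > 0"
        using lies_above_iff(1)[OF TH T(2,3)] S(3)[rule_format, OF TS T(2)] by simp
      ultimately show "p $ (d - 1) < 0" by simp
    qed
    then show ?thesis using S''H S''(2) by (intro disjI2 exI[of _ S'']) simp
  qed
qed

end

section \<open>From arrangements to the bounds on \<open>OSH\<close>\<close>

lemma general_position_arrangement:
  assumes "general_position d H" "1 \<le> d"
  obtains a b where "arrangement d H a b"
proof -
  have "\<forall>h\<in>H. \<exists>q :: real vec \<times> real. h = {x \<in> carrier_vec d. fst q \<bullet> x = snd q}"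
  proof
    fix h assume "h \<in> H"
    then have "is_hyperplane d h" using assms(1) by (simp add: general_position_def)
    then obtain a b where "h = {x \<in> carrier_vec d. a \<bullet> x = b}" unfolding is_hyperplane_def by blast
    then show "\<exists>q :: real vec \<times> real. h = {x \<in> carrier_vec d. fst q \<bullet> x = snd q}"
      by (intro exI[of _ "(a, b)"]) simp
  qed
  then obtain q :: "real vec set \<Rightarrow> real vec \<times> real" where q: "\<forall>h\<in>H. h = {x \<in> carrier_vec d. fst (q h) \<bullet> x = snd (q h)}"
    by (elim bchoice[THEN exE])
  have "arrangement d H (\<lambda>h. fst (q h)) (\<lambda>h. snd (q h))"
    by (rule arrangement.intro[OF assms(2,1)]) (rule q[rule_format])
  then show ?thesis by (rule that)
qed

theorem OSH_le_twr:
  fixes \<epsilon> :: real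
  assumes "d \<ge> 3" "\<epsilon> > 0"
  shows "\<exists>n0. \<forall>n\<ge>n0. ereal_of_enat (OSH d s n) \<le> ereal (twr (d - 1) (real n powr \<epsilon>))"
proof -
  have e: "1 \<le> d - 1" "2 \<le> d - 1" using assms(1) by auto
  \<comment> \<open>The factor 2 leaves room for rounding: the bound at \<open>\<epsilon>2\<close>
    lies at least 1 below the target, so the floor of the target still exceeds it.\<close>
  from twr_absorbs_polynomial[OF e(1) assms(2), of 2 1] obtain \<epsilon>2 n1 where
    \<epsilon>2: "\<epsilon>2 > 0" "n1 \<ge> 1" "\<forall>n\<ge>n1. 2 * twr (d - 1) (real n powr \<epsilon>2) ^ 1 \<le> twr (d - 1) (real n powr \<epsilon>)"
    by (elim exE conjE)
  \<comment> \<open>Chosen for \<open>(n + 1) ^ d \<le> n ^ (2 * d)\<close>: the polynomially larger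
    parameter at exponent \<open>\<epsilon>3\<close> is bounded by \<open>n\<close> at exponent
    \<open>\<epsilon>2\<close>.\<close>
  define \<epsilon>3 where "\<epsilon>3 = \<epsilon>2 / (2 * real d)"
  have \<epsilon>3: "\<epsilon>3 > 0" using \<epsilon>2(1) assms(1) by (simp add: \<epsilon>3_def)
  from one_sided_subset_tower[OF e(2) \<epsilon>3, of s] obtain n2 where
    n2: "\<forall>n\<ge>n2. \<forall>(I :: real vec set set) (J :: nat set) A \<alpha> \<beta>. finite I \<longrightarrow> card J = d - 1 \<longrightarrow> generic J A \<alpha> I \<longrightarrow>
    twr (d - 1) (real n powr \<epsilon>3) \<le> real (card I) \<longrightarrow> one_sided_subset s n J A \<alpha> \<beta> I" by (elim exE)
  have "ereal_of_enat (OSH d s n) \<le> ereal (twr (d - 1) (real n powr \<epsilon>))"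
    if n: "n \<ge> max n1 (max n2 (d + 2))" for n
  proof -
    define x where "x = twr (d - 1) (real n powr \<epsilon>)"
    define y where "y = twr (d - 1) (real n powr \<epsilon>2)"
    define z where "z = twr (d - 1) (real ((n + 1) ^ d) powr \<epsilon>3)"
    have "1 \<le> y" unfolding y_def using n \<epsilon>2(1) by (intro twr_ge_1 powr_nat_ge_1) auto
    moreover have "2 * y \<le> x" using \<epsilon>2(3)[rule_format, of n] n by (simp add: x_def y_def)
    ultimately have yx: "y \<le> x - 1" "0 \<le> x" by linarith+
    have "2 * n \<le> n * n" using n by (intro mult_right_mono) auto
    then have "n + 1 \<le> n ^ 2" using n unfolding power2_eq_square by linarith
    then have "(n + 1) ^ d \<le> (n ^ 2) ^ d" by (rule power_mono) simp
    also have "\<dots> = n ^ (2 * d)" by (rule power_mult[symmetric])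
    finally have "real ((n + 1) ^ d) \<le> real (n ^ (2 * d))" by (simp only: of_nat_le_iff)
    then have "real ((n + 1) ^ d) powr \<epsilon>3 \<le> real (n ^ (2 * d)) powr \<epsilon>3" using \<epsilon>3 by (intro powr_mono2) auto
    also have "real (n ^ (2 * d)) = real n powr (2 * real d)" using n by (simp flip: powr_realpow)
    also have "(real n powr (2 * real d)) powr \<epsilon>3 = real n powr \<epsilon>2"
      using assms(1) by (simp add: powr_powr \<epsilon>3_def)
    finally have "z \<le> y" unfolding z_def y_def by (rule twr_mono)
    define N where "N = nat \<lfloor>x\<rfloor>"
    have N: "z \<le> real N" "real N \<le> x" using yx \<open>z \<le> y\<close> unfolding N_def by linarith+
    have "one_sided d s n N"
      unfolding one_sided_def
    proof (intro allI impI, elim conjE)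
      fix H assume H: "general_position d H" "card H = N"
      have "1 \<le> d" using assms(1) by simp
      from general_position_arrangement[OF H(1) this] obtain a b where "arrangement d H a b" .
      then interpret arrangement d H a b .
      have "n \<le> (n + 1) ^ d" using self_le_power[of "n + 1" d] \<open>1 \<le> d\<close> by simp
      then have "n2 \<le> (n + 1) ^ d" using n by simp
      moreover have "card J = d - 1" by simp
      moreover have "twr (d - 1) (real ((n + 1) ^ d) powr \<epsilon>3) \<le> real (card H)" using N(1) H(2) by (simp add: z_def)
      ultimately have "one_sided_subset s ((n + 1) ^ d) J A \<alpha> b H"
        using n2[rule_format, OF _ finite_H _ generic_H] by simp
      then show "(\<exists>S\<subseteq>H. card S = s \<and> vertices_above d S) \<or> (\<exists>S\<subseteq>H. card S = n \<and> vertices_below d S)"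
        by (rule one_sided_if_one_sided_subset) (use n in simp)
    qed
    then have "OSH d s n \<le> enat N" unfolding OSH_def by (intro Inf_lower) blast
    then have "ereal_of_enat (OSH d s n) \<le> ereal_of_enat (enat N)" by (simp only: ereal_of_enat_le_iff)
    also have "\<dots> \<le> ereal x" using N(2) by simp
    finally show ?thesis by (simp add: x_def)
  qed
  then show ?thesis by (intro exI[of _ "max n1 (max n2 (d + 2))"]) simp
qed

theorem theorem16:
  shows "(\<forall>s::nat. s \<ge> 4 \<longrightarrow>
            (\<forall>\<epsilon>::real. \<epsilon> > 0 \<longrightarrow>
              (\<exists>n0::nat. \<forall>n::nat. n \<ge> n0 \<longrightarrow>
                ereal_of_enat (OSH 3 s n) \<le> ereal (2 powr (real n powr \<epsilon>)))))
       \<and> (\<forall>d s::nat. d \<ge> 4 \<and> s \<ge> d + 1 \<longrightarrow>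
            (\<forall>\<epsilon>::real. \<epsilon> > 0 \<longrightarrow>
              (\<exists>n0::nat. \<forall>n::nat. n \<ge> n0 \<longrightarrow>
                ereal_of_enat (OSH d s n) \<le> ereal (twr (d - 1) (real n powr \<epsilon>)))))"
proof (intro conjI allI impI, goal_cases)
  case (1 s \<epsilon>)
  have "twr (3 - 1) x = 2 powr x" for x by (simp add: numeral_2_eq_2)
  with OSH_le_twr[of 3 \<epsilon> s] 1 show ?case by simp
next
  case (2 d s \<epsilon>)
  then show ?case using OSH_le_twr[of d \<epsilon> s] by simp
qed

end
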